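(* Let $(M,g)$ be a compact Riemannian manifold of dimension $m$. There exists a constant $c_1=c_1(M,g)>0$ such that for every $k\ge 1$ and every $f\in C^1(M,\mathbb{R}^k)$, $$b(Z(f))\le c_1\cdot\left(\frac{\|f\|_{C^1}}{\operatorname{dist}_{C^1}(f,\Delta)}\right)^m .$$
   Context: Manifolds are smooth. $b(\cdot)$ denotes the sum of the Betti numbers of a topological space. For $f=(f_1,\dots,f_k)\in C^1(M,\mathbb{R}^k)$, $Z(f)=\{x\in M: f_1(x)=\dots=f_k(x)=0\}$. The $C^1$-norm is $\|f\|_{C^1}=\max_{x\in M}\big(\|f(x)\|+\|D_xf\|\big)$, where $\|f(x)\|$ is the Euclidean norm and $\|D_xf\|=\max_{v\in T_xM,\ \|v\|_{g}=1}\|D_xf(v)\|$. The discriminant is $\Delta=\{f\in C^1(M,\mathbb{R}^k): \exists x\in M,\ f(x)=0,\ \mathrm{rk}(D_xf)<k\}$, and $\operatorname{dist}_{C^1}(f,\Delta)=\inf_{h\in\Delta}\|f-h\|_{C^1}$. When $\operatorname{dist}_{C^1}(f,\Delta)=0$ the right-hand side is read as $+\infty$ (the inequality is then vacuous). *)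

theory Defs
  imports "HOL-Analysis.Analysis" "HOL-Homology.Homology" "HOL-Library.Function_Algebras"
begin

section \<open>Smooth manifolds\<close>

fun Ck_on :: "nat \<Rightarrow> ('e::real_normed_vector \<Rightarrow> 'f::real_normed_vector) \<Rightarrow> 'e set \<Rightarrow> bool" where
  "Ck_on 0 f S \<longleftrightarrow> continuous_on S f"
| "Ck_on (Suc n) f S \<longleftrightarrow>
     (\<forall>x\<in>S. f differentiable (at x)) \<and> (\<forall>v. Ck_on n (\<lambda>x. frechet_derivative f (at x) v) S)"

definition smooth_on :: "('e::real_normed_vector \<Rightarrow> 'f::real_normed_vector) \<Rightarrow> 'e set \<Rightarrow> bool" where
  "smooth_on f S \<longleftrightarrow> (\<forall>n. Ck_on n f S)"

text \<open>The model space \<open>'e\<close> plays the role of Euclidean \<open>m\<close>-space. The class \<open>euclidean_space\<close>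
  excludes dimension 0, so \<open>'e\<close> is only required to be a real inner product space, and
  \<open>smooth_manifold\<close> below requires it to have finite dimension \<open>m\<close>. The class \<open>heine_borel\<close> is no
  further restriction, since every finite-dimensional inner product space satisfies it.
  Only the values of a chart map on its domain are meaningful.\<close>

type_synonym ('a, 'e) chart = "'a set \<times> ('a \<Rightarrow> 'e)"

definition chart_image :: "('a, 'e) chart \<Rightarrow> 'e set" where
  "chart_image c = snd c ` fst c"

definition chart_inv :: "('a, 'e) chart \<Rightarrow> 'e \<Rightarrow> 'a" where
  "chart_inv c = inv_into (fst c) (snd c)"

definition transition :: "('a, 'e) chart \<Rightarrow> ('a, 'e) chart \<Rightarrow> 'e \<Rightarrow> 'e" where
  "transition c d = snd d \<circ> chart_inv c"

definition is_chart :: "'a topology \<Rightarrow> ('a, 'e::{real_inner, heine_borel}) chart \<Rightarrow> bool" where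
  "is_chart X c \<longleftrightarrow> openin X (fst c) \<and> open (chart_image c) \<and>
     homeomorphic_map (subtopology X (fst c)) (top_of_set (chart_image c)) (snd c)"

definition smooth_atlas :: "'a topology \<Rightarrow> ('a, 'e::{real_inner, heine_borel}) chart set \<Rightarrow> bool" where
  "smooth_atlas X A \<longleftrightarrow>
     (\<forall>c\<in>A. is_chart X c) \<and> (\<Union>c\<in>A. fst c) = topspace X \<and>
     (\<forall>c\<in>A. \<forall>d\<in>A. smooth_on (transition c d) (snd c ` (fst c \<inter> fst d)))"

definition smooth_manifold ::
  "nat \<Rightarrow> 'a topology \<Rightarrow> ('a, 'e::{real_inner, heine_borel}) chart set \<Rightarrow> bool" where
  "smooth_manifold m X A \<longleftrightarrow>
     (\<exists>B. finite B \<and> span B = (UNIV :: 'e set)) \<and> dim (UNIV :: 'e set) = m \<and>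
     Hausdorff_space X \<and> second_countable X \<and> smooth_atlas X A"

section \<open>Tangent vectors and Riemannian metrics\<close>

definition charts_at :: "('a, 'e) chart set \<Rightarrow> 'a \<Rightarrow> ('a, 'e) chart set" where
  "charts_at A p = {c \<in> A. p \<in> fst c}"

text \<open>A tangent vector at \<open>p\<close> is the family of its coordinate vectors in all charts around \<open>p\<close>,
  which are related by the derivatives of the transition maps. The value \<open>0\<close> at all other charts
  makes the representation unique.\<close>

type_synonym ('a, 'e) tvector = "('a, 'e) chart \<Rightarrow> 'e"

definition tangent_space ::
  "('a, 'e::{real_inner, heine_borel}) chart set \<Rightarrow> 'a \<Rightarrow> ('a, 'e) tvector set" where
  "tangent_space A p = {v.
     (\<forall>c\<in>charts_at A p. \<forall>d\<in>charts_at A p.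
        v d = frechet_derivative (transition c d) (at (snd c p)) (v c)) \<and>
     (\<forall>c. c \<notin> charts_at A p \<longrightarrow> v c = 0)}"

text \<open>The tangent vector at \<open>p\<close> whose coordinate vector in the chart \<open>c\<close> is \<open>e\<close>.\<close>

definition coord_vector ::
  "('a, 'e::{real_inner, heine_borel}) chart set \<Rightarrow> ('a, 'e) chart \<Rightarrow> 'a \<Rightarrow> 'e \<Rightarrow> ('a, 'e) tvector" where
  "coord_vector A c p e = (\<lambda>d. if d \<in> charts_at A p
     then frechet_derivative (transition c d) (at (snd c p)) e else 0)"

definition riemannian_metric ::
  "'a topology \<Rightarrow> ('a, 'e::{real_inner, heine_borel}) chart set \<Rightarrow>
   ('a \<Rightarrow> ('a, 'e) tvector \<Rightarrow> ('a, 'e) tvector \<Rightarrow> real) \<Rightarrow> bool" where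
  "riemannian_metric X A g \<longleftrightarrow>
     (\<forall>p\<in>topspace X. \<forall>u\<in>tangent_space A p. \<forall>v\<in>tangent_space A p.
        g p u v = g p v u \<and>
        (\<forall>w\<in>tangent_space A p. g p (\<lambda>c. u c + w c) v = g p u v + g p w v) \<and>
        (\<forall>a. g p (\<lambda>c. a *\<^sub>R u c) v = a * g p u v) \<and>
        (u \<noteq> (\<lambda>c. 0) \<longrightarrow> 0 < g p u u)) \<and>
     (\<forall>c\<in>A. \<forall>e e'. smooth_on
        (\<lambda>y. g (chart_inv c y) (coord_vector A c (chart_inv c y) e) (coord_vector A c (chart_inv c y) e'))
        (chart_image c))"

section \<open>Maps of class \<open>C\<^sup>1\<close> and the discriminant\<close>

text \<open>Since the constant of the theorem does not depend on \<open>k\<close>, the target space has to be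
  indexed by a number rather than by a type: it is the carrier of \<open>Euclidean_space k\<close>, the set of
  real sequences vanishing from index \<open>k\<close> on, with the Euclidean norm \<open>\<lambda>y. L2_set y {..<k}\<close>.\<close>

definition C1_maps ::
  "'a topology \<Rightarrow> ('a, 'e::{real_inner, heine_borel}) chart set \<Rightarrow> nat \<Rightarrow> ('a \<Rightarrow> nat \<Rightarrow> real) set" where
  "C1_maps X A k = {f. (\<forall>x\<in>topspace X. f x \<in> topspace (Euclidean_space k)) \<and>
     (\<forall>c\<in>A. \<forall>i<k. Ck_on 1 (\<lambda>y. f (chart_inv c y) i) (chart_image c))}"

definition zero_set :: "'a topology \<Rightarrow> nat \<Rightarrow> ('a \<Rightarrow> nat \<Rightarrow> real) \<Rightarrow> 'a set" where
  "zero_set X k f = {x \<in> topspace X. \<forall>i<k. f x i = 0}"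

text \<open>The derivative of a map into \<open>Euclidean_space k\<close> at \<open>x\<close>, applied to a tangent vector; the
  result is independent of the chart, so an arbitrary one is chosen.\<close>

definition differential ::
  "('a, 'e::{real_inner, heine_borel}) chart set \<Rightarrow> nat \<Rightarrow> ('a \<Rightarrow> nat \<Rightarrow> real) \<Rightarrow>
   'a \<Rightarrow> ('a, 'e) tvector \<Rightarrow> nat \<Rightarrow> real" where
  "differential A k f x v = (let c = (SOME c. c \<in> charts_at A x) in
     (\<lambda>i. if i < k then frechet_derivative (\<lambda>y. f (chart_inv c y) i) (at (snd c x)) (v c) else 0))"

lemma vector_space_real_sequences: "vector_space (\<lambda>(a::real) (y::nat \<Rightarrow> real) i. a * y i)"
  by unfold_locales (auto simp: algebra_simps fun_eq_iff)

definition diff_rank ::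
  "('a, 'e::{real_inner, heine_borel}) chart set \<Rightarrow> nat \<Rightarrow> ('a \<Rightarrow> nat \<Rightarrow> real) \<Rightarrow> 'a \<Rightarrow> nat" where
  "diff_rank A k f x = vector_space.dim (\<lambda>(a::real) (y::nat \<Rightarrow> real) i. a * y i)
     (differential A k f x ` tangent_space A x)"

definition discriminant ::
  "'a topology \<Rightarrow> ('a, 'e::{real_inner, heine_borel}) chart set \<Rightarrow> nat \<Rightarrow> ('a \<Rightarrow> nat \<Rightarrow> real) set" where
  "discriminant X A k =
     {f \<in> C1_maps X A k. \<exists>x\<in>topspace X. (\<forall>i<k. f x i = 0) \<and> diff_rank A k f x < k}"

text \<open>Norms and distances are taken in \<open>ennreal\<close>, where the suprema below are \<open>0\<close> over the empty
  set (no unit tangent vectors in dimension 0) and the infimum is \<open>\<infinity>\<close> over the empty set. On a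
  compact manifold the suprema are attained and finite.\<close>

definition diff_norm ::
  "('a, 'e::{real_inner, heine_borel}) chart set \<Rightarrow>
   ('a \<Rightarrow> ('a, 'e) tvector \<Rightarrow> ('a, 'e) tvector \<Rightarrow> real) \<Rightarrow> nat \<Rightarrow> ('a \<Rightarrow> nat \<Rightarrow> real) \<Rightarrow> 'a \<Rightarrow> ennreal" where
  "diff_norm A g k f x = (SUP v\<in>{v \<in> tangent_space A x. sqrt (g x v v) = 1}.
     ennreal (L2_set (differential A k f x v) {..<k}))"

definition C1_norm ::
  "'a topology \<Rightarrow> ('a, 'e::{real_inner, heine_borel}) chart set \<Rightarrow>
   ('a \<Rightarrow> ('a, 'e) tvector \<Rightarrow> ('a, 'e) tvector \<Rightarrow> real) \<Rightarrow> nat \<Rightarrow> ('a \<Rightarrow> nat \<Rightarrow> real) \<Rightarrow> ennreal" where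
  "C1_norm X A g k f = (SUP x\<in>topspace X. ennreal (L2_set (f x) {..<k}) + diff_norm A g k f x)"

definition dist_discriminant ::
  "'a topology \<Rightarrow> ('a, 'e::{real_inner, heine_borel}) chart set \<Rightarrow>
   ('a \<Rightarrow> ('a, 'e) tvector \<Rightarrow> ('a, 'e) tvector \<Rightarrow> real) \<Rightarrow> nat \<Rightarrow> ('a \<Rightarrow> nat \<Rightarrow> real) \<Rightarrow> ennreal" where
  "dist_discriminant X A g k f =
     (INF h\<in>discriminant X A k. C1_norm X A g k (\<lambda>x i. f x i - h x i))"

section \<open>Betti numbers\<close>

text \<open>The rank of an abelian group: the largest number of elements that are linearly independent
  over the integers.\<close>

definition ab_rank :: "('a, 'b) monoid_scheme \<Rightarrow> enat" where
  "ab_rank G = (SUP B\<in>{B. finite B \<and> B \<subseteq> carrier G \<and>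
     (\<forall>n::'a \<Rightarrow> int. finprod G (\<lambda>b. b [^]\<^bsub>G\<^esub> n b) B = \<one>\<^bsub>G\<^esub> \<longrightarrow> (\<forall>b\<in>B. n b = 0))}. enat (card B))"

text \<open>\<open>homology_group\<close> is singular homology with integer coefficients.\<close>

definition betti :: "nat \<Rightarrow> 'a topology \<Rightarrow> enat" where
  "betti p X = ab_rank (homology_group (int p) X)"

definition total_betti :: "'a topology \<Rightarrow> ennreal" where
  "total_betti X = suminf (\<lambda>p. ennreal_of_enat (betti p X))"

end

theory Submission
  imports Defs
begin

text \<open>Write \<open>\<delta>\<close> for the distance of \<open>f\<close> from the discriminant and \<open>L\<close> for its \<open>C\<^sup>1\<close>-norm. Subtracting the
  constant \<open>f x\<close> from \<open>f\<close> shows that \<open>D\<^sub>xf\<close> is onto wherever \<open>\<bar>f x\<bar> < \<delta>\<close>. Hence small Newton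
  steps, cut off in charts and iterated, retract \<open>U = {\<bar>f\<bar> \<le> \<delta>/2}\<close> onto the zero set \<open>Z\<close>; only the
  existence of this retraction matters, so no modulus of continuity of \<open>Df\<close> is needed.

  Embed \<open>M\<close> into a normed space such that a neighbourhood of the image retracts onto it with
  Lipschitz control. As \<open>f\<close> is Lipschitz with a constant proportional to \<open>L\<close>, for
  \<open>\<epsilon> = h \<delta> / L\<close> with a suitable \<open>h\<close> depending only on \<open>(M, g)\<close> the \<open>\<epsilon>\<close>-neighbourhood of \<open>Z\<close> retracts
  into \<open>U\<close>. So \<open>Z\<close> is a retract of the union \<open>P\<close> of the \<open>\<epsilon>\<close>-balls around a maximal \<open>\<epsilon>\<close>-separated
  subset of \<open>Z\<close>, and the homology of \<open>Z\<close> embeds into that of \<open>P\<close>. There are at most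
  \<open>const \<cdot> \<epsilon>\<^sup>-\<^sup>m\<close> balls, each of them meets a bounded number of others, and by convexity the
  total Betti number of \<open>P\<close> is at most the number of simplices of the nerve.\<close>

section \<open>Ranks of abelian groups\<close>

text \<open>Since \<open>f\<close> is only of class C1, a vector field built from its derivative to
  decrease |f| need not be Lipschitz, and its flow need not be unique; discrete steps with uniformly
  convergent iterates avoid flows. The tolerances of these steps depend on k and f, which is
  harmless because it never matters how far the retraction moves points. The constant comes only
  from the embedding, from packing bounds in charts and from the Lipschitz estimate; these see f
  through \<delta> and L alone, so it does not depend on k. The ambient space is there for
  convexity: intersections of its balls are convex, hence contractible, which spares the geometry of
  geodesic balls. The price is that the balls leave M, so the neighbourhood retraction has to bring
  their points back close enough to Z for |f| \<le> \<delta>/2. No homotopy from the retraction to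
  the identity is needed, since a left inverse already makes the inclusion injective on homology.
  Substituting \<epsilon> = h \<delta> / L into a bound const / \<epsilon>^m gives the power of L /
  \<delta> in the theorem.\<close>

definition lincomb :: "('a, 'b) monoid_scheme \<Rightarrow> ('i \<Rightarrow> 'a) \<Rightarrow> ('i \<Rightarrow> int) \<Rightarrow> 'i set \<Rightarrow> 'a" where
  "lincomb G a n I = finprod G (\<lambda>i. a i [^]\<^bsub>G\<^esub> n i) I"

text \<open>Families instead of sets let the images of independent elements under a homomorphism be
  tested before they are known to be distinct; \<open>card_le_ab_rank\<close> returns to
  sets.\<close>

definition indep_family :: "('a, 'b) monoid_scheme \<Rightarrow> ('i \<Rightarrow> 'a) \<Rightarrow> 'i set \<Rightarrow> bool" where
  "indep_family G a I \<longleftrightarrow> (\<forall>n. lincomb G a n I = \<one>\<^bsub>G\<^esub> \<longrightarrow> (\<forall>i\<in>I. n i = 0))"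

lemma ab_rank_alt:
  "ab_rank G = (SUP B\<in>{B. finite B \<and> B \<subseteq> carrier G \<and> indep_family G (\<lambda>b. b) B}. enat (card B))"
  by (simp add: ab_rank_def indep_family_def lincomb_def)

section \<open>Integer linear combinations and independent families\<close>

context comm_group
begin

lemma lincomb_closed [simp]: "a \<in> I \<rightarrow> carrier G \<Longrightarrow> lincomb G a n I \<in> carrier G"
  unfolding lincomb_def by (intro finprod_closed) auto

lemma lincomb_add:
  assumes "a \<in> I \<rightarrow> carrier G"
  shows "lincomb G a (\<lambda>i. n i + k i) I = lincomb G a n I \<otimes> lincomb G a k I"
proof -
  have "lincomb G a (\<lambda>i. n i + k i) I = finprod G (\<lambda>i. a i [^] n i \<otimes> a i [^] k i) I"
    unfolding lincomb_def using assms by (intro finprod_cong') (auto simp: int_pow_mult Pi_iff)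
  also have "\<dots> = lincomb G a n I \<otimes> lincomb G a k I"
    unfolding lincomb_def using assms by (intro finprod_multf) auto
  finally show ?thesis .
qed

lemma lincomb_pow:
  assumes a: "a \<in> I \<rightarrow> carrier G" and I: "finite I"
  shows "lincomb G a n I [^] (k::int) = lincomb G a (\<lambda>i. k * n i) I"
  using I a
proof (induction I rule: finite_induct)
  case empty
  then show ?case by (simp add: lincomb_def)
next
  case (insert x F)
  then have "lincomb G a n (insert x F) = a x [^] n x \<otimes> lincomb G a n F"
    unfolding lincomb_def by (subst finprod_insert) auto
  moreover have "lincomb G a (\<lambda>i. k * n i) (insert x F) = a x [^] (k * n x) \<otimes> lincomb G a (\<lambda>i. k * n i) F"
    using insert unfolding lincomb_def by (subst finprod_insert) auto
  ultimately show ?case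
    using insert by (simp add: int_pow_distrib int_pow_pow mult.commute)
qed

lemma lincomb_lincomb:
  assumes a: "a \<in> I \<rightarrow> carrier G" and I: "finite I" and J: "finite J"
  shows "lincomb G (\<lambda>j. lincomb G a (n j) I) k J = lincomb G a (\<lambda>i. \<Sum>j\<in>J. k j * n j i) I"
  using J
proof (induction J rule: finite_induct)
  case empty
  then show ?case using a by (simp add: lincomb_def)
next
  case (insert x F)
  have "lincomb G (\<lambda>j. lincomb G a (n j) I) k (insert x F)
        = lincomb G a (n x) I [^] k x \<otimes> lincomb G (\<lambda>j. lincomb G a (n j) I) k F"
    unfolding lincomb_def[of G "\<lambda>j. lincomb G a (n j) I"]
    using insert a by (subst finprod_insert) auto
  also have "\<dots> = lincomb G a (\<lambda>i. k x * n x i + (\<Sum>j\<in>F. k j * n j i)) I"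
    using insert a I by (simp add: lincomb_pow lincomb_add)
  finally show ?case using insert by simp
qed

lemma lincomb_mono_neutral:
  assumes a: "a \<in> I \<rightarrow> carrier G" and I: "finite I" and "J \<subseteq> I" and "\<And>i. i \<in> I - J \<Longrightarrow> n i = 0"
  shows "lincomb G a n I = lincomb G a n J"
  unfolding lincomb_def using assms
  by (intro finprod_mono_neutral_cong_right) auto

lemma lincomb_diff:
  assumes a: "a \<in> I \<rightarrow> carrier G" and I: "finite I" and "i \<in> I" "j \<in> I" "i \<noteq> j"
  shows "lincomb G a (\<lambda>l. if l = i then 1 else if l = j then -1 else 0) I = a i \<otimes> inv (a j)"
proof -
  let ?n = "\<lambda>l. if l = i then 1 else if l = j then -1 else (0::int)"
  have "lincomb G a ?n I = lincomb G a ?n {i,j}"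
    using assms by (intro lincomb_mono_neutral) auto
  also have "\<dots> = a i \<otimes> inv (a j)"
    using assms unfolding lincomb_def by (auto simp: int_pow_neg Pi_iff)
  finally show ?thesis .
qed

text \<open>If two indices had the same value, coefficients 1 and -1 at them would form a nontrivial
  relation.\<close>

lemma indep_family_inj_on:
  assumes a: "a \<in> I \<rightarrow> carrier G" and I: "finite I" and "indep_family G a I"
  shows "inj_on a I"
proof (rule inj_onI, rule ccontr)
  fix i j assume "i \<in> I" "j \<in> I" "a i = a j" "i \<noteq> j"
  then have "lincomb G a (\<lambda>l. if l = i then 1 else if l = j then -1 else 0) I = \<one>"
    using a by (subst lincomb_diff[OF a I]) (auto simp: Pi_iff)
  then show False
    using assms \<open>i \<in> I\<close> unfolding indep_family_def by fastforce
qed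

lemma card_le_ab_rank:
  assumes a: "a \<in> I \<rightarrow> carrier G" and I: "finite I" and ind: "indep_family G a I"
  shows "enat (card I) \<le> ab_rank G"
proof -
  have inj: "inj_on a I" by (rule indep_family_inj_on[OF assms])
  have "indep_family G (\<lambda>b. b) (a ` I)"
    unfolding indep_family_def
  proof (intro allI impI ballI)
    fix n b assume "lincomb G (\<lambda>b. b) n (a ` I) = \<one>" and b: "b \<in> a ` I"
    moreover have "lincomb G (\<lambda>b. b) n (a ` I) = lincomb G a (n \<circ> a) I"
      unfolding lincomb_def using a inj by (subst finprod_reindex) auto
    ultimately have "\<forall>i\<in>I. (n \<circ> a) i = 0"
      using ind unfolding indep_family_def by metis
    then show "n b = 0" using b by auto
  qed
  then have "enat (card (a ` I)) \<le> ab_rank G"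
    unfolding ab_rank_alt using a I by (intro SUP_upper) auto
  then show ?thesis using card_image[OF inj] by simp
qed

end

lemma hom_lincomb:
  assumes "comm_group G" "comm_group H" and h: "h \<in> hom G H"
    and a: "a \<in> I \<rightarrow> carrier G" and I: "finite I"
  shows "h (lincomb G a n I) = lincomb H (h \<circ> a) n I"
proof -
  interpret G: comm_group G by fact
  interpret H: comm_group H by fact
  interpret group_hom G H h by unfold_locales (rule h)
  show ?thesis
    using I a
  proof (induction I rule: finite_induct)
    case empty
    then show ?case by (simp add: lincomb_def)
  next
    case (insert x F)
    then have "lincomb G a n (insert x F) = a x [^]\<^bsub>G\<^esub> n x \<otimes>\<^bsub>G\<^esub> lincomb G a n F"
      unfolding lincomb_def by (subst G.finprod_insert) auto
    moreover have "lincomb H (h \<circ> a) n (insert x F) = h (a x) [^]\<^bsub>H\<^esub> n x \<otimes>\<^bsub>H\<^esub> lincomb H (h \<circ> a) n F"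
      using insert unfolding lincomb_def by (subst H.finprod_insert) (auto simp: Pi_iff)
    ultimately show ?case
      using insert by (simp add: hom_int_pow comp_def)
  qed
qed

lemma ab_rank_mono:
  assumes "comm_group G" "comm_group H" and h: "h \<in> mon G H"
  shows "ab_rank G \<le> ab_rank H"
  unfolding ab_rank_alt[of G]
proof (rule SUP_least, clarsimp)
  fix B assume B: "finite B" "B \<subseteq> carrier G" "indep_family G (\<lambda>b. b) B"
  interpret G: comm_group G by fact
  interpret H: comm_group H by fact
  have hom: "h \<in> hom G H" and inj: "inj_on h (carrier G)" using h by (auto simp: mon_def)
  interpret group_hom G H h by unfold_locales (rule hom)
  have eq: "lincomb H h n B = h (lincomb G (\<lambda>b. b) n B)" for n
  proof -
    have "(\<lambda>b. b) \<in> B \<rightarrow> carrier G" using B by auto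
    from hom_lincomb[OF assms(1,2) hom this B(1), of n] show ?thesis by (simp add: comp_def)
  qed
  have "indep_family H h B"
    unfolding indep_family_def
  proof (intro allI impI)
    fix n assume "lincomb H h n B = \<one>\<^bsub>H\<^esub>"
    then have "h (lincomb G (\<lambda>b. b) n B) = h \<one>\<^bsub>G\<^esub>" by (simp add: eq)
    then have "lincomb G (\<lambda>b. b) n B = \<one>\<^bsub>G\<^esub>"
      using B by (intro inj_onD[OF inj] G.lincomb_closed) auto
    then show "\<forall>i\<in>B. n i = 0" using B unfolding indep_family_def by blast
  qed
  then show "enat (card B) \<le> ab_rank H"
    using B by (intro H.card_le_ab_rank) auto
qed

lemma ab_rank_iso:
  assumes "comm_group G" "comm_group H" and "G \<cong> H"
  shows "ab_rank G = ab_rank H"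
proof (rule antisym)
  show "ab_rank G \<le> ab_rank H"
    using assms by (auto simp: is_iso_def iso_iff_mon_epi intro: ab_rank_mono)
  have "H \<cong> G" using assms by (simp add: comm_group.axioms(2) group.iso_sym)
  then show "ab_rank H \<le> ab_rank G"
    using assms by (auto simp: is_iso_def iso_iff_mon_epi intro: ab_rank_mono)
qed

text \<open>A maximal subset \<open>S\<close> of an independent set \<open>B\<close> with independent image in \<open>K\<close> is counted by
  \<open>K\<close>; each element of \<open>B - S\<close> is, up to a multiple and modulo \<open>S\<close>, in the kernel.\<close>

lemma ab_rank_exact:
  assumes "comm_group G" "comm_group H" "comm_group K"
    and f: "f \<in> hom G H" and h: "h \<in> hom H K"
    and exact: "kernel H K h \<subseteq> f ` carrier G"
  shows "ab_rank H \<le> ab_rank G + ab_rank K"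
  unfolding ab_rank_alt[of H]
proof (rule SUP_least, clarsimp)
  fix B assume B: "finite B" "B \<subseteq> carrier H" "indep_family H (\<lambda>b. b) B"
  interpret G: comm_group G by fact
  interpret H: comm_group H by fact
  interpret K: comm_group K by fact
  have B1: "(\<lambda>b. b) \<in> B \<rightarrow> carrier H" using B by auto
  define \<S> where "\<S> = {S. S \<subseteq> B \<and> indep_family K h S}"
  have "finite \<S>" unfolding \<S>_def using B(1) by auto
  moreover have "{} \<in> \<S>" unfolding \<S>_def by (auto simp: indep_family_def)
  ultimately obtain S where S: "S \<in> \<S>" and max: "\<And>T. T \<in> \<S> \<Longrightarrow> S \<subseteq> T \<Longrightarrow> T = S"
    using finite_has_maximal[of \<S>] by (metis empty_iff)
  have SB: "S \<subseteq> B" and Sind: "indep_family K h S" and finS: "finite S"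
    using S B(1) unfolding \<S>_def by (auto intro: finite_subset)
  have cardS: "enat (card S) \<le> ab_rank K"
    using SB B hom_in_carrier[OF h] finS Sind by (intro K.card_le_ab_rank) auto
  have "\<exists>n c. c \<in> carrier G \<and> n s \<noteq> 0 \<and> (\<forall>i. i \<notin> insert s S \<longrightarrow> n i = 0) \<and> f c = lincomb H (\<lambda>b. b) n B"
    if s: "s \<in> B - S" for s
  proof -
    have "insert s S \<notin> \<S>" using max[of "insert s S"] s by auto
    then have "\<not> indep_family K h (insert s S)" using s SB by (auto simp: \<S>_def)
    then obtain n i where n: "lincomb K h n (insert s S) = \<one>\<^bsub>K\<^esub>" "i \<in> insert s S" "n i \<noteq> 0"
      unfolding indep_family_def by blast
    have hT: "h \<in> insert s S \<rightarrow> carrier K" using s SB B hom_in_carrier[OF h] by auto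
    have "n s \<noteq> 0"
    proof
      assume ns: "n s = 0"
      have "lincomb K h n (insert s S) = lincomb K h n S"
        using hT finS s ns by (intro K.lincomb_mono_neutral) auto
      then show False using n ns Sind s unfolding indep_family_def by (metis insertE)
    qed
    define n' where "n' = (\<lambda>i. if i \<in> insert s S then n i else 0)"
    have "lincomb H (\<lambda>b. b) n' B = lincomb H (\<lambda>b. b) n' (insert s S)"
      using B1 B(1) SB s by (intro H.lincomb_mono_neutral) (auto simp: n'_def)
    also have "\<dots> = lincomb H (\<lambda>b. b) n (insert s S)"
      unfolding lincomb_def using s SB B by (intro H.finprod_cong') (auto simp: n'_def)
    finally have eq: "lincomb H (\<lambda>b. b) n' B = lincomb H (\<lambda>b. b) n (insert s S)" .
    have "h (lincomb H (\<lambda>b. b) n (insert s S)) = lincomb K h n (insert s S)"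
      using hom_lincomb[OF assms(2,3) h, of "\<lambda>b. b" "insert s S" n] s SB B finS
      by (auto simp: comp_def)
    then have "lincomb H (\<lambda>b. b) n' B \<in> kernel H K h"
      using n(1) H.lincomb_closed[OF B1, of n'] unfolding kernel_def eq by simp
    then obtain c where "c \<in> carrier G" "f c = lincomb H (\<lambda>b. b) n' B"
      using exact by auto
    then show ?thesis
      using \<open>n s \<noteq> 0\<close> by (intro exI[of _ n'] exI[of _ c]) (auto simp: n'_def)
  qed
  then obtain n c where c: "\<And>s. s \<in> B - S \<Longrightarrow> c s \<in> carrier G"
    and ns: "\<And>s. s \<in> B - S \<Longrightarrow> n s s \<noteq> (0::int)"
    and n0: "\<And>s i. s \<in> B - S \<Longrightarrow> i \<notin> insert s S \<Longrightarrow> n s i = 0"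
    and fc: "\<And>s. s \<in> B - S \<Longrightarrow> f (c s) = lincomb H (\<lambda>b. b) (n s) B"
    by metis
  \<comment> \<open>A relation \<open>k\<close> among the \<open>c s\<close> maps to a relation
    among the elements of \<open>B\<close>. Its coefficient at \<open>s\<close> in
    \<open>B - S\<close> is \<open>k s * n s s\<close>, because every other \<open>n j\<close>
    vanishes there; so \<open>k s\<close> is 0.\<close>
  have "indep_family G c (B - S)"
    unfolding indep_family_def
  proof (intro allI impI ballI)
    fix k s assume k: "lincomb G c k (B - S) = \<one>\<^bsub>G\<^esub>" and s: "s \<in> B - S"
    have "\<one>\<^bsub>H\<^esub> = f (lincomb G c k (B - S))"
      using k f hom_one[OF f] by simp
    also have "\<dots> = lincomb H (f \<circ> c) k (B - S)"
      using B c by (intro hom_lincomb[OF assms(1,2) f]) auto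
    also have "\<dots> = lincomb H (\<lambda>s. lincomb H (\<lambda>b. b) (n s) B) k (B - S)"
      unfolding lincomb_def[of _ "f \<circ> c"] lincomb_def[of _ "\<lambda>s. lincomb H (\<lambda>b. b) (n s) B"]
      using fc B1 by (intro H.finprod_cong') auto
    also have "\<dots> = lincomb H (\<lambda>b. b) (\<lambda>i. \<Sum>j\<in>B - S. k j * n j i) B"
      using B B1 by (intro H.lincomb_lincomb) auto
    finally have "(\<Sum>j\<in>B - S. k j * n j s) = 0"
      using B(3) s unfolding indep_family_def by (metis DiffD1)
    moreover have "(\<Sum>j\<in>B - S. k j * n j s) = (\<Sum>j\<in>{s}. k j * n j s)"
      using s B(1) n0 by (intro sum.mono_neutral_right) auto
    ultimately show "k s = 0" using ns s by simp
  qed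
  then have "enat (card (B - S)) \<le> ab_rank G"
    using B c by (intro G.card_le_ab_rank) auto
  moreover have "card B = card (B - S) + card S"
    using SB B(1) by (metis card_Diff_subset card_mono finS le_add_diff_inverse2)
  ultimately show "enat (card B) \<le> ab_rank G + ab_rank K"
    using cardS by (simp add: add_mono flip: plus_enat_simps(1))
qed

lemma ab_rank_trivial:
  assumes "comm_group G" "trivial_group G"
  shows "ab_rank G = 0"
proof -
  interpret comm_group G by fact
  have "card B = 0" if "finite B" "B \<subseteq> carrier G" "indep_family G (\<lambda>b. b) B" for B
  proof (rule ccontr)
    assume "card B \<noteq> 0"
    then obtain b where "b \<in> B" by fastforce
    moreover have "lincomb G (\<lambda>b. b) (\<lambda>_. 1) B = \<one>\<^bsub>G\<^esub>"
    proof -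
      have "(\<lambda>b. b) \<in> B \<rightarrow> carrier G" using that by auto
      then have "lincomb G (\<lambda>b. b) (\<lambda>_. 1) B \<in> carrier G" by simp
      then show ?thesis using assms(2) by (simp add: trivial_group_def)
    qed
    ultimately have "(1::int) = 0" using that(3) unfolding indep_family_def by metis
    then show False by simp
  qed
  then have "ab_rank G \<le> 0"
    unfolding ab_rank_alt by (intro SUP_least) (auto simp: zero_enat_def)
  then show ?thesis by simp
qed

lemma ab_rank_integer_group: "ab_rank integer_group \<le> 1"
  unfolding ab_rank_alt
proof (rule SUP_least, clarsimp)
  fix B :: "int set" assume B: "finite B" "indep_family integer_group (\<lambda>b. b) B"
  interpret comm_group integer_group by (rule abelian_integer_group)
  have "card B \<le> 1"
  proof (rule ccontr)
    assume "\<not> card B \<le> 1"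
    then obtain x y where xy: "x \<in> B" "y \<in> B" "x \<noteq> y"
      by (metis B(1) One_nat_def card_le_Suc0_iff_eq)
    \<comment> \<open>For distinct integers, \<open>x * y - y * x = 0\<close> is a relation whose
      coefficients are not both 0.\<close>
    define n where "n = (\<lambda>b. if b = x then y else if b = y then - x else 0)"
    have "lincomb integer_group (\<lambda>b. b) n B = lincomb integer_group (\<lambda>b. b) n {x, y}"
      using xy B by (intro lincomb_mono_neutral) (auto simp: n_def)
    also have "\<dots> = 0"
      using xy unfolding lincomb_def by (simp add: n_def)
    finally have "n x = 0" "n y = 0"
      using B xy unfolding indep_family_def by auto
    then show False using xy by (auto simp: n_def)
  qed
  then show "enat (card B) \<le> 1" by (simp add: one_enat_def)
qed

section \<open>Betti numbers of unions of convex sets\<close>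

lemma suminf_ennreal_of_enat_mono:
  "(\<And>p. a p \<le> b p) \<Longrightarrow> suminf (\<lambda>p. ennreal_of_enat (a p)) \<le> suminf (\<lambda>p. ennreal_of_enat (b p))"
  by (intro suminf_le) auto

lemma ennreal_of_enat_add: "ennreal_of_enat (a + b) = ennreal_of_enat a + ennreal_of_enat b"
  by (cases a; cases b) auto

text \<open>A left inverse of \<open>i\<close> induces a left inverse in homology, so
  \<open>i\<close> is injective there in every degree.\<close>

lemma total_betti_section_map:
  assumes "section_map X Y i"
  shows "total_betti X \<le> total_betti Y"
  unfolding total_betti_def betti_def
  by (intro suminf_ennreal_of_enat_mono
      ab_rank_mono[OF abelian_homology_group abelian_homology_group mon_hom_induced_section_map[OF assms]])

lemma betti_eq_0_if_trivial: "trivial_group (homology_group (int p) X) \<Longrightarrow> betti p X = 0"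
  unfolding betti_def by (rule ab_rank_trivial[OF abelian_homology_group])

lemma betti_cong: "homology_group (int p) X \<cong> homology_group (int p) Y \<Longrightarrow> betti p X = betti p Y"
  unfolding betti_def by (rule ab_rank_iso[OF abelian_homology_group abelian_homology_group])

lemma total_betti_empty:
  assumes "topspace X = {}"
  shows "total_betti X = 0"
proof -
  have "betti p X = 0" for p
    by (intro betti_eq_0_if_trivial trivial_homology_group_empty assms)
  then show ?thesis by (simp add: total_betti_def)
qed

lemma total_betti_contractible:
  assumes "contractible_space X"
  shows "total_betti X \<le> 1"
proof (cases "topspace X = {}")
  case True
  then show ?thesis by (simp add: total_betti_empty)
next
  case False
  then obtain a where a: "a \<in> topspace X" "X homotopy_equivalent_space (subtopology X {a})"
    using assms by (auto simp: contractible_eq_homotopy_equivalent_singleton_subtopology)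
  let ?P = "subtopology X {a}"
  have eq: "betti p X = betti p ?P" for p
    by (intro betti_cong homotopy_equivalent_space_imp_isomorphic_homology_groups a(2))
  have P: "topspace ?P = {a}" using a by auto
  have 1: "betti p X = 0" if "p \<noteq> 0" for p
    unfolding eq using that by (intro betti_eq_0_if_trivial homology_dimension_axiom[OF P]) auto
  have "ab_rank (homology_group 0 ?P) = ab_rank integer_group"
    by (intro ab_rank_iso abelian_homology_group abelian_integer_group homology_coefficients[OF P])
  then have 2: "betti 0 X \<le> 1"
    unfolding eq using ab_rank_integer_group by (simp add: betti_def)
  have "total_betti X = ennreal_of_enat (betti 0 X)"
    unfolding total_betti_def using 1 by (subst suminf_finite[of "{0}"]) auto
  also have "\<dots> \<le> ennreal_of_enat 1" using 2 by (simp only: ennreal_of_enat_le_iff)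
  finally show ?thesis by (simp add: one_enat_def)
qed

text \<open>Exactness for the pair \<open>(X, T)\<close>, excision to \<open>(S, S \<inter> T)\<close>, and exactness for the latter pair
  replace the Mayer-Vietoris sequence.\<close>

lemma betti_union_open:
  assumes S: "openin X S" and T: "openin X T" and ST: "S \<union> T = topspace X"
  shows "betti p X \<le> betti p (subtopology X T) + betti p (subtopology X S)
           + (case p of 0 \<Rightarrow> 0 | Suc q \<Rightarrow> betti q (subtopology X (S \<inter> T)))"
proof -
  let ?p = "int p"
  have SX: "S \<subseteq> topspace X" and TX: "T \<subseteq> topspace X" using ST by auto
  have "ab_rank (homology_group ?p X) \<le> ab_rank (homology_group ?p (subtopology X T))
          + ab_rank (relative_homology_group ?p X T)"
  proof (rule ab_rank_exact)
    show "kernel (homology_group ?p X) (relative_homology_group ?p X T) (hom_induced ?p X {} X T id)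
        \<subseteq> hom_induced ?p (subtopology X T) {} X {} id ` carrier (homology_group ?p (subtopology X T))"
      using homology_exactness_axiom_3[of ?p X T] by simp
  qed (auto simp: abelian_homology_group hom_induced_hom)
  moreover have "ab_rank (relative_homology_group ?p X T)
      = ab_rank (relative_homology_group ?p (subtopology X S) (S \<inter> T))"
  proof (rule ab_rank_iso[symmetric])
    \<comment> \<open>The excised set is the complement of \<open>S\<close>: it is closed and
      contained in the open set \<open>T\<close>.\<close>
    have "X closure_of (topspace X - S) = topspace X - S"
      using S by (simp add: closure_of_eq closedin_def Diff_Diff_Int openin_subset inf.absorb2)
    moreover have "X interior_of T = T"
      using T by (simp add: interior_of_openin)
    ultimately have *: "X closure_of (topspace X - S) \<subseteq> X interior_of T"
      using ST by auto
    have "topspace X - (topspace X - S) = S" "T - (topspace X - S) = S \<inter> T"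
      using SX TX by auto
    then have "relative_homology_group ?p (subtopology X S) (S \<inter> T)
        \<cong> relative_homology_group ?p (subtopology X (topspace X)) T"
      using homology_excision_axiom[OF * TX, of ?p] by (auto intro: is_isoI)
    then show "relative_homology_group ?p (subtopology X S) (S \<inter> T) \<cong> relative_homology_group ?p X T"
      by simp
  qed auto
  moreover have "ab_rank (relative_homology_group ?p (subtopology X S) (S \<inter> T))
      \<le> ab_rank (homology_group ?p (subtopology X S))
        + ab_rank (homology_group (?p - 1) (subtopology (subtopology X S) (S \<inter> T)))"
  proof (rule ab_rank_exact)
    show "kernel (relative_homology_group ?p (subtopology X S) (S \<inter> T))
            (homology_group (?p - 1) (subtopology (subtopology X S) (S \<inter> T)))
            (hom_boundary ?p (subtopology X S) (S \<inter> T))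
        \<subseteq> hom_induced ?p (subtopology X S) {} (subtopology X S) (S \<inter> T) id
            ` carrier (homology_group ?p (subtopology X S))"
      using homology_exactness_axiom_1[of ?p "subtopology X S" "S \<inter> T"] by simp
  qed (auto simp: abelian_homology_group hom_induced_hom hom_boundary_hom)
  \<comment> \<open>The boundary map lowers the degree, so for p = 0 its target is homology in
    degree -1, which is trivial.\<close>
  moreover have "ab_rank (homology_group (?p - 1) (subtopology (subtopology X S) (S \<inter> T)))
      = (case p of 0 \<Rightarrow> 0 | Suc q \<Rightarrow> betti q (subtopology X (S \<inter> T)))"
  proof (cases p)
    case 0
    then show ?thesis by (simp add: ab_rank_trivial abelian_homology_group)
  next
    case (Suc q)
    then show ?thesis by (simp add: betti_def subtopology_subtopology Int_absorb2)
  qed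
  ultimately show ?thesis
    unfolding betti_def[of p] by (simp only: add.assoc) (meson add_left_mono order_trans)
qed

lemma total_betti_union_open:
  assumes "openin X S" and "openin X T" and "S \<union> T = topspace X"
  shows "total_betti X \<le> total_betti (subtopology X T) + total_betti (subtopology X S)
           + total_betti (subtopology X (S \<inter> T))"
proof -
  let ?c = "\<lambda>p. case p of 0 \<Rightarrow> 0 | Suc q \<Rightarrow> betti q (subtopology X (S \<inter> T))"
  have "total_betti X \<le> suminf (\<lambda>p. ennreal_of_enat (betti p (subtopology X T) + betti p (subtopology X S) + ?c p))"
    unfolding total_betti_def by (intro suminf_ennreal_of_enat_mono betti_union_open assms)
  also have "\<dots> = total_betti (subtopology X T) + total_betti (subtopology X S)
      + suminf (\<lambda>p. ennreal_of_enat (?c p))"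
    unfolding total_betti_def ennreal_of_enat_add by (simp add: suminf_add)
  \<comment> \<open>The degree shift does not change the sum because the term in degree 0 is
    0.\<close>
  also have "suminf (\<lambda>p. ennreal_of_enat (?c p)) = total_betti (subtopology X (S \<inter> T))"
    unfolding total_betti_def
    by (subst suminf_offset[of _ "Suc 0"]) auto
  finally show ?thesis .
qed

text \<open>No homology of the nerve is computed; each simplex is charged at most 1. Adding
  \<open>F x\<close> costs, besides the old union, 1 for the convex set \<open>F x\<close> and a
  bound for its intersection with the old union. That intersection is the union of the convex sets
  \<open>F x \<inter> F i\<close>, whose simplices J correspond to the simplices
  \<open>insert x J\<close> of the larger family.\<close>

lemma total_betti_nerve:
  fixes F :: "'i \<Rightarrow> 'b::real_normed_vector set"
  assumes "finite I" and "\<And>i. i \<in> I \<Longrightarrow> open (F i)" "\<And>i. i \<in> I \<Longrightarrow> convex (F i)"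
  shows "total_betti (top_of_set (\<Union>i\<in>I. F i))
    \<le> of_nat (card {J. J \<subseteq> I \<and> J \<noteq> {} \<and> (\<Inter>i\<in>J. F i) \<noteq> {}})"
  using assms
proof (induction I arbitrary: F rule: finite_induct)
  case empty
  then show ?case by (simp add: total_betti_empty)
next
  case (insert x I)
  let ?U = "\<Union>i\<in>I. F i"
  let ?N = "\<lambda>I F. {J. J \<subseteq> I \<and> J \<noteq> {} \<and> (\<Inter>i\<in>J. F i) \<noteq> {}}"
  show ?case
  proof (cases "F x = {}")
    case True
    have "?N (insert x I) F = ?N I F"
      using True insert(2) by (auto simp: subset_insert_iff)
    moreover have "(\<Union>i\<in>insert x I. F i) = ?U" using True by auto
    ultimately show ?thesis using insert by simp
  next
    case False
    let ?X = "top_of_set (F x \<union> ?U)"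
    have o: "open ?U" "open (F x)" using insert by auto
    have "total_betti ?X \<le> total_betti (subtopology ?X ?U) + total_betti (subtopology ?X (F x))
           + total_betti (subtopology ?X (F x \<inter> ?U))"
      by (intro total_betti_union_open) (auto simp: openin_open_eq[OF open_Un[OF o(2,1)]] o)
    also have "subtopology ?X ?U = top_of_set ?U"
      by (simp add: subtopology_subtopology Int_absorb1)
    also have "subtopology ?X (F x) = top_of_set (F x)"
      by (simp add: subtopology_subtopology Int_absorb1)
    also have "subtopology ?X (F x \<inter> ?U) = top_of_set (\<Union>i\<in>I. F x \<inter> F i)"
      by (simp add: subtopology_subtopology Int_absorb1 le_supI1 inf.coboundedI1)
    also have "total_betti (top_of_set ?U) + total_betti (top_of_set (F x))
          + total_betti (top_of_set (\<Union>i\<in>I. F x \<inter> F i))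
        \<le> of_nat (card (?N I F)) + 1 + of_nat (card (?N I (\<lambda>i. F x \<inter> F i)))"
      using insert by (intro add_mono insert.IH total_betti_contractible)
        (auto simp: convex_Int contractible_space_top_of_set convex_imp_contractible)
    also have "\<dots> = of_nat (card (?N I F) + 1 + card (?N I (\<lambda>i. F x \<inter> F i)))" by simp
    also have "card (?N I F) + 1 + card (?N I (\<lambda>i. F x \<inter> F i)) \<le> card (?N (insert x I) F)"
    proof -
      have fin: "finite (?N I F)" "finite (?N I (\<lambda>i. F x \<inter> F i))" "finite (?N (insert x I) F)"
        using insert(1) by (auto intro: finite_subset[of _ "Pow (insert x I)"])
      have inj: "inj_on (insert x) (?N I (\<lambda>i. F x \<inter> F i))"
        using insert(2) by (auto simp: inj_on_def insert_ident subset_eq)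
      have "?N I F \<union> {{x}} \<union> insert x ` ?N I (\<lambda>i. F x \<inter> F i) \<subseteq> ?N (insert x I) F"
        using False by auto
      then have "card (?N I F \<union> {{x}} \<union> insert x ` ?N I (\<lambda>i. F x \<inter> F i)) \<le> card (?N (insert x I) F)"
        using fin by (intro card_mono) auto
      moreover have "card (?N I F \<union> {{x}} \<union> insert x ` ?N I (\<lambda>i. F x \<inter> F i))
          = card (?N I F) + 1 + card (insert x ` ?N I (\<lambda>i. F x \<inter> F i))"
      proof (subst card_Un_disjoint)
        show "(?N I F \<union> {{x}}) \<inter> insert x ` ?N I (\<lambda>i. F x \<inter> F i) = {}"
          using insert(2) by (auto simp: subset_eq dest: equalityD1)
        show "card (?N I F \<union> {{x}}) + card (insert x ` ?N I (\<lambda>i. F x \<inter> F i))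
            = card (?N I F) + 1 + card (insert x ` ?N I (\<lambda>i. F x \<inter> F i))"
          using insert(2) fin by (subst card_Un_disjoint) auto
      qed (use fin in auto)
      ultimately show ?thesis using card_image[OF inj] by simp
    qed
    finally show ?thesis by (simp add: of_nat_mono)
  qed
qed

text \<open>Every simplex consists of sets that meet any chosen vertex of it, so it is one of at
  most 2^D sets of neighbours of that vertex.\<close>

lemma card_nerve_le:
  assumes "finite I" and D: "\<And>i. i \<in> I \<Longrightarrow> card {j\<in>I. F i \<inter> F j \<noteq> {}} \<le> D"
  shows "card {J. J \<subseteq> I \<and> J \<noteq> {} \<and> (\<Inter>i\<in>J. F i) \<noteq> {}} \<le> card I * 2 ^ D"
proof -
  have "{J. J \<subseteq> I \<and> J \<noteq> {} \<and> (\<Inter>i\<in>J. F i) \<noteq> {}} \<subseteq> (\<Union>i\<in>I. Pow {j\<in>I. F i \<inter> F j \<noteq> {}})"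
    by blast
  then have "card {J. J \<subseteq> I \<and> J \<noteq> {} \<and> (\<Inter>i\<in>J. F i) \<noteq> {}}
      \<le> card (\<Union>i\<in>I. Pow {j\<in>I. F i \<inter> F j \<noteq> {}})"
    using assms(1) by (intro card_mono) auto
  also have "\<dots> \<le> (\<Sum>i\<in>I. card (Pow {j\<in>I. F i \<inter> F j \<noteq> {}}))"
    by (intro card_UN_le assms(1))
  also have "\<dots> \<le> (\<Sum>i\<in>I. 2 ^ D)"
    using assms(1) D by (intro sum_mono) (auto simp: card_Pow intro: power_increasing)
  finally show ?thesis by simp
qed

section \<open>Retraction onto a zero set by iterated pushes\<close>

text \<open>Requiring \<open>S x = x\<close> where \<open>l x = 0\<close> makes a finite composition of pushes contract at every
  point where one of them does, although the later ones act at displaced points.\<close>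

definition push :: "'b::metric_space set \<Rightarrow> ('b \<Rightarrow> real) \<Rightarrow> ('b \<Rightarrow> 'b) \<Rightarrow> ('b \<Rightarrow> real) \<Rightarrow> real \<Rightarrow> bool" where
  "push K \<phi> S l C \<longleftrightarrow> continuous_on K S \<and> S ` K \<subseteq> K \<and> continuous_on K l \<and> 0 \<le> C \<and>
     (\<forall>x\<in>K. 0 \<le> l x \<and> l x \<le> 1 \<and> \<phi> (S x) \<le> (1 - l x) * \<phi> x \<and> dist (S x) x \<le> C * \<phi> x \<and>
            (l x = 0 \<longrightarrow> S x = x))"

lemma push_id: "push K \<phi> (\<lambda>x. x) (\<lambda>x. 0) 0"
  by (auto simp: push_def)

lemma push_compose:
  assumes p1: "push K \<phi> S1 l1 C1" and p2: "push K \<phi> S2 l2 C2" and pos: "\<And>x. x \<in> K \<Longrightarrow> 0 \<le> \<phi> x"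
  shows "\<exists>l. push K \<phi> (S2 \<circ> S1) l (C1 + C2) \<and> (\<forall>x\<in>K. 0 < l1 x \<or> 0 < l2 x \<longrightarrow> 0 < l x)"
proof (intro exI conjI)
  \<comment> \<open>The factors 1 - l multiply, the second one being read where the first push has
    moved the point.\<close>
  let ?l = "\<lambda>x. 1 - (1 - l2 (S1 x)) * (1 - l1 x)"
  have in1: "S1 x \<in> K" if "x \<in> K" for x using p1 that by (auto simp: push_def)
  have *: "0 \<le> ?l x \<and> ?l x \<le> 1 \<and> \<phi> ((S2 \<circ> S1) x) \<le> (1 - ?l x) * \<phi> x \<and> dist ((S2 \<circ> S1) x) x \<le> (C1 + C2) * \<phi> x
      \<and> (?l x = 0 \<longrightarrow> l1 x = 0 \<and> l2 x = 0 \<and> S1 x = x \<and> S2 x = x)" if x: "x \<in> K" for x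
  proof -
    have 1: "0 \<le> l1 x" "l1 x \<le> 1" "\<phi> (S1 x) \<le> (1 - l1 x) * \<phi> x" "dist (S1 x) x \<le> C1 * \<phi> x" "l1 x = 0 \<longrightarrow> S1 x = x"
      using p1 x by (auto simp: push_def)
    have 2: "0 \<le> l2 (S1 x)" "l2 (S1 x) \<le> 1" "\<phi> (S2 (S1 x)) \<le> (1 - l2 (S1 x)) * \<phi> (S1 x)"
      "dist (S2 (S1 x)) (S1 x) \<le> C2 * \<phi> (S1 x)" "l2 (S1 x) = 0 \<longrightarrow> S2 (S1 x) = S1 x" "0 \<le> C2"
      using p2 in1[OF x] by (auto simp: push_def)
    have le: "(1 - l2 (S1 x)) * (1 - l1 x) \<le> 1 * (1 - l1 x)"
      using 1 2 by (intro mult_right_mono) auto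
    have ge: "0 \<le> (1 - l2 (S1 x)) * (1 - l1 x)" using 1 2 by simp
    have "\<phi> (S1 x) \<le> 1 * \<phi> x"
      using 1 pos[OF x] by (intro order_trans[OF 1(3)] mult_right_mono) auto
    then have phi1: "C2 * \<phi> (S1 x) \<le> C2 * \<phi> x" using 2 by (intro mult_left_mono) auto
    have "\<phi> (S2 (S1 x)) \<le> (1 - l2 (S1 x)) * ((1 - l1 x) * \<phi> x)"
      using 1 2 by (intro order_trans[OF 2(3)] mult_left_mono) auto
    moreover have "dist (S2 (S1 x)) x \<le> (C1 + C2) * \<phi> x"
      using dist_triangle[of "S2 (S1 x)" x "S1 x"] 1 2 phi1 by (simp add: distrib_right)
    moreover have "l1 x = 0 \<and> l2 x = 0 \<and> S1 x = x \<and> S2 x = x" if "?l x = 0"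
    proof -
      have "l1 x = 0" using le that 1 by simp
      then show ?thesis using that 1 2 by auto
    qed
    moreover have "0 \<le> ?l x" using order_trans[OF le, of 1] 1(1) by simp
    moreover have "?l x \<le> 1" using ge by simp
    ultimately show ?thesis by (simp only: diff_diff_eq2 add_diff_cancel_left' mult.assoc comp_apply simp_thms) blast
  qed
  show "push K \<phi> (S2 \<circ> S1) ?l (C1 + C2)"
    unfolding push_def
  proof (intro conjI)
    have c: "continuous_on K S1" "S1 ` K \<subseteq> K" "continuous_on K S2" "continuous_on K l2" "continuous_on K l1"
      using p1 p2 by (auto simp: push_def)
    then show "continuous_on K (S2 \<circ> S1)"
      by (intro continuous_on_compose) (auto intro: continuous_on_subset)
    have "continuous_on K (\<lambda>x. l2 (S1 x))"
      by (rule continuous_on_compose2[OF c(4) c(1) c(2)])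
    then show "continuous_on K ?l" using c by (intro continuous_intros)
    show "(S2 \<circ> S1) ` K \<subseteq> K" using c(2) p2 by (auto simp: push_def image_subset_iff)
    show "0 \<le> C1 + C2" using p1 p2 by (auto simp: push_def)
    show "\<forall>x\<in>K. 0 \<le> ?l x \<and> ?l x \<le> 1 \<and> \<phi> ((S2 \<circ> S1) x) \<le> (1 - ?l x) * \<phi> x \<and>
        dist ((S2 \<circ> S1) x) x \<le> (C1 + C2) * \<phi> x \<and> (?l x = 0 \<longrightarrow> (S2 \<circ> S1) x = x)"
    proof
      fix x assume "x \<in> K"
      from *[OF this] show "0 \<le> ?l x \<and> ?l x \<le> 1 \<and> \<phi> ((S2 \<circ> S1) x) \<le> (1 - ?l x) * \<phi> x \<and>
        dist ((S2 \<circ> S1) x) x \<le> (C1 + C2) * \<phi> x \<and> (?l x = 0 \<longrightarrow> (S2 \<circ> S1) x = x)"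
        by (metis comp_apply)
    qed
  qed
  show "\<forall>x\<in>K. 0 < l1 x \<or> 0 < l2 x \<longrightarrow> 0 < ?l x"
  proof (intro ballI impI)
    fix x assume "x \<in> K" "0 < l1 x \<or> 0 < l2 x"
    then show "0 < ?l x" using *[of x] by linarith
  qed
qed

text \<open>Compactness composes finitely many pushes into one map \<open>T\<close> with a uniform
  factor \<open>e < 1\<close>. Then \<phi> decays like e^n along the iterates of \<open>T\<close>,
  and the steps are bounded by a multiple of \<phi>, so the iterates converge uniformly. The limit
  is continuous, takes its values where \<phi> vanishes, and fixes such points because
  \<open>T\<close> does.\<close>

lemma zero_set_retract_if_push:
  fixes K :: "'b::metric_space set"
  assumes K: "compact K" and cont: "continuous_on K \<phi>" and pos: "\<And>x. x \<in> K \<Longrightarrow> 0 \<le> \<phi> x"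
    and local: "\<And>x. x \<in> K \<Longrightarrow> \<exists>S l C. push K \<phi> S l C \<and> 0 < l x"
  shows "\<exists>\<rho>. continuous_on K \<rho> \<and> \<rho> ` K \<subseteq> {x \<in> K. \<phi> x = 0} \<and> (\<forall>x\<in>K. \<phi> x = 0 \<longrightarrow> \<rho> x = x)"
proof (cases "K = {}")
  case False
  obtain S l C where loc: "\<And>y. y \<in> K \<Longrightarrow> push K \<phi> (S y) (l y) (C y) \<and> 0 < l y y"
    using local by metis
  have "\<exists>U. open U \<and> {x \<in> K. 0 < l y x} = U \<inter> K" if "y \<in> K" for y
  proof -
    have "continuous_on K (l y)" using loc[OF that] by (simp add: push_def)
    from continuous_on_open_invariant[THEN iffD1, OF this, rule_format, of "{0<..}"]
    obtain U where U: "open U" "U \<inter> K = l y -` {0<..} \<inter> K" by auto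
    then show ?thesis by (intro exI[of _ U]) auto
  qed
  then obtain U where U: "\<And>y. y \<in> K \<Longrightarrow> open (U y) \<and> {x \<in> K. 0 < l y x} = U y \<inter> K" by metis
  have "x \<in> U x" if "x \<in> K" for x
  proof -
    have "x \<in> {x' \<in> K. 0 < l x x'}" using loc[OF that] that by simp
    then show ?thesis using U[OF that] by simp
  qed
  then have "K \<subseteq> (\<Union>y\<in>K. U y)" by blast
  then obtain Y where Y: "Y \<subseteq> K" "finite Y" "K \<subseteq> (\<Union>y\<in>Y. U y)"
    using compactE_image[OF K, of K U] U by metis
  have "\<exists>S L C. push K \<phi> S L C \<and> (\<forall>x\<in>K. (\<exists>y\<in>Y. 0 < l y x) \<longrightarrow> 0 < L x)"
    using Y(2,1)
  proof (induction Y rule: finite_induct)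
    case empty
    then show ?case using push_id by blast
  next
    case (insert y Y)
    then obtain S' L C' where 1: "push K \<phi> S' L C'" "\<forall>x\<in>K. (\<exists>y\<in>Y. 0 < l y x) \<longrightarrow> 0 < L x" by auto
    have 2: "push K \<phi> (S y) (l y) (C y)" using loc insert by auto
    obtain L' where "push K \<phi> (S y \<circ> S') L' (C' + C y)" "\<forall>x\<in>K. 0 < L x \<or> 0 < l y x \<longrightarrow> 0 < L' x"
      using push_compose[OF 1(1) 2 pos] by blast
    then show ?case using 1(2) by blast
  qed
  then obtain T L D where p: "push K \<phi> T L D" and L: "\<forall>x\<in>K. (\<exists>y\<in>Y. 0 < l y x) \<longrightarrow> 0 < L x"
    by blast
  have Lpos: "0 < L x" if x: "x \<in> K" for x
  proof -
    obtain y where y: "y \<in> Y" "x \<in> U y" using Y(3) x by blast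
    then have "x \<in> {x \<in> K. 0 < l y x}" using U[of y] Y(1) x by blast
    then show ?thesis using L x y(1) by blast
  qed
  have contT: "continuous_on K T" "continuous_on K L" and TK: "\<And>x. x \<in> K \<Longrightarrow> T x \<in> K" and D: "0 \<le> D"
    and T: "\<And>x. x \<in> K \<Longrightarrow> L x \<le> 1 \<and> \<phi> (T x) \<le> (1 - L x) * \<phi> x \<and> dist (T x) x \<le> D * \<phi> x"
    using p by (auto simp: push_def)
  obtain x0 where x0: "x0 \<in> K" "\<And>x. x \<in> K \<Longrightarrow> L x0 \<le> L x"
    using continuous_attains_inf[OF K False contT(2)] by blast
  obtain x1 where x1: "x1 \<in> K" "\<And>x. x \<in> K \<Longrightarrow> \<phi> x \<le> \<phi> x1"
    using continuous_attains_sup[OF K False cont] by blast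
  \<comment> \<open>\<open>L\<close> has a positive minimum on the compact set \<open>K\<close>, so
    this factor is less than 1.\<close>
  define e where "e = 1 - L x0"
  have e: "0 \<le> e" "e < 1" using Lpos[OF x0(1)] T[OF x0(1)] by (auto simp: e_def)
  have itK: "(T ^^ n) x \<in> K" if "x \<in> K" for n x using TK that by (induction n) auto
  have itphi: "\<phi> ((T ^^ n) x) \<le> e ^ n * \<phi> x" if x: "x \<in> K" for n x
  proof (induction n)
    case (Suc n)
    let ?z = "(T ^^ n) x"
    have z: "?z \<in> K" by (rule itK[OF x])
    have "\<phi> (T ?z) \<le> (1 - L ?z) * \<phi> ?z" using T[OF z] by auto
    also have "\<dots> \<le> e * \<phi> ?z" using x0(2)[OF z] pos[OF z] by (intro mult_right_mono) (auto simp: e_def)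
    also have "\<dots> \<le> e * (e ^ n * \<phi> x)" using Suc e by (intro mult_left_mono) auto
    finally show ?case by simp
  qed simp
  have step: "dist ((T ^^ Suc n) x) ((T ^^ n) x) \<le> D * \<phi> x1 * e ^ n" if x: "x \<in> K" for n x
  proof -
    have "dist ((T ^^ Suc n) x) ((T ^^ n) x) \<le> D * \<phi> ((T ^^ n) x)" using T[OF itK[OF x]] by simp
    also have "\<dots> \<le> D * (e ^ n * \<phi> x1)"
      using D e x1(2)[OF x] by (intro mult_left_mono order_trans[OF itphi[OF x]]) auto
    finally show ?thesis by (simp add: mult_ac)
  qed
  \<comment> \<open>\<open>B * e ^ n\<close> is the tail of the geometric series formed by the step
    bounds \<open>D * \<phi> x1 * e ^ n\<close>.\<close>
  define B where "B = D * \<phi> x1 / (1 - e)"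
  have B: "0 \<le> B" using D pos[OF x1(1)] e by (simp add: B_def)
  have BD: "B * (1 - e) = D * \<phi> x1" using e by (simp add: B_def)
  \<comment> \<open>Subtracting \<open>e ^ (n + k)\<close> strengthens the claim enough for the
    induction on \<open>k\<close>.\<close>
  have tele: "dist ((T ^^ (n + k)) x) ((T ^^ n) x) \<le> B * (e ^ n - e ^ (n + k))" if x: "x \<in> K" for n k x
  proof (induction k)
    case (Suc k)
    have "dist ((T ^^ (n + Suc k)) x) ((T ^^ n) x)
        \<le> dist ((T ^^ Suc (n + k)) x) ((T ^^ (n + k)) x) + dist ((T ^^ (n + k)) x) ((T ^^ n) x)"
      by (simp only: add_Suc_right dist_triangle)
    also have "\<dots> \<le> B * (1 - e) * e ^ (n + k) + B * (e ^ n - e ^ (n + k))"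
      unfolding BD by (intro add_mono step[OF x] Suc)
    also have "\<dots> = B * (e ^ n - e ^ (n + Suc k))" by (simp add: algebra_simps)
    finally show ?case .
  qed simp
  have tele': "dist ((T ^^ k) x) ((T ^^ n) x) \<le> B * e ^ n" if x: "x \<in> K" and "n \<le> k" for n k x
  proof -
    have "dist ((T ^^ k) x) ((T ^^ n) x) \<le> B * (e ^ n - e ^ k)"
      using tele[OF x, of n "k - n"] that by simp
    also have "\<dots> \<le> B * e ^ n" using B e by (intro mult_left_mono) auto
    finally show ?thesis .
  qed
  have small: "\<forall>\<^sub>F n in sequentially. B * e ^ n < \<epsilon>" if "0 < \<epsilon>" for \<epsilon>
  proof -
    have "(\<lambda>n. B * e ^ n) \<longlonglongrightarrow> B * 0"
      using e by (intro tendsto_mult tendsto_const LIMSEQ_realpow_zero)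
    then show ?thesis using that by (intro order_tendstoD) auto
  qed
  have "\<exists>z. (\<lambda>n. (T ^^ n) x) \<longlonglongrightarrow> z" if x: "x \<in> K" for x
  proof -
    have "Cauchy (\<lambda>n. (T ^^ n) x)"
    proof (rule metric_CauchyI)
      fix \<epsilon> :: real assume "0 < \<epsilon>"
      then obtain N where N: "B * e ^ N < \<epsilon> / 2"
        using small[of "\<epsilon> / 2"] by (auto simp: eventually_sequentially)
      have "dist ((T ^^ m) x) ((T ^^ n) x) < \<epsilon>" if "N \<le> m" "N \<le> n" for m n
        using dist_triangle2[of "(T ^^ m) x" "(T ^^ n) x" "(T ^^ N) x"]
          tele'[OF x that(1)] tele'[OF x that(2)] N by linarith
      then show "\<exists>M. \<forall>m\<ge>M. \<forall>n\<ge>M. dist ((T ^^ m) x) ((T ^^ n) x) < \<epsilon>" by blast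
    qed
    then show ?thesis
      using compact_imp_complete[OF K, unfolded complete_def, rule_format, of "\<lambda>n. (T ^^ n) x"] itK[OF x]
      by blast
  qed
  then obtain \<rho> where ptw: "\<And>x. x \<in> K \<Longrightarrow> (\<lambda>n. (T ^^ n) x) \<longlonglongrightarrow> \<rho> x" by metis
  have near: "dist (\<rho> x) ((T ^^ n) x) \<le> B * e ^ n" if x: "x \<in> K" for x n
  proof (rule LIMSEQ_le_const2)
    show "(\<lambda>k. dist ((T ^^ k) x) ((T ^^ n) x)) \<longlonglongrightarrow> dist (\<rho> x) ((T ^^ n) x)"
      by (intro tendsto_dist ptw[OF x] tendsto_const)
    show "\<exists>N. \<forall>k\<ge>N. dist ((T ^^ k) x) ((T ^^ n) x) \<le> B * e ^ n" using tele'[OF x] by blast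
  qed
  have lim: "uniform_limit K (\<lambda>n x. (T ^^ n) x) \<rho> sequentially"
  proof (rule uniform_limitI)
    fix \<epsilon> :: real assume "0 < \<epsilon>"
    from small[OF this]
    show "\<forall>\<^sub>F n in sequentially. \<forall>x\<in>K. dist ((T ^^ n) x) (\<rho> x) < \<epsilon>"
    proof (rule eventually_mono)
      fix n assume "B * e ^ n < \<epsilon>"
      then show "\<forall>x\<in>K. dist ((T ^^ n) x) (\<rho> x) < \<epsilon>"
        using near by (metis dist_commute order_le_less_trans)
    qed
  qed
  have contn: "continuous_on K (T ^^ n)" for n
  proof (induction n)
    case (Suc n)
    have "continuous_on K (\<lambda>x. T ((T ^^ n) x))"
      by (rule continuous_on_compose2[OF contT(1) Suc]) (use itK in auto)
    then show ?case by (simp add: comp_def)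
  qed (simp add: id_def)
  have "continuous_on K \<rho>"
    by (rule uniform_limit_theorem[OF always_eventually[OF allI[OF contn]] lim]) simp
  moreover have "\<rho> x \<in> K \<and> \<phi> (\<rho> x) = 0" if x: "x \<in> K" for x
  proof -
    have rK: "\<rho> x \<in> K"
      using closed_sequentially[OF compact_imp_closed[OF K] _ ptw[OF x]] itK[OF x] by blast
    have "(\<lambda>n. \<phi> ((T ^^ n) x)) \<longlonglongrightarrow> \<phi> (\<rho> x)"
      using cont ptw[OF x] rK itK[OF x] continuous_on_tendsto_compose[OF cont ptw[OF x] rK] by auto
    moreover have "(\<lambda>n. \<phi> ((T ^^ n) x)) \<longlonglongrightarrow> 0"
    proof (rule tendsto_sandwich[of "\<lambda>_. 0" _ _ "\<lambda>n. e ^ n * \<phi> x"])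
      have "(\<lambda>n. e ^ n * \<phi> x) \<longlonglongrightarrow> 0 * \<phi> x"
        using e by (intro tendsto_mult tendsto_const LIMSEQ_realpow_zero)
      then show "(\<lambda>n. e ^ n * \<phi> x) \<longlonglongrightarrow> 0" by simp
    qed (use itphi[OF x] pos[OF itK[OF x]] in auto)
    ultimately have "\<phi> (\<rho> x) = 0" by (rule LIMSEQ_unique)
    then show ?thesis using rK by simp
  qed
  moreover have "\<rho> x = x" if x: "x \<in> K" "\<phi> x = 0" for x
  proof -
    have Tx: "T x = x" using T[OF x(1)] x(2) by simp
    have "(T ^^ n) x = x" for n using Tx by (induction n) auto
    then show ?thesis using ptw[OF x(1)] by (simp add: LIMSEQ_const_iff)
  qed
  ultimately show ?thesis by blast
qed auto

section \<open>Separated sets in finite-dimensional inner product spaces\<close>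

definition separated :: "real \<Rightarrow> 'b::metric_space set \<Rightarrow> bool" where
  "separated \<epsilon> S \<longleftrightarrow> (\<forall>x\<in>S. \<forall>y\<in>S. x \<noteq> y \<longrightarrow> \<epsilon> \<le> dist x y)"

lemma separated_subset: "separated \<epsilon> T \<Longrightarrow> S \<subseteq> T \<Longrightarrow> separated \<epsilon> S"
  unfolding separated_def by blast

text \<open>\<open>'e\<close> need not be a \<open>euclidean_space\<close>, so an orthonormal
  spanning set takes the place of \<open>Basis\<close>; in dimension 0 it is empty.\<close>

definition orthonormal :: "'e::real_inner set \<Rightarrow> bool" where
  "orthonormal B \<longleftrightarrow> (\<forall>b\<in>B. \<forall>b'\<in>B. b \<bullet> b' = (if b = b' then 1 else 0))"

lemma orthonormal_expansion:
  fixes B :: "'e::real_inner set"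
  assumes "finite B" "orthonormal B" "v \<in> span B"
  shows "(\<Sum>b\<in>B. (v \<bullet> b) *\<^sub>R b) = v"
proof -
  obtain u where u: "v = (\<Sum>b\<in>B. u b *\<^sub>R b)"
    using assms(1,3) by (auto simp: span_finite)
  have "v \<bullet> b = u b" if "b \<in> B" for b
  proof -
    have "v \<bullet> b = (\<Sum>b'\<in>B. u b' * (b' \<bullet> b))" by (simp add: u inner_sum_left)
    also have "\<dots> = (\<Sum>b'\<in>B. if b' = b then u b' else 0)"
      using assms(2) that by (intro sum.cong) (auto simp: orthonormal_def)
    finally show ?thesis using that assms(1) by simp
  qed
  then show ?thesis using u by simp
qed

text \<open>Gram-Schmidt: unless \<open>x\<close> equals its projection \<open>p\<close> to the span
  of \<open>C\<close>, the normalised difference extends \<open>C\<close>.\<close>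

lemma orthonormal_basis_ex:
  fixes B :: "'e::real_inner set"
  assumes "finite B"
  shows "\<exists>C. finite C \<and> orthonormal C \<and> span C = span B"
  using assms
proof (induction B rule: finite_induct)
  case empty
  then show ?case by (intro exI[of _ "{}"]) (auto simp: orthonormal_def)
next
  case (insert x B)
  then obtain C where C: "finite C" "orthonormal C" "span C = span B" by auto
  define p where "p = (\<Sum>b\<in>C. (x \<bullet> b) *\<^sub>R b)"
  have p: "p \<in> span C" unfolding p_def by (intro span_sum span_scale span_base)
  have eq: "span (insert x B) = span (insert x C)"
    using C(3) by (metis span_insert)
  show ?case
  proof (cases "x = p")
    case True
    then show ?thesis using C p eq by (metis span_redundant)
  next
    case False
    define y where "y = (x - p) /\<^sub>R norm (x - p)"
    have y: "y \<bullet> y = 1" using False by (simp add: y_def dot_square_norm power2_eq_square)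
    have yb: "y \<bullet> b = 0" if "b \<in> C" for b
    proof -
      have "p \<bullet> b = (\<Sum>b'\<in>C. (x \<bullet> b') * (b' \<bullet> b))" by (simp add: p_def inner_sum_left)
      also have "\<dots> = (\<Sum>b'\<in>C. if b' = b then x \<bullet> b' else 0)"
        using C(2) that by (intro sum.cong) (auto simp: orthonormal_def)
      finally show ?thesis using that C(1) by (simp add: y_def inner_diff_left)
    qed
    have "orthonormal (insert y C)"
      using C(2) y yb by (auto simp: orthonormal_def inner_commute)
    moreover have "span (insert y C) = span (insert x C)"
    proof -
      have x: "x = norm (x - p) *\<^sub>R y + p" using False by (simp add: y_def)
      have pC: "p \<in> span (insert z C)" for z using p span_mono[of C "insert z C"] by blast
      have "x \<in> span (insert y C)"
        by (subst x) (intro span_add span_scale pC span_base insertI1)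
      moreover have "y \<in> span (insert x C)"
        unfolding y_def by (intro span_scale span_diff pC span_base insertI1)
      ultimately show ?thesis
        by (intro antisym span_minimal) (auto intro: span_base)
    qed
    ultimately show ?thesis using C(1) eq by (intro exI[of _ "insert y C"]) auto
  qed
qed

lemma orthonormal_independent:
  fixes B :: "'e::real_inner set"
  assumes "orthonormal B"
  shows "independent B"
proof (rule pairwise_orthogonal_independent)
  show "pairwise orthogonal B"
    using assms by (auto simp: pairwise_def orthogonal_def orthonormal_def)
  show "0 \<notin> B"
  proof
    assume "0 \<in> B"
    then have "(0::'e) \<bullet> 0 = 1" using assms unfolding orthonormal_def by metis
    then show False by simp
  qed
qed

lemma orthonormal_norm_le:
  fixes B :: "'e::real_inner set"
  assumes "finite B" "orthonormal B" "v \<in> span B"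
  shows "norm v \<le> (\<Sum>b\<in>B. \<bar>v \<bullet> b\<bar>)"
proof -
  have "norm v = norm (\<Sum>b\<in>B. (v \<bullet> b) *\<^sub>R b)"
    using orthonormal_expansion[OF assms] by simp
  also have "\<dots> \<le> (\<Sum>b\<in>B. norm ((v \<bullet> b) *\<^sub>R b))" by (rule norm_sum)
  also have "\<dots> = (\<Sum>b\<in>B. \<bar>v \<bullet> b\<bar>)"
    using assms(2) by (intro sum.cong) (auto simp: orthonormal_def norm_eq_sqrt_inner)
  finally show ?thesis .
qed

text \<open>Pigeonhole on a grid: the floors of rescaled coordinates encode each point by its cell.
  Two points in one cell differ by at most 1/h in each coordinate, hence by less than
  \<open>s\<close> in norm, so the code is injective on \<open>T\<close>.\<close>

lemma card_separated_le:
  fixes B T :: "'e::real_inner set"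
  assumes B: "finite B" "orthonormal B" "span B = UNIV" and T: "T \<subseteq> cball p R" "separated s T"
    and s: "0 < s" and R: "0 \<le> R"
  shows "finite T \<and> real (card T) \<le> (2 * R * (real (card B) + 1) / s + 2) ^ card B"
proof -
  \<comment> \<open>Cells have side \<open>s / (card B + 1)\<close>, so that \<open>card B\<close>
    such sides still add up to less than \<open>s\<close>; the summand 1 also covers dimension
    0.\<close>
  define h where "h = (real (card B) + 1) / s"
  have h: "0 < h" using s by (simp add: h_def)
  define code where "code v = (\<lambda>b\<in>B. \<lfloor>((v - p) \<bullet> b) * h\<rfloor>)" for v
  \<comment> \<open>The extra value at the lower end accounts for floors rounding negative numbers
    away from 0.\<close>
  define J where "J = {- \<lfloor>R * h\<rfloor> - 1 .. \<lfloor>R * h\<rfloor>}"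
  have "inj_on code T"
  proof (rule inj_onI, rule ccontr)
    fix v w assume vw: "v \<in> T" "w \<in> T" "code v = code w" "v \<noteq> w"
    have b: "\<bar>(v - w) \<bullet> b\<bar> \<le> 1 / h" if "b \<in> B" for b
    proof -
      have "\<lfloor>((v - p) \<bullet> b) * h\<rfloor> = \<lfloor>((w - p) \<bullet> b) * h\<rfloor>"
        using fun_cong[OF vw(3), of b] that by (simp add: code_def)
      then have "\<bar>((v - p) \<bullet> b) * h - ((w - p) \<bullet> b) * h\<bar> \<le> 1" by linarith
      also have "((v - p) \<bullet> b) * h - ((w - p) \<bullet> b) * h = ((v - w) \<bullet> b) * h"
        by (simp add: inner_diff_left algebra_simps)
      finally show ?thesis using h by (simp add: abs_mult field_simps)
    qed
    have "dist v w \<le> (\<Sum>b\<in>B. \<bar>(v - w) \<bullet> b\<bar>)"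
      unfolding dist_norm using B by (intro orthonormal_norm_le) auto
    also have "\<dots> \<le> (\<Sum>b\<in>B. 1 / h)" by (intro sum_mono b)
    also have "\<dots> < s" using s by (simp add: h_def field_simps)
    finally show False using T(2) vw unfolding separated_def by force
  qed
  moreover have sub: "code ` T \<subseteq> B \<rightarrow>\<^sub>E J"
  proof -
    have "\<lfloor>((v - p) \<bullet> b) * h\<rfloor> \<in> J" if "v \<in> T" "b \<in> B" for v b
    proof -
      have "norm b = 1" using B(2) that by (auto simp: orthonormal_def norm_eq_sqrt_inner)
      then have "\<bar>(v - p) \<bullet> b\<bar> \<le> norm (v - p)" using Cauchy_Schwarz_ineq2[of "v - p" b] by simp
      also have "\<dots> \<le> R" using T(1) that by (auto simp: dist_norm norm_minus_commute)
      finally have "\<bar>((v - p) \<bullet> b) * h\<bar> \<le> R * h" using h by (simp add: abs_mult)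
      then show ?thesis unfolding J_def by (simp add: abs_le_iff) linarith
    qed
    then show ?thesis by (auto simp: code_def)
  qed
  moreover have fin: "finite (B \<rightarrow>\<^sub>E J)" using B(1) by (intro finite_PiE) (auto simp: J_def)
  ultimately have "finite T" using inj_on_finite by blast
  have "card T = card (code ` T)" using \<open>inj_on code T\<close> by (simp add: card_image)
  also have "\<dots> \<le> card (B \<rightarrow>\<^sub>E J)" by (intro card_mono fin sub)
  also have "\<dots> = card J ^ card B" by (simp add: card_PiE B(1))
  finally have "real (card T) \<le> real (card J) ^ card B" by (metis of_nat_le_iff of_nat_power)
  also have "\<dots> \<le> (2 * R * (real (card B) + 1) / s + 2) ^ card B"
  proof (rule power_mono)
    have "0 \<le> \<lfloor>R * h\<rfloor>" using R h by simp
    then have "real (card J) = 2 * real_of_int \<lfloor>R * h\<rfloor> + 2" by (simp add: J_def)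
    also have "\<dots> \<le> 2 * (R * h) + 2" by simp
    finally show "real (card J) \<le> 2 * R * (real (card B) + 1) / s + 2" by (simp add: h_def)
  qed simp
  finally show ?thesis using \<open>finite T\<close> by simp
qed

section \<open>Compact Lipschitz submanifolds of a normed space\<close>

text \<open>Homogeneous coordinates: the \<open>i\<close>-th chart is \<open>x \<mapsto> a i x / t i x\<close>, defined where the
  cut-off \<open>t i\<close> is positive, and \<open>G i\<close> is its inverse.\<close>

locale lipschitz_atlas =
  fixes M :: "'b::real_normed_vector set" and q :: nat
    and a :: "nat \<Rightarrow> 'b \<Rightarrow> 'e::{real_inner, heine_borel}" and t :: "nat \<Rightarrow> 'b \<Rightarrow> real"
    and G :: "nat \<Rightarrow> 'e \<Rightarrow> 'b" and C :: real
  assumes t_lip: "\<bar>t i y - t i y'\<bar> \<le> dist y y'"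
    and a_lip: "dist (a i y) (a i y') \<le> dist y y'"
    and G_in: "i < q \<Longrightarrow> norm u \<le> 3 \<Longrightarrow> G i u \<in> M"
    and G_lip: "i < q \<Longrightarrow> norm u \<le> 3 \<Longrightarrow> norm u' \<le> 3 \<Longrightarrow> dist (G i u) (G i u') \<le> C * dist u u'"
    and coord_norm: "i < q \<Longrightarrow> x \<in> M \<Longrightarrow> 0 < t i x \<Longrightarrow> norm (a i x /\<^sub>R t i x) \<le> 3 - t i x"
    and G_coord: "i < q \<Longrightarrow> x \<in> M \<Longrightarrow> 0 < t i x \<Longrightarrow> G i (a i x /\<^sub>R t i x) = x"
    and cover: "x \<in> M \<Longrightarrow> \<exists>i<q. t i x = 1"
    and C_ge_1: "1 \<le> C"
begin

definition \<kappa> :: "nat \<Rightarrow> 'b \<Rightarrow> 'e" where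
  "\<kappa> i y = a i y /\<^sub>R t i y"

definition nbhd :: "real \<Rightarrow> 'b set" where
  "nbhd \<eta> = {y. \<exists>x\<in>M. dist y x < \<eta>}"

text \<open>The weight vanishes already at t i = 1/2. This leaves a zone between 3/8 and 1/2, where
  the chart is still usable but has no influence, for gluing the retractions.\<close>

definition w :: "nat \<Rightarrow> 'b \<Rightarrow> real" where
  "w i y = max 0 (t i y - 1/2)"

definition W :: "nat \<Rightarrow> 'b \<Rightarrow> real" where
  "W j y = (\<Sum>i<j. w i y)"

text \<open>Multiplying by \<open>t i y\<close> turns the difference into a change of
  \<open>a i\<close> plus a change of \<open>t i\<close> times \<open>\<kappa> i x\<close>. The two
  terms contribute 1 and 3 times the distance, as \<open>\<kappa> i x\<close> has norm at most 3 for
  \<open>x\<close> in \<open>M\<close>; the point \<open>y\<close> may lie off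
  \<open>M\<close>.\<close>

lemma kappa_dist:
  assumes i: "i < q" and x: "x \<in> M" "0 < t i x" and y: "0 < t i y"
  shows "dist (\<kappa> i y) (\<kappa> i x) \<le> 4 / t i y * dist y x"
proof -
  have k: "norm (\<kappa> i x) \<le> 3" using coord_norm[OF i x] x(2) by (simp add: \<kappa>_def)
  have ax: "a i x = t i x *\<^sub>R \<kappa> i x" using x by (simp add: \<kappa>_def)
  have ay: "a i y = t i y *\<^sub>R \<kappa> i y" using y by (simp add: \<kappa>_def)
  have "t i y *\<^sub>R (\<kappa> i y - \<kappa> i x) = (a i y - a i x) + (t i x - t i y) *\<^sub>R \<kappa> i x"
    unfolding ax ay by (simp add: algebra_simps)
  then have "t i y * norm (\<kappa> i y - \<kappa> i x) = norm ((a i y - a i x) + (t i x - t i y) *\<^sub>R \<kappa> i x)"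
    using y by (metis abs_of_pos norm_scaleR)
  also have "\<dots> \<le> norm (a i y - a i x) + \<bar>t i x - t i y\<bar> * norm (\<kappa> i x)"
    by (metis norm_scaleR norm_triangle_ineq)
  also have "\<dots> \<le> dist y x + dist y x * 3"
    using a_lip[of i y x] t_lip[of i x y] k
    by (intro add_mono mult_mono) (auto simp: dist_norm norm_minus_commute)
  finally show ?thesis using y by (simp add: field_simps dist_norm)
qed

lemma continuous_on_t [continuous_intros]: "continuous_on S (t i)"
proof (rule continuous_on_eq_continuous_within[THEN iffD2], rule ballI)
  fix x assume "x \<in> S"
  show "continuous (at x within S) (t i)"
    unfolding continuous_within_eps_delta
    using t_lip by (metis dist_real_def order_le_less_trans)
qed

lemma continuous_on_a [continuous_intros]: "continuous_on S (a i)"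
proof (rule continuous_on_eq_continuous_within[THEN iffD2], rule ballI)
  fix x assume "x \<in> S"
  show "continuous (at x within S) (a i)"
    unfolding continuous_within_eps_delta
    using a_lip by (metis order_le_less_trans)
qed

lemma continuous_on_w [continuous_intros]: "continuous_on S (w i)"
  unfolding w_def by (intro continuous_intros)

lemma continuous_on_W [continuous_intros]: "continuous_on S (W i)"
  unfolding W_def by (intro continuous_intros)

lemma continuous_on_kappa:
  assumes "\<And>y. y \<in> S \<Longrightarrow> t i y \<noteq> 0"
  shows "continuous_on S (\<kappa> i)"
  unfolding \<kappa>_def using assms by (intro continuous_intros) auto

lemma continuous_on_G:
  assumes "i < q"
  shows "continuous_on (cball 0 3) (G i)"
proof (rule continuous_on_eq_continuous_within[THEN iffD2], rule ballI)
  fix u :: 'e assume u: "u \<in> cball 0 3"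
  show "continuous (at u within cball 0 3) (G i)"
    unfolding continuous_within_eps_delta
  proof (intro allI impI)
    fix e :: real assume "0 < e"
    have "dist (G i u') (G i u) < e" if "u' \<in> cball 0 3" "dist u' u < e / C" for u'
    proof -
      have "dist (G i u') (G i u) \<le> C * dist u' u" using u that by (intro G_lip assms) auto
      also have "\<dots> < C * (e / C)" using that C_ge_1 by (intro mult_strict_left_mono) auto
      finally show ?thesis using C_ge_1 by simp
    qed
    then show "\<exists>d>0. \<forall>x'\<in>cball 0 3. dist x' u < d \<longrightarrow> dist (G i x') (G i u) < e"
      using \<open>0 < e\<close> C_ge_1 by (intro exI[of _ "e / C"]) auto
  qed
qed

lemma w_nonneg: "0 \<le> w i y" by (simp add: w_def)

lemma W_nonneg: "0 \<le> W j y" by (simp add: W_def w_nonneg sum_nonneg)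

lemma W_Suc: "W (Suc j) y = W j y + w j y" by (simp add: W_def)

lemma open_nbhd: "open (nbhd \<eta>)"
proof -
  have "nbhd \<eta> = (\<Union>x\<in>M. ball x \<eta>)" by (auto simp: nbhd_def dist_commute)
  then show ?thesis by auto
qed

text \<open>The neighbourhood retraction is built chart by chart: in the chart \<open>j\<close> the retraction \<open>R\<close>
  obtained from the earlier charts is averaged with the chart projection \<open>\<kappa> j\<close>. Where \<open>R y\<close> is
  undefined, i.e. \<open>W j y = 0\<close>, its coefficient vanishes.\<close>

definition blend :: "nat \<Rightarrow> ('b \<Rightarrow> 'b) \<Rightarrow> 'b \<Rightarrow> 'e" where
  "blend j R y = (1 - w j y / W (Suc j) y) *\<^sub>R \<kappa> j (R y) + (w j y / W (Suc j) y) *\<^sub>R \<kappa> j y"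

text \<open>Comparison with every nearby \<open>x\<close> in \<open>M\<close> does double duty: x =
  y shows that \<open>R\<close> fixes the points of \<open>M\<close> where it is controlled, and
  general \<open>x\<close> gives the Lipschitz control.\<close>

definition retracts_to :: "nat \<Rightarrow> real \<Rightarrow> real \<Rightarrow> ('b \<Rightarrow> 'b) \<Rightarrow> bool" where
  "retracts_to j D \<eta> R \<longleftrightarrow> 1 \<le> D \<and> 0 < \<eta> \<and> continuous_on (nbhd \<eta> \<inter> {y. 0 < W j y}) R \<and>
     (\<forall>x\<in>M. \<forall>y. dist y x < \<eta> \<longrightarrow> 0 < W j y \<longrightarrow> R y \<in> M \<and> dist (R y) x \<le> D * dist y x)"

text \<open>Both averaged points are close to \<open>\<kappa> j x\<close>:
  \<open>\<kappa> j y\<close> directly, and \<open>\<kappa> j (R y)\<close> because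
  \<open>R y\<close> is within \<open>D * dist y x\<close> of \<open>x\<close>. As
  \<open>t j\<close> exceeds 1/8 at \<open>y\<close> and at \<open>R y\<close>, the factor 4 / t j
  of \<open>kappa_dist\<close> is at most 32.\<close>

lemma blend_near:
  assumes j: "j < q" and R: "retracts_to j D \<eta> R" and \<eta>': "\<eta>' \<le> \<eta>" "\<eta>' \<le> 1 / (128 * D)"
    and x: "x \<in> M" and y: "dist y x < \<eta>'" "0 < W (Suc j) y" "3/8 < t j y"
  shows "dist (blend j R y) (\<kappa> j x) \<le> 32 * D * dist y x" and "norm (blend j R y) \<le> 3" and "1/4 < t j x"
    and "0 < W j y \<Longrightarrow> 1/8 < t j (R y)"
proof -
  define d where "d = dist y x"
  have D: "1 \<le> D" using R by (simp add: retracts_to_def)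
  have d0: "0 \<le> d" by (simp add: d_def)
  \<comment> \<open>A distance of at most 1 / (128 D) changes \<open>t j\<close> by at most 1/128,
    even after \<open>R\<close>, and makes 32 D d at most 1/4.\<close>
  have Dd: "128 * D * d \<le> 1"
  proof -
    have "D * d \<le> D * (1 / (128 * D))"
      using y(1) \<eta>'(2) D by (intro mult_left_mono) (auto simp: d_def)
    then show ?thesis using D by simp
  qed
  have dD: "d \<le> D * d" using D d0 by (simp add: mult_le_cancel_right1)
  then have d128: "128 * d \<le> 1" using Dd by linarith
  show tx: "1/4 < t j x" using t_lip[of j y x] y(3) d128 unfolding d_def by linarith
  have ky: "dist (\<kappa> j y) (\<kappa> j x) \<le> 32 * D * d"
  proof -
    have "dist (\<kappa> j y) (\<kappa> j x) \<le> 4 / t j y * d"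
      unfolding d_def using tx y(3) by (intro kappa_dist j x) auto
    also have "\<dots> \<le> 32 * d" using y(3) d0 by (intro mult_right_mono) (auto simp: field_simps)
    also have "\<dots> \<le> 32 * D * d" using dD by simp
    finally show ?thesis .
  qed
  have tR: "1/8 < t j (R y)" and kR: "dist (\<kappa> j (R y)) (\<kappa> j x) \<le> 32 * D * d" if "0 < W j y"
  proof -
    have Ry: "dist (R y) x \<le> D * d"
      using R x y(1) \<eta>'(1) that unfolding retracts_to_def d_def by auto
    then show tR: "1/8 < t j (R y)" using t_lip[of j "R y" x] tx Dd by linarith
    have "dist (\<kappa> j (R y)) (\<kappa> j x) \<le> 4 / t j (R y) * dist (R y) x"
      using tx tR by (intro kappa_dist j x) auto
    also have "\<dots> \<le> 32 * (D * d)"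
      using Ry tR by (intro mult_mono) (auto simp: field_simps)
    finally show "dist (\<kappa> j (R y)) (\<kappa> j x) \<le> 32 * D * d" by simp
  qed
  show "0 < W j y \<Longrightarrow> 1/8 < t j (R y)" by (rule tR)
  define \<theta> where "\<theta> = w j y / W (Suc j) y"
  have \<theta>: "0 \<le> \<theta>" "\<theta> \<le> 1"
    using y(2) w_nonneg[of j y] W_nonneg[of j y] by (auto simp: \<theta>_def W_Suc field_simps)
  have one: "\<theta> = 1" if "W j y = 0" using that y(2) by (simp add: \<theta>_def W_Suc)
  have "blend j R y - \<kappa> j x = (1 - \<theta>) *\<^sub>R (\<kappa> j (R y) - \<kappa> j x) + \<theta> *\<^sub>R (\<kappa> j y - \<kappa> j x)"
    by (simp add: blend_def \<theta>_def[symmetric] algebra_simps)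
  then have "dist (blend j R y) (\<kappa> j x)
      \<le> norm ((1 - \<theta>) *\<^sub>R (\<kappa> j (R y) - \<kappa> j x)) + norm (\<theta> *\<^sub>R (\<kappa> j y - \<kappa> j x))"
    unfolding dist_norm by (metis norm_triangle_ineq)
  also have "\<dots> = (1 - \<theta>) * dist (\<kappa> j (R y)) (\<kappa> j x) + \<theta> * dist (\<kappa> j y) (\<kappa> j x)"
    using \<theta> by (simp add: dist_norm)
  also have "\<dots> \<le> (1 - \<theta>) * (32 * D * d) + \<theta> * (32 * D * d)"
  proof (rule add_mono)
    show "(1 - \<theta>) * dist (\<kappa> j (R y)) (\<kappa> j x) \<le> (1 - \<theta>) * (32 * D * d)"
    proof (cases "W j y = 0")
      case False
      then have "0 < W j y" using W_nonneg[of j y] by simp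
      then show ?thesis using \<theta> kR by (intro mult_left_mono) auto
    qed (simp add: one)
    show "\<theta> * dist (\<kappa> j y) (\<kappa> j x) \<le> \<theta> * (32 * D * d)" using \<theta> ky by (intro mult_left_mono) auto
  qed
  finally have b: "dist (blend j R y) (\<kappa> j x) \<le> 32 * D * d" by (simp add: algebra_simps)
  then show "dist (blend j R y) (\<kappa> j x) \<le> 32 * D * dist y x" by (simp add: d_def)
  have "norm (blend j R y) \<le> norm (\<kappa> j x) + dist (blend j R y) (\<kappa> j x)"
    using norm_triangle_sub[of "blend j R y" "\<kappa> j x"] by (simp add: dist_norm)
  \<comment> \<open>The slack \<open>t j x\<close> in \<open>coord_norm\<close> exceeds 1/4 and
    absorbs the deviation of the average, which therefore stays in the ball where \<open>G j\<close>
    is controlled.\<close>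
  also have "\<dots> \<le> (3 - t j x) + 1/4"
    using coord_norm[OF j x] tx b Dd by (intro add_mono) (auto simp: \<kappa>_def)
  finally show "norm (blend j R y) \<le> 3" using tx by simp
qed

text \<open>The critical points are those with \<open>W j y = 0\<close>, where \<open>R\<close> is
  not controlled. Nearby, \<open>\<kappa> j (R z)\<close> is bounded by 3 wherever its coefficient
  is nonzero, and this coefficient tends to 0.\<close>

lemma continuous_on_blend:
  assumes j: "j < q" and R: "retracts_to j D \<eta> R" and \<eta>': "\<eta>' \<le> \<eta>" "\<eta>' \<le> 1 / (128 * D)"
  shows "continuous_on (nbhd \<eta>' \<inter> {y. 0 < W (Suc j) y} \<inter> {y. 3/8 < t j y}) (blend j R)"
proof -
  let ?A = "nbhd \<eta>' \<inter> {y. 0 < W (Suc j) y} \<inter> {y. 3/8 < t j y}"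
  have opA: "open ?A"
    by (intro open_Int open_nbhd open_Collect_less continuous_intros)
  have c\<theta>: "continuous_on ?A (\<lambda>y. w j y / W (Suc j) y)"
    by (intro continuous_intros) auto
  have c2: "continuous_on ?A (\<lambda>y. (w j y / W (Suc j) y) *\<^sub>R \<kappa> j y)"
    using c\<theta> by (intro continuous_intros continuous_on_kappa) auto
  have near: "1/8 < t j (R y) \<and> R y \<in> M" if y: "y \<in> ?A" "0 < W j y" for y
  proof -
    obtain x where x: "x \<in> M" "dist y x < \<eta>'" using y by (auto simp: nbhd_def)
    then show ?thesis
      using blend_near(4)[OF j R \<eta>' x] y R \<eta>'(1) unfolding retracts_to_def by auto
  qed
  have bd: "norm (\<kappa> j (R y)) \<le> 3" if y: "y \<in> ?A" "0 < W j y" for y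
    using coord_norm[OF j, of "R y"] near[OF that] by (simp add: \<kappa>_def)
  let ?f = "\<lambda>y. (1 - w j y / W (Suc j) y) *\<^sub>R \<kappa> j (R y)"
  have "continuous (at y within ?A) ?f" if y: "y \<in> ?A" for y
  proof (cases "W j y = 0")
    case False
    let ?B = "?A \<inter> {y. 0 < W j y}"
    have yB: "y \<in> ?B" using False W_nonneg[of j y] y by auto
    have opB: "open ?B" by (intro open_Int opA open_Collect_less continuous_intros)
    have cR: "continuous_on ?B R"
    proof (rule continuous_on_subset)
      show "continuous_on (nbhd \<eta> \<inter> {y. 0 < W j y}) R" using R by (simp add: retracts_to_def)
      show "?B \<subseteq> nbhd \<eta> \<inter> {y. 0 < W j y}" using \<eta>'(1) by (force simp: nbhd_def)
    qed
    have "continuous_on ?B (\<lambda>y. \<kappa> j (R y))"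
    proof (rule continuous_on_compose2[OF _ cR])
      show "continuous_on {z. 1/8 < t j z} (\<kappa> j)" by (intro continuous_on_kappa) auto
      show "R ` ?B \<subseteq> {z. 1/8 < t j z}" using near by auto
    qed
    moreover have "continuous_on ?B (\<lambda>y. w j y / W (Suc j) y)"
      by (rule continuous_on_subset[OF c\<theta>]) auto
    ultimately have "continuous_on ?B ?f"
      by (intro continuous_on_scaleR continuous_on_diff continuous_on_const)
    then have "continuous (at y) ?f" using continuous_on_eq_continuous_at[OF opB] yB by blast
    then show ?thesis by (rule continuous_at_imp_continuous_at_within)
  next
    case True
    have \<theta>1: "w j y / W (Suc j) y = 1" using True y by (simp add: W_Suc)
    have "((\<lambda>z. w j z / W (Suc j) z) \<longlongrightarrow> w j y / W (Suc j) y) (at y within ?A)"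
      using c\<theta> y unfolding continuous_on_def by blast
    then have lim: "((\<lambda>z. 3 * (1 - w j z / W (Suc j) z)) \<longlongrightarrow> 3 * (1 - w j y / W (Suc j) y)) (at y within ?A)"
      by (intro tendsto_mult tendsto_diff tendsto_const)
    have "norm (?f z) \<le> 3 * (1 - w j z / W (Suc j) z)" if z: "z \<in> ?A" for z
    proof (cases "W j z = 0")
      case True
      then show ?thesis using z by (simp add: W_Suc)
    next
      case False
      then have "norm (\<kappa> j (R z)) \<le> 3" using bd[OF z] W_nonneg[of j z] by simp
      moreover have le: "w j z / W (Suc j) z \<le> 1"
        using z W_nonneg[of j z] by (simp add: W_Suc)
      ultimately have "norm (\<kappa> j (R z)) * (1 - w j z / W (Suc j) z) \<le> 3 * (1 - w j z / W (Suc j) z)"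
        by (intro mult_right_mono) auto
      then show ?thesis using le by (simp add: mult.commute)
    qed
    then have "\<forall>\<^sub>F z in at y within ?A. norm (?f z) \<le> 3 * (1 - w j z / W (Suc j) z)"
      by (simp add: eventually_at_filter)
    then have "(?f \<longlongrightarrow> 0) (at y within ?A)"
      by (rule Lim_null_comparison) (use lim \<theta>1 in simp)
    then show ?thesis using \<theta>1 by (simp add: continuous_within)
  qed
  then have "continuous_on ?A ?f" by (simp add: continuous_on_eq_continuous_within)
  from continuous_on_add[OF this c2] show ?thesis by (simp add: blend_def[abs_def])
qed

lemma retracts_to_ex:
  assumes "j \<le> q"
  shows "\<exists>D \<eta> R. retracts_to j D \<eta> R"
  using assms
proof (induction j)
  case 0
  have "retracts_to 0 1 1 (\<lambda>y. y)" by (auto simp: retracts_to_def W_def)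
  then show ?case by blast
next
  case (Suc j)
  then obtain D \<eta> R where R: "retracts_to j D \<eta> R" by auto
  have j: "j < q" using Suc.prems by simp
  have D: "1 \<le> D" "0 < \<eta>" using R by (auto simp: retracts_to_def)
  define \<eta>' where "\<eta>' = min \<eta> (1 / (128 * D))"
  have \<eta>': "\<eta>' \<le> \<eta>" "\<eta>' \<le> 1 / (128 * D)" "0 < \<eta>'" using D by (auto simp: \<eta>'_def)
  \<comment> \<open>On the overlap 3/8 < t j y < 1/2 the weight \<open>w j y\<close> is 0, so
    \<open>blend j R y\<close> is \<open>\<kappa> j (R y)\<close> and \<open>G j\<close> maps it
    back to \<open>R y\<close>: the two branches agree on an open zone and can be glued.\<close>
  define R' where "R' y = (if 3/8 < t j y then G j (blend j R y) else R y)" for y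
  \<comment> \<open>The factor 32 D comes from \<open>blend_near\<close>, and \<open>C\<close> from
    \<open>G_lip\<close>.\<close>
  define D' where "D' = 32 * C * D"
  have D': "D \<le> D'" "1 \<le> D'"
  proof -
    have "1 * D \<le> (32 * C) * D" using C_ge_1 D by (intro mult_right_mono) auto
    then show "D \<le> D'" by (simp add: D'_def)
    then show "1 \<le> D'" using D(1) by linarith
  qed
  let ?A = "nbhd \<eta>' \<inter> {y. 0 < W (Suc j) y}"
  have Wpos: "0 < W j y" if "0 < W (Suc j) y" "t j y \<le> 1/2" for y
    using that by (simp add: W_Suc w_def)
  have in3: "norm (blend j R y) \<le> 3" if y: "y \<in> ?A \<inter> {y. 3/8 < t j y}" for y
  proof -
    obtain x where x: "x \<in> M" "dist y x < \<eta>'" using y by (auto simp: nbhd_def)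
    then show ?thesis using blend_near(2)[OF j R \<eta>'(1,2) x] y by auto
  qed
  have cG: "continuous_on (?A \<inter> {y. 3/8 < t j y}) (\<lambda>y. G j (blend j R y))"
    by (rule continuous_on_compose2[OF continuous_on_G[OF j] continuous_on_blend[OF j R \<eta>'(1,2)]])
       (use in3 in auto)
  have c1: "continuous_on (?A \<inter> {y. 3/8 < t j y}) R'"
    by (rule continuous_on_eq[OF cG]) (simp add: R'_def)
  have cR: "continuous_on (?A \<inter> {y. t j y < 1/2}) R"
  proof (rule continuous_on_subset)
    show "continuous_on (nbhd \<eta> \<inter> {y. 0 < W j y}) R" using R by (simp add: retracts_to_def)
    show "?A \<inter> {y. t j y < 1/2} \<subseteq> nbhd \<eta> \<inter> {y. 0 < W j y}"
      using \<eta>'(1) Wpos by (force simp: nbhd_def)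
  qed
  have c2: "continuous_on (?A \<inter> {y. t j y < 1/2}) R'"
  proof (rule continuous_on_eq[OF cR])
    fix y assume y: "y \<in> ?A \<inter> {y. t j y < 1/2}"
    show "R y = R' y"
    proof (cases "3/8 < t j y")
      case True
      obtain x where x: "x \<in> M" "dist y x < \<eta>'" using y by (auto simp: nbhd_def)
      have "w j y = 0" using y by (simp add: w_def)
      moreover have "0 < W j y" using y Wpos by simp
      moreover have "1/8 < t j (R y)"
        using blend_near(4)[OF j R \<eta>'(1,2) x _ True] y \<open>0 < W j y\<close> by auto
      moreover have "R y \<in> M" using R x \<eta>'(1) \<open>0 < W j y\<close> unfolding retracts_to_def by auto
      ultimately show ?thesis using True G_coord[OF j, of "R y"] by (simp add: R'_def blend_def \<kappa>_def)
    qed (simp add: R'_def)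
  qed
  have "continuous_on ((?A \<inter> {y. 3/8 < t j y}) \<union> (?A \<inter> {y. t j y < 1/2})) R'"
    by (intro continuous_on_open_Un c1 c2 open_Int open_nbhd open_Collect_less continuous_intros)
  also have "(?A \<inter> {y. 3/8 < t j y}) \<union> (?A \<inter> {y. t j y < 1/2}) = ?A" by auto
  finally have c: "continuous_on ?A R'" .
  have "R' y \<in> M \<and> dist (R' y) x \<le> D' * dist y x" if x: "x \<in> M" "dist y x < \<eta>'" and y: "0 < W (Suc j) y" for x y
  proof (cases "3/8 < t j y")
    case True
    note b = blend_near[OF j R \<eta>'(1,2) x y True]
    have kx: "norm (\<kappa> j x) \<le> 3" "G j (\<kappa> j x) = x"
      using coord_norm[OF j x(1)] G_coord[OF j x(1)] b(3) by (auto simp: \<kappa>_def)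
    have "dist (G j (blend j R y)) (G j (\<kappa> j x)) \<le> C * dist (blend j R y) (\<kappa> j x)"
      by (intro G_lip j b kx)
    also have "\<dots> \<le> C * (32 * D * dist y x)" using C_ge_1 b(1) by (intro mult_left_mono) auto
    finally show ?thesis using True G_in[OF j b(2)] kx by (simp add: R'_def D'_def mult_ac)
  next
    case False
    then have "R y \<in> M \<and> dist (R y) x \<le> D * dist y x"
      using R x y \<eta>'(1) Wpos unfolding retracts_to_def by auto
    moreover have "D * dist y x \<le> D' * dist y x" using D' by (intro mult_right_mono) auto
    ultimately show ?thesis using False by (auto simp: R'_def)
  qed
  then have "retracts_to (Suc j) D' \<eta>' R'"
    unfolding retracts_to_def using c D' \<eta>'(3) by blast
  then show ?case by blast
qed

lemma lipschitz_neighbourhood_retract: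
  obtains D \<eta> r where "1 \<le> D" "0 < \<eta>" "\<eta> \<le> 1" "continuous_on (nbhd \<eta>) r"
    "\<And>x y. x \<in> M \<Longrightarrow> dist y x < \<eta> \<Longrightarrow> r y \<in> M \<and> dist (r y) x \<le> D * dist y x"
proof -
  obtain D \<eta> R where R: "retracts_to q D \<eta> R" using retracts_to_ex by blast
  \<comment> \<open>Within distance 1/4 of \<open>x\<close> the chart with \<open>t i x = 1\<close>
    still has t i > 1/2, so its weight is positive and \<open>R\<close> is controlled.\<close>
  define \<eta>' where "\<eta>' = min \<eta> (1/4)"
  have W: "0 < W q y" if x: "x \<in> M" "dist y x < \<eta>'" for x y
  proof -
    obtain i where i: "i < q" "t i x = 1" using cover[OF x(1)] by blast
    have "dist y x < 1/4" using x(2) by (simp add: \<eta>'_def)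
    then have "1/2 < t i y" using t_lip[of i y x] i(2) by linarith
    then have "0 < w i y" by (simp add: w_def)
    also have "w i y \<le> W q y" unfolding W_def using i w_nonneg by (intro member_le_sum) auto
    finally show ?thesis .
  qed
  have sub: "nbhd \<eta>' \<subseteq> nbhd \<eta> \<inter> {y. 0 < W q y}"
    using W by (force simp: nbhd_def \<eta>'_def)
  show thesis
  proof (rule that[of D \<eta>' R])
    show "continuous_on (nbhd \<eta>') R"
      using R sub continuous_on_subset unfolding retracts_to_def by blast
    show "R y \<in> M \<and> dist (R y) x \<le> D * dist y x" if x: "x \<in> M" "dist y x < \<eta>'" for x y
      using R x W[OF x] unfolding retracts_to_def \<eta>'_def by auto
  qed (use R in \<open>auto simp: retracts_to_def \<eta>'_def\<close>)
qed

text \<open>Two points of \<open>M\<close> closer than 1/4 lie in a common chart, where the local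
  bound applies; for all others the global bound 2 L equals 8 L times 1/4. The function
  \<open>e x x'\<close> will be the distance of the values of f.\<close>

lemma pseudodist_le_if_local:
  assumes loc: "\<And>i u u'. i < q \<Longrightarrow> norm u \<le> 3 \<Longrightarrow> norm u' \<le> 3 \<Longrightarrow> e (G i u) (G i u') \<le> L * dist u u'"
    and glob: "\<And>x x'. x \<in> M \<Longrightarrow> x' \<in> M \<Longrightarrow> e x x' \<le> 2 * L" and L: "0 \<le> L"
    and x: "x \<in> M" "x' \<in> M"
  shows "e x x' \<le> 8 * L * dist x x'"
proof (cases "dist x x' < 1/4")
  case True
  obtain i where i: "i < q" "t i x = 1" using cover[OF x(1)] by blast
  have t': "3/4 \<le> t i x'" using t_lip[of i x' x] i True by (simp add: dist_commute)
  have "norm (\<kappa> i x) \<le> 3" "norm (\<kappa> i x') \<le> 3" "G i (\<kappa> i x) = x" "G i (\<kappa> i x') = x'"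
    using coord_norm[OF i(1) x(1)] coord_norm[OF i(1) x(2)] G_coord[OF i(1) x(1)] G_coord[OF i(1) x(2)] i t'
    by (auto simp: \<kappa>_def)
  then have "e x x' \<le> L * dist (\<kappa> i x) (\<kappa> i x')" using loc[OF i(1), of "\<kappa> i x" "\<kappa> i x'"] by simp
  also have "\<dots> \<le> L * (4 * dist x x')"
    using kappa_dist[OF i(1) x(2), of x] i t' L by (intro mult_left_mono) auto
  also have "\<dots> \<le> 8 * L * dist x x'" using L by simp
  finally show ?thesis .
next
  case False
  have "e x x' \<le> 8 * L * (1/4)" using glob[OF x] by simp
  also have "\<dots> \<le> 8 * L * dist x x'" using False L by (intro mult_left_mono) auto
  finally show ?thesis .
qed

text \<open>Where t i = 1 the coordinate of \<open>x\<close> is \<open>a i x\<close>, and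
  \<open>G i\<close> inverts it with Lipschitz constant \<open>C\<close>. So these coordinates are
  \<epsilon>/C-separated, and the grid count applies in each of the \<open>q\<close> charts.\<close>

lemma card_separated_in_chart_balls:
  fixes B :: "'e set"
  assumes B: "finite B" "orthonormal B" "span B = UNIV"
    and S: "S \<subseteq> M" "separated \<epsilon> S" "\<And>i x. i < q \<Longrightarrow> x \<in> S \<Longrightarrow> t i x = 1 \<Longrightarrow> dist (p i) (a i x) \<le> R"
    and \<epsilon>: "0 < \<epsilon>" "0 \<le> R"
  shows "finite S \<and> real (card S) \<le> real q * (2 * R * (real (card B) + 1) * C / \<epsilon> + 2) ^ card B"
proof -
  define S' where "S' i = {x \<in> S. t i x = 1}" for i
  have Sun: "S = (\<Union>i<q. S' i)" using cover S(1) unfolding S'_def by blast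
  let ?n = "(2 * R * (real (card B) + 1) * C / \<epsilon> + 2) ^ card B"
  have *: "finite (S' i) \<and> real (card (S' i)) \<le> ?n" if i: "i < q" for i
  proof -
    have d: "dist x y \<le> C * dist (a i x) (a i y)" if "x \<in> S' i" "y \<in> S' i" for x y
    proof -
      have "norm (a i z) \<le> 3 \<and> G i (a i z) = z" if "z \<in> S' i" for z
        using coord_norm[OF i, of z] G_coord[OF i, of z] that S(1) by (auto simp: S'_def)
      then show ?thesis using G_lip[OF i, of "a i x" "a i y"] that by auto
    qed
    have inj: "inj_on (a i) (S' i)"
    proof (rule inj_onI)
      fix x y assume "x \<in> S' i" "y \<in> S' i" "a i x = a i y"
      then show "x = y" using d[of x y] by simp
    qed
    have "separated (\<epsilon> / C) (a i ` S' i)"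
      unfolding separated_def
    proof clarsimp
      fix x y assume xy: "x \<in> S' i" "y \<in> S' i" "a i x \<noteq> a i y"
      then have "\<epsilon> \<le> dist x y" using S(2) unfolding separated_def S'_def by auto
      then show "\<epsilon> / C \<le> dist (a i x) (a i y)" using d[OF xy(1,2)] C_ge_1 by (simp add: field_simps)
    qed
    moreover have "a i ` S' i \<subseteq> cball (p i) R" using S(3)[OF i] by (auto simp: S'_def)
    ultimately have "finite (a i ` S' i) \<and> real (card (a i ` S' i)) \<le> (2 * R * (real (card B) + 1) / (\<epsilon> / C) + 2) ^ card B"
      using \<epsilon> C_ge_1 by (intro card_separated_le B) auto
    then show ?thesis using finite_imageD[OF _ inj] card_image[OF inj] by simp
  qed
  have "finite S" unfolding Sun using * by auto
  have "card S \<le> (\<Sum>i<q. card (S' i))" unfolding Sun by (rule card_UN_le) simp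
  then have "real (card S) \<le> (\<Sum>i<q. real (card (S' i)))" by (metis of_nat_le_iff of_nat_sum)
  also have "\<dots> \<le> (\<Sum>i<q. ?n)" using * by (intro sum_mono) auto
  finally show ?thesis using \<open>finite S\<close> by simp
qed

lemma card_separated_global:
  fixes B :: "'e set"
  assumes B: "finite B" "orthonormal B" "span B = UNIV"
    and S: "S \<subseteq> M" "separated \<epsilon> S" and \<epsilon>: "0 < \<epsilon>" "\<epsilon> \<le> 1"
  shows "finite S \<and> real (card S) \<le> real q * (6 * (real (card B) + 1) * C + 2) ^ card B / \<epsilon> ^ card B"
proof -
  let ?n = "6 * (real (card B) + 1) * C"
  have "finite S \<and> real (card S) \<le> real q * (2 * 3 * (real (card B) + 1) * C / \<epsilon> + 2) ^ card B"
  proof (rule card_separated_in_chart_balls[OF B S])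
    show "dist 0 (a i x) \<le> 3" if "i < q" "x \<in> S" "t i x = 1" for i x
      using coord_norm[of i x] that S(1) by auto
  qed (use \<epsilon> in auto)
  moreover have "(2 * 3 * (real (card B) + 1) * C / \<epsilon> + 2) ^ card B \<le> ((?n + 2) / \<epsilon>) ^ card B"
  proof (rule power_mono)
    \<comment> \<open>As \<epsilon> is at most 1, the summand 2 is absorbed into the quotient by
      \<epsilon>.\<close>
    have "2 \<le> 2 / \<epsilon>" using \<epsilon> by (simp add: le_divide_eq)
    then show "2 * 3 * (real (card B) + 1) * C / \<epsilon> + 2 \<le> (?n + 2) / \<epsilon>"
      by (simp add: add_divide_distrib)
    show "0 \<le> 2 * 3 * (real (card B) + 1) * C / \<epsilon> + 2" using \<epsilon> C_ge_1 by simp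
  qed
  then have "real q * (2 * 3 * (real (card B) + 1) * C / \<epsilon> + 2) ^ card B \<le> real q * ((?n + 2) / \<epsilon>) ^ card B"
    by (intro mult_left_mono) auto
  ultimately show ?thesis unfolding power_divide times_divide_eq_right by linarith
qed

text \<open>The radius is proportional to the separation, so \<epsilon> cancels; this bounds the
  number of neighbours of a ball uniformly.\<close>

lemma card_separated_local:
  fixes B :: "'e set"
  assumes B: "finite B" "orthonormal B" "span B = UNIV"
    and S: "S \<subseteq> M" "separated \<epsilon> S" and \<epsilon>: "0 < \<epsilon>"
  shows "real (card {y\<in>S. dist z y < 2 * \<epsilon>}) \<le> real q * (4 * (real (card B) + 1) * C + 2) ^ card B"
proof -
  have "finite {y\<in>S. dist z y < 2 * \<epsilon>} \<and> real (card {y\<in>S. dist z y < 2 * \<epsilon>})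
      \<le> real q * (2 * (2 * \<epsilon>) * (real (card B) + 1) * C / \<epsilon> + 2) ^ card B"
  proof (rule card_separated_in_chart_balls[OF B, where p = "\<lambda>i. a i z"])
    show "separated \<epsilon> {y\<in>S. dist z y < 2 * \<epsilon>}" by (rule separated_subset[OF S(2)]) auto
    show "dist (a i z) (a i y) \<le> 2 * \<epsilon>" if "y \<in> {y\<in>S. dist z y < 2 * \<epsilon>}" for i y
      using a_lip[of i z y] that by simp
  qed (use S \<epsilon> in auto)
  moreover have "2 * (2 * \<epsilon>) * (real (card B) + 1) * C / \<epsilon> = 4 * (real (card B) + 1) * C"
    using \<epsilon> by (simp add: field_simps)
  ultimately show ?thesis by simp
qed

text \<open>\<open>Z\<close> is a retract of the union of the balls around a maximal separated subset of \<open>Z\<close>.\<close>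

lemma total_betti_retract_bound:
  fixes B :: "'e set"
  assumes B: "finite B" "orthonormal B" "span B = UNIV"
  shows "\<exists>c D \<eta>. 0 < c \<and> 1 \<le> D \<and> 0 < \<eta> \<and> \<eta> \<le> 1 \<and>
    (\<forall>\<epsilon> Z U \<rho>. 0 < \<epsilon> \<longrightarrow> \<epsilon> \<le> \<eta> \<longrightarrow> Z \<subseteq> M \<longrightarrow> (\<forall>x\<in>M. \<forall>z\<in>Z. dist x z \<le> D * \<epsilon> \<longrightarrow> x \<in> U) \<longrightarrow>
      continuous_on U \<rho> \<longrightarrow> \<rho> ` U \<subseteq> Z \<longrightarrow> (\<forall>z\<in>Z. \<rho> z = z) \<longrightarrow>
      total_betti (top_of_set Z) \<le> ennreal (c / \<epsilon> ^ card B))"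
proof -
  obtain D \<eta> r where r: "1 \<le> D" "0 < \<eta>" "\<eta> \<le> 1" "continuous_on (nbhd \<eta>) r"
    "\<And>x y. x \<in> M \<Longrightarrow> dist y x < \<eta> \<Longrightarrow> r y \<in> M \<and> dist (r y) x \<le> D * dist y x"
    using lipschitz_neighbourhood_retract by metis
  define N where "N = real q * (6 * (real (card B) + 1) * C + 2) ^ card B"
  \<comment> \<open>This bounds how many balls of the cover meet a given one.\<close>
  define k where "k = nat \<lfloor>real q * (4 * (real (card B) + 1) * C + 2) ^ card B\<rfloor>"
  have N0: "0 \<le> N" using C_ge_1 by (simp add: N_def)
  \<comment> \<open>The summand 1 keeps \<open>c\<close> positive when \<open>M\<close> is empty and
    \<open>q\<close> is 0.\<close>
  define c where "c = N * 2 ^ k + 1"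
  have c: "0 < c" using N0 by (simp add: c_def add_nonneg_pos)
  have "total_betti (top_of_set Z) \<le> ennreal (c / \<epsilon> ^ card B)"
    if \<epsilon>: "0 < \<epsilon>" "\<epsilon> \<le> \<eta>" and ZM: "Z \<subseteq> M" and U: "\<forall>x\<in>M. \<forall>z\<in>Z. dist x z \<le> D * \<epsilon> \<longrightarrow> x \<in> U"
      and \<rho>: "continuous_on U \<rho>" "\<rho> ` U \<subseteq> Z" "\<forall>z\<in>Z. \<rho> z = z" for \<epsilon> Z U \<rho>
  proof -
    have \<epsilon>1: "\<epsilon> \<le> 1" using \<epsilon> r by simp
    have cardS: "finite S \<and> real (card S) \<le> N / \<epsilon> ^ card B" if "S \<subseteq> Z" "separated \<epsilon> S" for S
      using card_separated_global[OF B _ that(2) \<epsilon>(1) \<epsilon>1] that ZM unfolding N_def by auto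
    \<comment> \<open>A separated subset of largest cardinality exists because \<open>cardS\<close>
      bounds all of them; it cannot be enlarged, so its \<epsilon>-balls cover
      \<open>Z\<close>.\<close>
    let ?P = "\<lambda>n. \<exists>S. S \<subseteq> Z \<and> separated \<epsilon> S \<and> card S = n"
    have "?P 0" by (intro exI[of _ "{}"]) (auto simp: separated_def)
    moreover have "\<forall>n. ?P n \<longrightarrow> n \<le> nat \<lceil>N / \<epsilon> ^ card B\<rceil>"
    proof (intro allI impI)
      fix n assume "?P n"
      then have "real n \<le> N / \<epsilon> ^ card B" using cardS by blast
      then show "n \<le> nat \<lceil>N / \<epsilon> ^ card B\<rceil>" by linarith
    qed
    ultimately obtain n where n: "?P n" "\<And>n'. ?P n' \<Longrightarrow> n' \<le> n"
      using Nat.ex_has_greatest_nat[of ?P 0 "nat \<lceil>N / \<epsilon> ^ card B\<rceil>"] by blast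
    then obtain S where S: "S \<subseteq> Z" "separated \<epsilon> S" "card S = n" by blast
    have finS: "finite S" using cardS S by blast
    have dense: "\<exists>s\<in>S. dist s z < \<epsilon>" if z: "z \<in> Z" for z
    proof (rule ccontr)
      assume *: "\<not> (\<exists>s\<in>S. dist s z < \<epsilon>)"
      then have "z \<notin> S" using \<epsilon> by auto
      moreover have "separated \<epsilon> (insert z S)"
        using S(2) * unfolding separated_def by (auto simp: dist_commute not_less)
      ultimately have "?P (Suc n)"
        using S finS z by (intro exI[of _ "insert z S"]) auto
      then have "Suc n \<le> n" by (rule n(2))
      then show False by simp
    qed
    define P where "P = (\<Union>s\<in>S. ball s \<epsilon>)"
    have ZP: "Z \<subseteq> P" using dense by (auto simp: P_def)
    have Pn: "P \<subseteq> nbhd \<eta>"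
    proof
      fix y assume "y \<in> P"
      then obtain s where "s \<in> S" "dist y s < \<epsilon>" by (auto simp: P_def dist_commute)
      then show "y \<in> nbhd \<eta>" using S(1) ZM \<epsilon>(2) unfolding nbhd_def by (auto intro!: bexI[of _ s])
    qed
    have rU: "r y \<in> U" if y: "y \<in> P" for y
    proof -
      obtain s where s: "s \<in> S" "dist y s < \<epsilon>" using y by (auto simp: P_def dist_commute)
      then have "r y \<in> M" "dist (r y) s \<le> D * dist y s"
        using r(5)[of s y] S(1) ZM \<epsilon> by auto
      moreover have "D * dist y s \<le> D * \<epsilon>" using s r(1) by (intro mult_left_mono) auto
      ultimately have "dist (r y) s \<le> D * \<epsilon>" by linarith
      then show ?thesis using U \<open>r y \<in> M\<close> s(1) S(1) by blast
    qed
    have rZ: "r z = z" if "z \<in> Z" for z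
      using r(5)[of z z] r(2) that ZM by auto
    \<comment> \<open>The left inverse of the inclusion of \<open>Z\<close> into \<open>P\<close> is
      \<rho> after \<open>r\<close>: the map \<open>r\<close> sends \<open>P\<close> into
      \<open>U\<close> and fixes \<open>Z\<close>.\<close>
    have "section_map (top_of_set Z) (top_of_set P) (\<lambda>z. z)"
      unfolding section_map_def retraction_maps_def
    proof (intro exI conjI)
      show "continuous_map (top_of_set Z) (top_of_set P) (\<lambda>z. z)"
        using ZP by (simp add: continuous_map_in_subtopology continuous_on_id Pi_iff subset_iff)
      have "continuous_on P (\<lambda>y. \<rho> (r y))"
        by (rule continuous_on_compose2[OF \<rho>(1) continuous_on_subset[OF r(4) Pn]]) (use rU in auto)
      then show "continuous_map (top_of_set P) (top_of_set Z) (\<lambda>y. \<rho> (r y))"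
        using rU \<rho>(2) by (simp add: continuous_map_in_subtopology Pi_iff image_subset_iff)
      show "\<forall>x\<in>topspace (top_of_set Z). \<rho> (r x) = x" using rZ \<rho>(3) by simp
    qed
    then have "total_betti (top_of_set Z) \<le> total_betti (top_of_set P)"
      by (rule total_betti_section_map)
    also have "\<dots> \<le> of_nat (card {J. J \<subseteq> S \<and> J \<noteq> {} \<and> (\<Inter>s\<in>J. ball s \<epsilon>) \<noteq> {}})"
      unfolding P_def by (intro total_betti_nerve finS) auto
    also have "\<dots> \<le> of_nat (card S * 2 ^ k)"
    proof (intro of_nat_mono card_nerve_le finS)
      fix s assume s: "s \<in> S"
      have "{y\<in>S. ball s \<epsilon> \<inter> ball y \<epsilon> \<noteq> {}} \<subseteq> {y\<in>S. dist s y < 2 * \<epsilon>}"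
      proof clarsimp
        fix y assume "ball s \<epsilon> \<inter> ball y \<epsilon> \<noteq> {}"
        then obtain x where "dist s x < \<epsilon>" "dist y x < \<epsilon>" by auto
        then show "dist s y < 2 * \<epsilon>" using dist_triangle2[of s y x] by simp
      qed
      then have "card {y\<in>S. ball s \<epsilon> \<inter> ball y \<epsilon> \<noteq> {}} \<le> card {y\<in>S. dist s y < 2 * \<epsilon>}"
        using finS by (intro card_mono) auto
      also have "\<dots> \<le> k"
        using card_separated_local[OF B _ S(2) \<epsilon>(1), of s] S(1) ZM unfolding k_def
        by (simp add: le_nat_floor)
      finally show "card {y\<in>S. ball s \<epsilon> \<inter> ball y \<epsilon> \<noteq> {}} \<le> k" .
    qed
    also have "of_nat (card S * 2 ^ k) = ennreal (real (card S) * 2 ^ k)"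
      by (subst ennreal_of_nat_eq_real_of_nat) simp
    also have "\<dots> \<le> ennreal (c / \<epsilon> ^ card B)"
    proof (rule ennreal_leI)
      have "real (card S) * 2 ^ k \<le> N / \<epsilon> ^ card B * 2 ^ k"
        using cardS S by (intro mult_right_mono) auto
      also have "\<dots> \<le> c / \<epsilon> ^ card B"
        using \<epsilon> by (simp add: c_def divide_right_mono)
      finally show "real (card S) * 2 ^ k \<le> c / \<epsilon> ^ card B" .
    qed
    finally show ?thesis .
  qed
  then show ?thesis
    using c r(1-3) by (intro exI[of _ c] exI[of _ D] exI[of _ \<eta>] conjI allI impI) simp_all
qed

end

section \<open>Local Lipschitz continuity\<close>

definition lipschitz_near :: "('c::metric_space \<Rightarrow> 'd::metric_space) \<Rightarrow> 'c \<Rightarrow> bool" where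
  "lipschitz_near F p \<longleftrightarrow> (\<exists>r>0. \<exists>L\<ge>0. \<forall>u\<in>ball p r. \<forall>v\<in>ball p r. dist (F u) (F v) \<le> L * dist u v)"

lemma lipschitz_nearI:
  assumes "open V" "p \<in> V" "0 \<le> L" "\<And>u v. u \<in> V \<Longrightarrow> v \<in> V \<Longrightarrow> dist (F u) (F v) \<le> L * dist u v"
  shows "lipschitz_near F p"
proof -
  obtain r where "0 < r" "ball p r \<subseteq> V" using assms(1,2) openE by blast
  then have "\<forall>u\<in>ball p r. \<forall>v\<in>ball p r. dist (F u) (F v) \<le> L * dist u v" using assms(4) by blast
  then show ?thesis unfolding lipschitz_near_def using \<open>0 < r\<close> assms(3) by blast
qed

lemma lipschitz_nearE:
  assumes "lipschitz_near F p" "open V" "p \<in> V"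
  obtains r L where "0 < r" "0 \<le> L" "ball p r \<subseteq> V"
    "\<And>u v. u \<in> ball p r \<Longrightarrow> v \<in> ball p r \<Longrightarrow> dist (F u) (F v) \<le> L * dist u v"
proof -
  obtain r L where r: "0 < r" "0 \<le> L" "\<forall>u\<in>ball p r. \<forall>v\<in>ball p r. dist (F u) (F v) \<le> L * dist u v"
    using assms(1) unfolding lipschitz_near_def by blast
  obtain r' where r': "0 < r'" "ball p r' \<subseteq> V" using assms(2,3) openE by blast
  show thesis
    by (rule that[of "min r r'" L]) (use r r' in auto)
qed

lemma lipschitz_near_imp_isCont:
  assumes "lipschitz_near F p"
  shows "isCont F p"
proof -
  obtain r L where r: "0 < r" "0 \<le> L" "\<And>u v. u \<in> ball p r \<Longrightarrow> v \<in> ball p r \<Longrightarrow> dist (F u) (F v) \<le> L * dist u v"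
    using lipschitz_nearE[OF assms open_UNIV UNIV_I] by metis
  show ?thesis
    unfolding continuous_at_eps_delta
  proof (intro allI impI)
    fix e :: real assume e: "0 < e"
    have "dist (F u) (F p) < e" if "dist u p < min r (e / (L + 1))" for u
    proof -
      have "dist (F u) (F p) \<le> L * dist u p" using r that by (intro r(3)) (auto simp: dist_commute)
      also have "\<dots> \<le> (L + 1) * dist u p" by (intro mult_right_mono) auto
      also have "\<dots> < (L + 1) * (e / (L + 1))" using r that by (intro mult_strict_left_mono) auto
      finally show ?thesis using r by simp
    qed
    then show "\<exists>d>0. \<forall>x'. dist x' p < d \<longrightarrow> dist (F x') (F p) < e"
      using r e by (intro exI[of _ "min r (e / (L + 1))"]) auto
  qed
qed

text \<open>Pairs closer than a Lebesgue number \<open>e\<close> of the cover lie in one ball and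
  use its constant; for all other pairs the bound \<open>b\<close> on distances in the image is at
  most b/e times their distance.\<close>

lemma lipschitz_on_compact_if_near:
  fixes F :: "'c::metric_space \<Rightarrow> 'd::metric_space"
  assumes K: "compact K" and near: "\<And>p. p \<in> K \<Longrightarrow> lipschitz_near F p"
  shows "\<exists>L\<ge>0. \<forall>u\<in>K. \<forall>v\<in>K. dist (F u) (F v) \<le> L * dist u v"
proof (cases "K = {}")
  case False
  have "\<forall>p\<in>K. \<exists>r L. 0 < r \<and> 0 \<le> L \<and> (\<forall>u\<in>ball p r. \<forall>v\<in>ball p r. dist (F u) (F v) \<le> L * dist u v)"
    using near unfolding lipschitz_near_def by metis
  then obtain r L where r: "\<And>p. p \<in> K \<Longrightarrow> 0 < r p \<and> 0 \<le> L p \<and>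
      (\<forall>u\<in>ball p (r p). \<forall>v\<in>ball p (r p). dist (F u) (F v) \<le> L p * dist u v)" by metis
  have "K \<subseteq> (\<Union>p\<in>K. ball p (r p))" using r by force
  then obtain Y where Y: "Y \<subseteq> K" "finite Y" "K \<subseteq> (\<Union>p\<in>Y. ball p (r p))"
    using compactE_image[OF K, of K "\<lambda>p. ball p (r p)"] by auto
  obtain e where e: "0 < e" "\<And>x. x \<in> K \<Longrightarrow> \<exists>G\<in>(\<lambda>p. ball p (r p)) ` Y. ball x e \<subseteq> G"
    using Heine_Borel_lemma[OF K, of "(\<lambda>p. ball p (r p)) ` Y"] Y(3) by auto
  have "continuous_on K F"
    by (intro continuous_at_imp_continuous_on ballI lipschitz_near_imp_isCont near)
  then have "bounded (F ` K)" by (intro compact_imp_bounded compact_continuous_image K)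
  then obtain b where b: "\<And>u v. u \<in> K \<Longrightarrow> v \<in> K \<Longrightarrow> dist (F u) (F v) \<le> b"
    unfolding bounded_two_points by auto
  obtain z where z: "z \<in> K" using False by blast
  have b0: "0 \<le> b" using b[OF z z] by simp
  define LL where "LL = (\<Sum>p\<in>Y. L p) + b / e"
  have L0: "0 \<le> (\<Sum>p\<in>Y. L p)" using r Y(1) by (intro sum_nonneg) auto
  have "dist (F u) (F v) \<le> LL * dist u v" if uv: "u \<in> K" "v \<in> K" for u v
  proof (cases "dist u v < e")
    case True
    obtain p where p: "p \<in> Y" "ball u e \<subseteq> ball p (r p)" using e(2)[OF uv(1)] by blast
    have "u \<in> ball p (r p)" "v \<in> ball p (r p)" using p(2) True e(1) by (auto simp: subset_iff)
    then have "dist (F u) (F v) \<le> L p * dist u v" using r p(1) Y(1) by blast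
    also have "L p \<le> (\<Sum>p\<in>Y. L p)" using p(1) Y(1,2) r by (intro member_le_sum) auto
    also have "\<dots> \<le> LL" using b0 e by (simp add: LL_def)
    finally show ?thesis by (simp add: mult_right_mono)
  next
    case False
    have "dist (F u) (F v) \<le> b / e * e" using b[OF uv] e(1) by simp
    also have "\<dots> \<le> b / e * dist u v" using False b0 e(1) by (intro mult_left_mono) auto
    also have "\<dots> \<le> LL * dist u v" using L0 by (intro mult_right_mono) (auto simp: LL_def)
    finally show ?thesis .
  qed
  moreover have "0 \<le> LL" using L0 b0 e by (simp add: LL_def)
  ultimately show ?thesis by blast
qed (auto intro: exI[of _ 0])

lemma frechet_derivative_norm_le:
  fixes F :: "'e::real_inner \<Rightarrow> 'f::real_normed_vector"
  assumes B: "finite B" "orthonormal B" "span B = UNIV" and d: "F differentiable (at u)"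
    and K: "\<And>b. b \<in> B \<Longrightarrow> norm (frechet_derivative F (at u) b) \<le> K"
  shows "norm (frechet_derivative F (at u) v) \<le> real (card B) * K * norm v"
proof -
  let ?D = "frechet_derivative F (at u)"
  have lin: "linear ?D" by (rule linear_frechet_derivative[OF d])
  have "?D v = ?D (\<Sum>b\<in>B. (v \<bullet> b) *\<^sub>R b)" using orthonormal_expansion[OF B(1,2)] B(3) by simp
  also have "\<dots> = (\<Sum>b\<in>B. (v \<bullet> b) *\<^sub>R ?D b)" by (simp add: linear_sum[OF lin] linear_cmul[OF lin])
  also have "norm \<dots> \<le> (\<Sum>b\<in>B. norm ((v \<bullet> b) *\<^sub>R ?D b))" by (rule norm_sum)
  also have "\<dots> \<le> (\<Sum>b\<in>B. norm v * K)"
  proof (rule sum_mono)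
    fix b assume b: "b \<in> B"
    then have "norm b = 1" using B(2) by (auto simp: orthonormal_def norm_eq_sqrt_inner)
    then have "\<bar>v \<bullet> b\<bar> \<le> norm v" using Cauchy_Schwarz_ineq2[of v b] by simp
    then show "norm ((v \<bullet> b) *\<^sub>R ?D b) \<le> norm v * K" using K[OF b] by (simp add: mult_mono)
  qed
  finally show ?thesis by (simp add: mult_ac)
qed

lemma Ck_on_1_iff:
  "Ck_on 1 F S \<longleftrightarrow> (\<forall>x\<in>S. F differentiable (at x)) \<and>
     (\<forall>v. continuous_on S (\<lambda>x. frechet_derivative F (at x) v))"
  by (simp add: One_nat_def)

text \<open>\<open>Ck_on 1\<close> only makes the derivative continuous in each fixed direction.
  Bounding it on the finitely many basis vectors near \<open>p\<close> bounds its operator norm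
  there, and the mean value inequality applies on a ball.\<close>

lemma lipschitz_near_if_C1:
  fixes F :: "'e::real_inner \<Rightarrow> 'f::real_normed_vector" and B :: "'e set"
  assumes B: "finite B" "orthonormal B" "span B = UNIV" and S: "open S" "p \<in> S" and F: "Ck_on 1 F S"
  shows "lipschitz_near F p"
proof -
  let ?D = "\<lambda>u v. frechet_derivative F (at u) v"
  have "\<exists>r>0. ball p r \<subseteq> S \<and> (\<forall>u\<in>ball p r. norm (?D u b) \<le> norm (?D p b) + 1)" if "b \<in> B" for b
  proof -
    have "continuous_on S (\<lambda>u. ?D u b)" using F unfolding Ck_on_1_iff by blast
    then have "isCont (\<lambda>u. ?D u b) p" using S continuous_on_eq_continuous_at by blast
    then have "isCont (\<lambda>u. norm (?D u b)) p" by (rule continuous_norm)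
    then have "\<exists>d>0. \<forall>u. dist u p < d \<longrightarrow> dist (norm (?D u b)) (norm (?D p b)) < 1"
      unfolding continuous_at_eps_delta using zero_less_one by blast
    then obtain d where d: "0 < d" "\<And>u. dist u p < d \<Longrightarrow> dist (norm (?D u b)) (norm (?D p b)) < 1"
      by blast
    obtain r where r: "0 < r" "ball p r \<subseteq> S" using S openE by blast
    show ?thesis
    proof (intro exI[of _ "min d r"] conjI ballI)
      fix u assume "u \<in> ball p (min d r)"
      then have "dist (norm (?D u b)) (norm (?D p b)) < 1" by (intro d(2)) (simp add: dist_commute)
      then show "norm (?D u b) \<le> norm (?D p b) + 1" unfolding dist_real_def by linarith
    qed (use d r in auto)
  qed
  then obtain r where r: "\<And>b. b \<in> B \<Longrightarrow> 0 < r b \<and> ball p (r b) \<subseteq> S \<and>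
      (\<forall>u\<in>ball p (r b). norm (?D u b) \<le> norm (?D p b) + 1)" by metis
  obtain r0 where r0: "0 < r0" "ball p r0 \<subseteq> S" using S openE by blast
  define R where "R = Min (insert r0 (r ` B))"
  have R: "0 < R" "R \<le> r0" "\<And>b. b \<in> B \<Longrightarrow> R \<le> r b"
    using B(1) r r0 by (auto simp: R_def)
  define K where "K = (\<Sum>b\<in>B. norm (?D p b) + 1)"
  have K0: "0 \<le> K" unfolding K_def by (intro sum_nonneg) auto
  have inS: "ball p R \<subseteq> S" using R(2) r0(2) by auto
  have Kb: "norm (?D u b) \<le> K" if "b \<in> B" "u \<in> ball p R" for u b
  proof -
    have "u \<in> ball p (r b)" using that R(3)[OF that(1)] by auto
    then have "norm (?D u b) \<le> norm (?D p b) + 1" using r[OF that(1)] by blast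
    also have "\<dots> \<le> K" unfolding K_def using that B(1) by (intro member_le_sum) auto
    finally show ?thesis .
  qed
  have "dist (F u) (F v) \<le> real (card B) * K * dist u v" if "u \<in> ball p R" "v \<in> ball p R" for u v
    unfolding dist_norm
  proof (rule differentiable_bound[of "ball p R" F "\<lambda>u. ?D u"])
    fix u assume u: "u \<in> ball p R"
    have d: "F differentiable (at u)" using F inS u unfolding Ck_on_1_iff by blast
    then have "(F has_derivative ?D u) (at u)" by (simp flip: frechet_derivative_works)
    then show "(F has_derivative ?D u) (at u within ball p R)" by (rule has_derivative_at_withinI)
    show "onorm (?D u) \<le> real (card B) * K"
    proof (rule onorm_bound)
      show "norm (?D u v) \<le> real (card B) * K * norm v" for v
        by (rule frechet_derivative_norm_le[OF B d Kb[OF _ u]])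
    qed (simp add: K0)
  qed (use that in auto)
  then show ?thesis
    by (intro lipschitz_nearI[of "ball p R" p "real (card B) * K"]) (simp_all add: R K0)
qed

section \<open>Charts of a compact manifold\<close>

locale compact_manifold =
  fixes X :: "'a topology" and A :: "('a, 'e::{real_inner, heine_borel}) chart set" and m :: nat
  assumes smooth_manifold: "smooth_manifold m X A" and compact_X: "compact_space X"
begin

lemma Hausdorff_X: "Hausdorff_space X" and atlas: "smooth_atlas X A"
  using smooth_manifold by (auto simp: smooth_manifold_def)

lemma orthonormal_basis:
  obtains B :: "'e set" where "finite B" "orthonormal B" "span B = UNIV" "card B = m"
proof -
  obtain B0 where "finite B0" "span B0 = (UNIV::'e set)"
    using smooth_manifold by (auto simp: smooth_manifold_def)
  then obtain B where B: "finite B" "orthonormal B" "span B = (UNIV::'e set)"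
    using orthonormal_basis_ex[of B0] by auto
  have "dim (span B) = card B"
    by (intro dim_span_eq_card_independent orthonormal_independent B)
  then show thesis using that[OF B] smooth_manifold B by (simp add: smooth_manifold_def)
qed

lemma chart:
  assumes "c \<in> A"
  shows chart_openin: "openin X (fst c)" and chart_image_open: "open (chart_image c)"
    and chart_homeo: "homeomorphic_map (subtopology X (fst c)) (top_of_set (chart_image c)) (snd c)"
    and chart_subset: "fst c \<subseteq> topspace X"
proof -
  have c: "is_chart X c" using atlas assms by (simp add: smooth_atlas_def)
  then show "openin X (fst c)" "open (chart_image c)"
    "homeomorphic_map (subtopology X (fst c)) (top_of_set (chart_image c)) (snd c)"
    by (auto simp: is_chart_def)
  then show "fst c \<subseteq> topspace X" using openin_subset by blast
qed

lemma chart_inj: "c \<in> A \<Longrightarrow> inj_on (snd c) (fst c)"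
  using homeomorphic_imp_injective_map[OF chart_homeo] chart_subset
  by (simp add: inf.absorb2)

lemma chart_inv_chart: "c \<in> A \<Longrightarrow> x \<in> fst c \<Longrightarrow> chart_inv c (snd c x) = x"
  by (simp add: chart_inv_def chart_inj)

lemma chart_chart_inv: "u \<in> chart_image c \<Longrightarrow> snd c (chart_inv c u) = u"
  by (simp add: chart_image_def chart_inv_def f_inv_into_f)

lemma chart_inv_in: "u \<in> chart_image c \<Longrightarrow> chart_inv c u \<in> fst c"
  by (simp add: chart_image_def chart_inv_def inv_into_into)

lemma chart_in_image: "x \<in> fst c \<Longrightarrow> snd c x \<in> chart_image c"
  by (simp add: chart_image_def)

lemma continuous_chart: "c \<in> A \<Longrightarrow> continuous_map (subtopology X (fst c)) euclidean (snd c)"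
  using homeomorphic_imp_continuous_map[OF chart_homeo] by (simp add: continuous_map_in_subtopology)

lemma continuous_chart_inv:
  assumes c: "c \<in> A"
  shows "continuous_map (top_of_set (chart_image c)) X (chart_inv c)"
proof -
  obtain h where h: "homeomorphic_maps (subtopology X (fst c)) (top_of_set (chart_image c)) (snd c) h"
    using chart_homeo[OF c] homeomorphic_map_maps by blast
  then have "continuous_map (top_of_set (chart_image c)) (subtopology X (fst c)) h"
    by (simp add: homeomorphic_maps_def)
  then have *: "continuous_map (top_of_set (chart_image c)) X h" by (simp add: continuous_map_in_subtopology)
  have "h u = chart_inv c u" if u: "u \<in> chart_image c" for u
  proof -
    have "h (snd c (chart_inv c u)) = chart_inv c u"
      using h chart_inv_in[OF u] chart_subset[OF c] unfolding homeomorphic_maps_def by auto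
    then show ?thesis using chart_chart_inv[OF u] by simp
  qed
  then show ?thesis by (intro continuous_map_eq[OF *]) auto
qed

lemma open_chart_preimage:
  assumes c: "c \<in> A" and U: "openin X U"
  shows "open {u \<in> chart_image c. chart_inv c u \<in> U}"
proof -
  have "openin (top_of_set (chart_image c)) {u \<in> chart_image c. chart_inv c u \<in> U}"
    using openin_continuous_map_preimage[OF continuous_chart_inv[OF c] U] by simp
  then show ?thesis using chart_image_open[OF c] openin_open_trans by blast
qed

lemma openin_chart_vimage:
  assumes c: "c \<in> A" and U: "open U"
  shows "openin X {x \<in> fst c. snd c x \<in> U}"
proof -
  have "openin (subtopology X (fst c)) {x \<in> topspace (subtopology X (fst c)). snd c x \<in> U}"
    using U by (intro openin_continuous_map_preimage[OF continuous_chart[OF c]]) simp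
  also have "{x \<in> topspace (subtopology X (fst c)). snd c x \<in> U} = {x \<in> fst c. snd c x \<in> U}"
    using chart_subset[OF c] by auto
  finally show ?thesis using chart_openin[OF c] openin_trans_full by blast
qed

lemma compactin_chart_inv_image:
  assumes c: "c \<in> A" and K: "compact K" "K \<subseteq> chart_image c"
  shows "compactin X (chart_inv c ` K)"
proof (rule image_compactin[OF _ continuous_chart_inv[OF c]])
  show "compactin (top_of_set (chart_image c)) K" using K by (simp add: compactin_subtopology)
qed

lemma charts_at_ex:
  assumes "x \<in> topspace X"
  obtains c where "c \<in> A" "x \<in> fst c"
  using assms atlas unfolding smooth_atlas_def by blast

lemma continuous_map_if_charts:
  fixes F :: "'a \<Rightarrow> 'd::topological_space"
  assumes F: "\<And>d. d \<in> A \<Longrightarrow> continuous_on (chart_image d) (\<lambda>v. F (chart_inv d v))"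
  shows "continuous_map X euclidean F"
proof (rule continuous_map[THEN iffD2], intro conjI allI impI)
  fix U :: "'d set" assume "openin euclidean U"
  then have U: "open U" by simp
  show "openin X {x \<in> topspace X. F x \<in> U}"
  proof (subst openin_subopen, rule ballI)
    fix x assume x: "x \<in> {x \<in> topspace X. F x \<in> U}"
    then obtain d where d: "d \<in> A" "x \<in> fst d" using charts_at_ex by blast
    let ?O = "chart_image d \<inter> (\<lambda>v. F (chart_inv d v)) -` U"
    have O: "open ?O"
      using continuous_on_open_vimage[OF chart_image_open[OF d(1)]] F[OF d(1)] U
      by (metis Int_commute)
    have "openin X {y \<in> fst d. snd d y \<in> ?O}" by (rule openin_chart_vimage[OF d(1) O])
    moreover have "x \<in> {y \<in> fst d. snd d y \<in> ?O}"
      using x d chart_inv_chart[OF d] chart_in_image[OF d(2)] by simp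
    moreover have "{y \<in> fst d. snd d y \<in> ?O} \<subseteq> {x \<in> topspace X. F x \<in> U}"
      using chart_subset[OF d(1)] chart_inv_chart[OF d(1)] by auto
    ultimately show "\<exists>T. openin X T \<and> x \<in> T \<and> T \<subseteq> {x \<in> topspace X. F x \<in> U}" by blast
  qed
qed simp

lemma transition_C1:
  assumes "c \<in> A" "d \<in> A"
  shows "Ck_on 1 (transition c d) (snd c ` (fst c \<inter> fst d))" and "open (snd c ` (fst c \<inter> fst d))"
    and "snd c ` (fst c \<inter> fst d) = {u \<in> chart_image c. chart_inv c u \<in> fst d}"
proof -
  show "Ck_on 1 (transition c d) (snd c ` (fst c \<inter> fst d))"
    using assms atlas unfolding smooth_atlas_def smooth_on_def by blast
  show eq: "snd c ` (fst c \<inter> fst d) = {u \<in> chart_image c. chart_inv c u \<in> fst d}"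
  proof (intro equalityI subsetI)
    fix u assume "u \<in> snd c ` (fst c \<inter> fst d)"
    then obtain x where x: "x \<in> fst c" "x \<in> fst d" "u = snd c x" by blast
    show "u \<in> {u \<in> chart_image c. chart_inv c u \<in> fst d}"
      using chart_inv_chart[OF assms(1) x(1)] chart_in_image[OF x(1)] x by simp
  next
    fix u assume u: "u \<in> {u \<in> chart_image c. chart_inv c u \<in> fst d}"
    then have "snd c (chart_inv c u) = u" "chart_inv c u \<in> fst c \<inter> fst d"
      using chart_chart_inv[of u c] chart_inv_in[of u c] by simp_all
    then show "u \<in> snd c ` (fst c \<inter> fst d)" by (intro image_eqI[of _ _ "chart_inv c u"]) auto
  qed
  show "open (snd c ` (fst c \<inter> fst d))"
    unfolding eq using open_chart_preimage[OF assms(1) chart_openin[OF assms(2)]] .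
qed

text \<open>In units of \<open>\<rho> i\<close>, balls of radius 1 already cover the manifold, while
  the chart images contain closed balls of radius 3; the cut-offs fall to 0 in between.\<close>

lemma finite_chart_cover:
  obtains q :: nat and c p \<rho> where
    "\<And>i. i < q \<Longrightarrow> c i \<in> A" "\<And>i. i < q \<Longrightarrow> (0::real) < \<rho> i" "\<And>i. i < q \<Longrightarrow> cball (p i) (3 * \<rho> i) \<subseteq> chart_image (c i)"
    "\<And>x. x \<in> topspace X \<Longrightarrow> \<exists>i<q. x \<in> fst (c i) \<and> snd (c i) x \<in> ball (p i) (\<rho> i)"
proof -
  have "\<exists>c r. c \<in> A \<and> 0 < r \<and> x \<in> fst c \<and> cball (snd c x) (3 * r) \<subseteq> chart_image c" if x: "x \<in> topspace X" for x
  proof -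
    obtain c where c: "c \<in> A" "x \<in> fst c" using charts_at_ex[OF x] .
    obtain e where e: "0 < e" "cball (snd c x) e \<subseteq> chart_image c"
      using chart_image_open[OF c(1)] chart_in_image[OF c(2)] open_contains_cball by blast
    then show ?thesis using c by (intro exI[of _ c] exI[of _ "e / 3"]) auto
  qed
  then obtain c r where c: "\<And>x. x \<in> topspace X \<Longrightarrow>
      c x \<in> A \<and> (0::real) < r x \<and> x \<in> fst (c x) \<and> cball (snd (c x) x) (3 * r x) \<subseteq> chart_image (c x)" by metis
  define V where "V x = {y \<in> fst (c x). snd (c x) y \<in> ball (snd (c x) x) (r x)}" for x
  have "openin X (V x) \<and> x \<in> V x" if "x \<in> topspace X" for x
  proof
    show "openin X (V x)" unfolding V_def using c[OF that] by (intro openin_chart_vimage open_ball) auto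
    show "x \<in> V x" unfolding V_def using c[OF that] by simp
  qed
  then have "\<exists>\<F>. finite \<F> \<and> \<F> \<subseteq> V ` topspace X \<and> topspace X \<subseteq> \<Union> \<F>"
    by (intro compact_X[unfolded compact_space_alt, rule_format]) auto
  then obtain \<F> where "finite \<F>" "\<F> \<subseteq> V ` topspace X" "topspace X \<subseteq> \<Union> \<F>" by blast
  then obtain Y where Y: "Y \<subseteq> topspace X" "finite Y" "topspace X \<subseteq> (\<Union>y\<in>Y. V y)"
    by (metis finite_subset_image)
  obtain xs where xs: "set xs = Y" using finite_list[OF Y(2)] by blast
  show thesis
  proof (rule that[of "length xs" "\<lambda>i. c (xs ! i)" "\<lambda>i. r (xs ! i)" "\<lambda>i. snd (c (xs ! i)) (xs ! i)"])
    fix x assume "x \<in> topspace X"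
    then obtain y where "y \<in> Y" "x \<in> V y" using Y(3) by blast
    then obtain i where "i < length xs" "x \<in> V (xs ! i)" using xs by (auto simp: in_set_conv_nth)
    then show "\<exists>i<length xs. x \<in> fst (c (xs ! i)) \<and> snd (c (xs ! i)) x \<in> ball (snd (c (xs ! i)) (xs ! i)) (r (xs ! i))"
      by (auto simp: V_def)
  next
    fix i assume "i < length xs"
    then have "xs ! i \<in> topspace X" using Y(1) xs nth_mem by blast
    from c[OF this] show "c (xs ! i) \<in> A" "0 < r (xs ! i)"
      "cball (snd (c (xs ! i)) (xs ! i)) (3 * r (xs ! i)) \<subseteq> chart_image (c (xs ! i))" by blast+
  qed
qed

end

lemma dist_scaled_diff:
  fixes x y z :: "'e::real_normed_vector"
  assumes "0 < r"
  shows "dist ((x - z) /\<^sub>R r) ((y - z) /\<^sub>R r) = dist x y / r"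
proof -
  have "(x - z) /\<^sub>R r - (y - z) /\<^sub>R r = (x - y) /\<^sub>R r" by (simp add: algebra_simps)
  then show ?thesis using assms by (simp add: dist_norm divide_inverse_commute)
qed

lemma dist_affine:
  fixes u v z :: "'e::real_normed_vector"
  assumes "0 < r"
  shows "dist (z + r *\<^sub>R u) (z + r *\<^sub>R v) = r * dist u v"
proof -
  have "(z + r *\<^sub>R u) - (z + r *\<^sub>R v) = r *\<^sub>R (u - v)" by (simp add: algebra_simps)
  then show ?thesis using assms by (simp add: dist_norm)
qed

section \<open>The embedding\<close>

text \<open>The decrease with slope 1 to the value 0 at norm 3 gives
  \<open>norm v \<le> 3 - bump v\<close> wherever \<open>bump v\<close> is positive, which is the
  slack required by \<open>coord_norm\<close>.\<close>

definition bump :: "'e::real_normed_vector \<Rightarrow> real" where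
  "bump v = max 0 (min 1 (3 - norm v))"

text \<open>Keeping the cut-off as a last homogeneous coordinate makes \<open>v\<close> recoverable
  by division wherever it is positive. The map vanishes from norm 3 on, so it extends by 0 from a
  chart to the whole manifold.\<close>

definition cone :: "'e::real_normed_vector \<Rightarrow> 'e \<times> real" where
  "cone v = (bump v *\<^sub>R v, bump v)"

lemma bump_lip: "\<bar>bump u - bump v\<bar> \<le> norm (u - v)"
  using norm_triangle_ineq3[of u v] unfolding bump_def by linarith

lemma norm_le_if_bump_pos: "0 < bump v \<Longrightarrow> norm v \<le> 3 - bump v"
  unfolding bump_def by linarith

lemma cone_outside: "3 \<le> norm v \<Longrightarrow> cone v = 0"
  by (simp add: cone_def bump_def zero_prod_def)

text \<open>Of the constant 5, the first component accounts for 1 + 3, the norm of one argument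
  being at most 3, and the second for 1. If both norms exceed 3, both values are 0.\<close>

lemma cone_lip: "dist (cone u) (cone v) \<le> 5 * dist u v"
proof -
  have *: "dist (cone u) (cone v) \<le> 5 * dist u v" if v: "norm v \<le> 3" for u v :: 'a
  proof -
    have "bump u *\<^sub>R u - bump v *\<^sub>R v = bump u *\<^sub>R (u - v) + (bump u - bump v) *\<^sub>R v"
      by (simp add: algebra_simps)
    then have "norm (bump u *\<^sub>R u - bump v *\<^sub>R v)
        \<le> norm (bump u *\<^sub>R (u - v)) + norm ((bump u - bump v) *\<^sub>R v)"
      by (metis norm_triangle_ineq)
    also have "\<dots> = \<bar>bump u\<bar> * norm (u - v) + \<bar>bump u - bump v\<bar> * norm v" by simp
    also have "\<dots> \<le> 1 * norm (u - v) + norm (u - v) * 3"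
      using bump_lip[of u v] v by (intro add_mono mult_mono) (auto simp: bump_def)
    finally have "norm (bump u *\<^sub>R u - bump v *\<^sub>R v) \<le> 4 * norm (u - v)" by simp
    moreover have "cone u - cone v = (bump u *\<^sub>R u - bump v *\<^sub>R v, bump u - bump v)"
      by (simp add: cone_def)
    ultimately show ?thesis
      using bump_lip[of u v] norm_Pair_le[of "bump u *\<^sub>R u - bump v *\<^sub>R v" "bump u - bump v"]
      by (simp add: dist_norm)
  qed
  show ?thesis
  proof (cases "norm v \<le> 3")
    case False
    show ?thesis
    proof (cases "norm u \<le> 3")
      case True
      then show ?thesis using *[of u v] by (simp add: dist_commute)
    qed (use False in \<open>simp add: cone_outside\<close>)
  qed (rule *)
qed

locale charted_manifold = compact_manifold X A m
  for X :: "'a topology" and A :: "('a, 'e::{real_inner, heine_borel}) chart set" and m :: nat +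
  fixes q :: nat and c :: "nat \<Rightarrow> ('a, 'e) chart" and p :: "nat \<Rightarrow> 'e" and \<rho> :: "nat \<Rightarrow> real"
  assumes c_in: "i < q \<Longrightarrow> c i \<in> A" and \<rho>_pos: "i < q \<Longrightarrow> 0 < \<rho> i"
    and cball_subset: "i < q \<Longrightarrow> cball (p i) (3 * \<rho> i) \<subseteq> chart_image (c i)"
    and c_cover: "x \<in> topspace X \<Longrightarrow> \<exists>i<q. x \<in> fst (c i) \<and> snd (c i) x \<in> ball (p i) (\<rho> i)"
begin

definition \<phi> :: "nat \<Rightarrow> 'a \<Rightarrow> 'e" where
  "\<phi> i x = (snd (c i) x - p i) /\<^sub>R \<rho> i"

lemma norm_\<phi>: "i < q \<Longrightarrow> norm (\<phi> i x) = dist (p i) (snd (c i) x) / \<rho> i"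
  using \<rho>_pos[of i] by (simp add: \<phi>_def dist_norm norm_minus_commute divide_inverse_commute)

definition comp :: "nat \<Rightarrow> 'a \<Rightarrow> 'e \<times> real" where
  "comp i x = (if i < q \<and> x \<in> fst (c i) then cone (\<phi> i x) else 0)"

text \<open>The ambient space consists of functions on all of \<open>nat\<close> because the number \<open>q\<close> of charts cannot
  enter its type; only the first \<open>q\<close> components are nonzero.\<close>

definition \<Phi> :: "'a \<Rightarrow> (nat \<Rightarrow>\<^sub>C ('e \<times> real))" where
  "\<Phi> x = Bcontfun (\<lambda>i. comp i x)"

lemma apply_\<Phi>: "apply_bcontfun (\<Phi> x) i = comp i x"
proof -
  have "(\<lambda>i. comp i x) \<in> bcontfun"
  proof (rule bcontfun_normI)
    show "norm (comp i x) \<le> (\<Sum>j<q. norm (comp j x))" for i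
    proof (cases "i < q")
      case True
      then show ?thesis by (intro member_le_sum) auto
    qed (simp add: comp_def sum_nonneg)
  qed (simp add: continuous_on_open_vimage open_discrete)
  then show ?thesis by (simp add: \<Phi>_def Bcontfun_inverse)
qed

lemma dist_\<Phi>_le:
  assumes "\<And>i. i < q \<Longrightarrow> dist (comp i x) (comp i y) \<le> d" "0 \<le> d"
  shows "dist (\<Phi> x) (\<Phi> y) \<le> d"
proof (rule dist_bound)
  fix i show "dist (apply_bcontfun (\<Phi> x) i) (apply_bcontfun (\<Phi> y) i) \<le> d"
    using assms by (cases "i < q") (auto simp: apply_\<Phi> comp_def)
qed

text \<open>Inside the domain of \<open>c i\<close> this is the Lipschitz continuity of a transition
  map. At a point outside, the preimage of the closed ball of radius \<open>3 * \<rho> i\<close> is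
  compact, hence closed in the Hausdorff space \<open>X\<close>; a whole neighbourhood avoids it,
  and \<open>comp i\<close> is 0 there.\<close>

lemma comp_lipschitz_near:
  assumes d: "d \<in> A" and u: "u \<in> chart_image d" and i: "i < q"
  shows "lipschitz_near (\<lambda>v. comp i (chart_inv d v)) u"
proof (cases "chart_inv d u \<in> fst (c i)")
  case True
  note tr = transition_C1[OF d c_in[OF i]]
  obtain B :: "'e set" where B: "finite B" "orthonormal B" "span B = UNIV" using orthonormal_basis by metis
  have uS: "u \<in> snd d ` (fst d \<inter> fst (c i))" unfolding tr(3) using u True by simp
  obtain r L where r: "0 < r" "0 \<le> L" "ball u r \<subseteq> snd d ` (fst d \<inter> fst (c i))"
    "\<And>v w. v \<in> ball u r \<Longrightarrow> w \<in> ball u r \<Longrightarrow> dist (transition d (c i) v) (transition d (c i) w) \<le> L * dist v w"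
    using lipschitz_nearE[OF lipschitz_near_if_C1[OF B tr(2) uS tr(1)] tr(2) uS] by metis
  have eq: "comp i (chart_inv d v) = cone ((transition d (c i) v - p i) /\<^sub>R \<rho> i)" if "v \<in> ball u r" for v
  proof -
    have "v \<in> {u \<in> chart_image d. chart_inv d u \<in> fst (c i)}" using r(3) that unfolding tr(3) by blast
    then show ?thesis using i by (simp add: comp_def \<phi>_def transition_def)
  qed
  have "dist (comp i (chart_inv d v)) (comp i (chart_inv d w)) \<le> 5 * (L / \<rho> i) * dist v w"
    if vw: "v \<in> ball u r" "w \<in> ball u r" for v w
  proof -
    have "dist (comp i (chart_inv d v)) (comp i (chart_inv d w))
        \<le> 5 * dist ((transition d (c i) v - p i) /\<^sub>R \<rho> i) ((transition d (c i) w - p i) /\<^sub>R \<rho> i)"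
      unfolding eq[OF vw(1)] eq[OF vw(2)] by (rule cone_lip)
    also have "\<dots> = 5 * (dist (transition d (c i) v) (transition d (c i) w) / \<rho> i)"
      by (simp only: dist_scaled_diff[OF \<rho>_pos[OF i]])
    also have "\<dots> \<le> 5 * (L * dist v w / \<rho> i)"
      using r(4)[OF vw] \<rho>_pos[OF i] by (intro mult_left_mono divide_right_mono) auto
    finally show ?thesis by simp
  qed
  then show ?thesis
    using r \<rho>_pos[OF i] by (intro lipschitz_nearI[of "ball u r" u "5 * (L / \<rho> i)"]) auto
next
  case False
  let ?K = "chart_inv (c i) ` cball (p i) (3 * \<rho> i)"
  have "compactin X ?K"
    by (intro compactin_chart_inv_image c_in i cball_subset compact_cball)
  then have cl: "closedin X ?K" by (rule compactin_imp_closedin[OF Hausdorff_X])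
  let ?V = "{v \<in> chart_image d. chart_inv d v \<in> topspace X - ?K}"
  have V: "open ?V" by (intro open_chart_preimage d) (use cl in auto)
  have "?K \<subseteq> fst (c i)"
    by (intro image_subsetI chart_inv_in subsetD[OF cball_subset[OF i]])
  moreover have "chart_inv d u \<in> topspace X" by (rule subsetD[OF chart_subset[OF d] chart_inv_in[OF u]])
  ultimately have uV: "u \<in> ?V" using False u by blast
  have "comp i (chart_inv d v) = 0" if v: "v \<in> ?V" for v
  proof (cases "chart_inv d v \<in> fst (c i)")
    case True
    let ?x = "chart_inv d v"
    have "snd (c i) ?x \<notin> cball (p i) (3 * \<rho> i)"
    proof
      assume "snd (c i) ?x \<in> cball (p i) (3 * \<rho> i)"
      then have "chart_inv (c i) (snd (c i) ?x) \<in> ?K" by blast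
      then show False using v chart_inv_chart[OF c_in[OF i] True] by simp
    qed
    then have "3 \<le> norm (\<phi> i ?x)" using \<rho>_pos[OF i] by (simp add: norm_\<phi>[OF i] le_divide_eq)
    then show ?thesis by (simp add: comp_def cone_outside)
  qed (simp add: comp_def)
  then show ?thesis by (intro lipschitz_nearI[OF V uV, of 0]) auto
qed

lemma \<Phi>_lipschitz_near:
  assumes d: "d \<in> A" and u: "u \<in> chart_image d"
  shows "lipschitz_near (\<lambda>v. \<Phi> (chart_inv d v)) u"
proof -
  have "\<forall>i. \<exists>r L. i < q \<longrightarrow> 0 < r \<and> 0 \<le> L \<and>
      (\<forall>v\<in>ball u r. \<forall>w\<in>ball u r. dist (comp i (chart_inv d v)) (comp i (chart_inv d w)) \<le> L * dist v w)"
    using comp_lipschitz_near[OF d u] unfolding lipschitz_near_def by metis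
  then obtain r L where r: "\<And>i. i < q \<Longrightarrow> 0 < r i \<and> 0 \<le> L i \<and>
      (\<forall>v\<in>ball u (r i). \<forall>w\<in>ball u (r i). dist (comp i (chart_inv d v)) (comp i (chart_inv d w)) \<le> L i * dist v w)"
    by metis
  define R where "R = Min (insert 1 (r ` {..<q}))"
  have R: "0 < R" "\<And>i. i < q \<Longrightarrow> R \<le> r i" using r by (auto simp: R_def)
  define LL where "LL = (\<Sum>i<q. L i)"
  have LL: "0 \<le> LL" unfolding LL_def using r by (intro sum_nonneg) auto
  have "dist (\<Phi> (chart_inv d v)) (\<Phi> (chart_inv d w)) \<le> LL * dist v w" if vw: "v \<in> ball u R" "w \<in> ball u R" for v w
  proof (rule dist_\<Phi>_le)
    fix i assume i: "i < q"
    have "v \<in> ball u (r i)" "w \<in> ball u (r i)" using vw R(2)[OF i] by auto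
    then have "dist (comp i (chart_inv d v)) (comp i (chart_inv d w)) \<le> L i * dist v w" using r[OF i] by blast
    also have "\<dots> \<le> LL * dist v w"
      unfolding LL_def using i r by (intro mult_right_mono member_le_sum) auto
    finally show "dist (comp i (chart_inv d v)) (comp i (chart_inv d w)) \<le> LL * dist v w" .
  qed (use LL in auto)
  then show ?thesis using R LL by (intro lipschitz_nearI[of "ball u R" u LL]) auto
qed

section \<open>The embedded manifold and its Lipschitz atlas\<close>

definition M :: "(nat \<Rightarrow>\<^sub>C ('e \<times> real)) set" where
  "M = \<Phi> ` topspace X"

definition G :: "nat \<Rightarrow> 'e \<Rightarrow> (nat \<Rightarrow>\<^sub>C ('e \<times> real))" where
  "G i u = \<Phi> (chart_inv (c i) (p i + \<rho> i *\<^sub>R u))"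

definition a_coord :: "nat \<Rightarrow> (nat \<Rightarrow>\<^sub>C ('e \<times> real)) \<Rightarrow> 'e" where
  "a_coord i y = fst (apply_bcontfun y i)"

definition t_coord :: "nat \<Rightarrow> (nat \<Rightarrow>\<^sub>C ('e \<times> real)) \<Rightarrow> real" where
  "t_coord i y = snd (apply_bcontfun y i)"

lemma scaled_in_cball: "i < q \<Longrightarrow> norm u \<le> 3 \<Longrightarrow> p i + \<rho> i *\<^sub>R u \<in> cball (p i) (3 * \<rho> i)"
  using \<rho>_pos[of i] by (simp add: dist_norm mult.commute)

lemma t_coord_pos:
  assumes "0 < t_coord i (\<Phi> x)"
  shows "i < q" "x \<in> fst (c i)" "t_coord i (\<Phi> x) = bump (\<phi> i x)" "a_coord i (\<Phi> x) = bump (\<phi> i x) *\<^sub>R \<phi> i x"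
  using assms by (auto simp: t_coord_def a_coord_def apply_\<Phi> comp_def cone_def zero_prod_def split: if_splits)

lemma t_coord_cover: "x \<in> topspace X \<Longrightarrow> \<exists>i<q. t_coord i (\<Phi> x) = 1"
proof -
  assume "x \<in> topspace X"
  then obtain i where i: "i < q" "x \<in> fst (c i)" "snd (c i) x \<in> ball (p i) (\<rho> i)" using c_cover by blast
  then have "norm (\<phi> i x) < 1"
    using \<rho>_pos[OF i(1)] by (simp add: norm_\<phi>)
  then show ?thesis using i by (intro exI[of _ i]) (simp add: t_coord_def apply_\<Phi> comp_def cone_def bump_def)
qed

lemma \<Phi>_inj: "inj_on \<Phi> (topspace X)"
proof (rule inj_onI)
  fix x y assume xy: "x \<in> topspace X" "y \<in> topspace X" "\<Phi> x = \<Phi> y"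
  obtain i where i: "t_coord i (\<Phi> x) = 1" using t_coord_cover[OF xy(1)] by blast
  have 1: "0 < t_coord i (\<Phi> x)" "0 < t_coord i (\<Phi> y)" using i xy by auto
  note X1 = t_coord_pos[OF 1(1)] and Y1 = t_coord_pos[OF 1(2)]
  have "\<phi> i x = \<phi> i y" using X1 Y1 i xy(3) by simp
  then have "snd (c i) x = snd (c i) y" using \<rho>_pos[OF X1(1)] by (simp add: \<phi>_def)
  then show "x = y" using chart_inj[OF c_in[OF X1(1)]] X1(2) Y1(2) by (auto dest: inj_onD)
qed

lemma continuous_on_\<Phi>_chart_inv:
  "d \<in> A \<Longrightarrow> continuous_on (chart_image d) (\<lambda>v. \<Phi> (chart_inv d v))"
  by (intro continuous_at_imp_continuous_on ballI lipschitz_near_imp_isCont \<Phi>_lipschitz_near)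

lemma continuous_\<Phi>: "continuous_map X euclidean \<Phi>"
  by (rule continuous_map_if_charts[OF continuous_on_\<Phi>_chart_inv])

lemma homeomorphic_\<Phi>: "homeomorphic_map X (top_of_set M) \<Phi>"
proof (rule continuous_imp_homeomorphic_map)
  show "continuous_map X (top_of_set M) \<Phi>"
    using continuous_\<Phi> by (simp add: continuous_map_in_subtopology M_def)
  show "Hausdorff_space (top_of_set M)" by (simp add: Hausdorff_space_subtopology)
qed (use compact_X \<Phi>_inj in \<open>auto simp: M_def\<close>)

lemma compact_M: "compact M"
  using image_compactin[OF compact_X[unfolded compact_space_def] continuous_\<Phi>] by (simp add: M_def)

lemma G_coord:
  assumes i: "i < q" and x: "x \<in> M" "0 < t_coord i x"
  shows "norm (a_coord i x /\<^sub>R t_coord i x) \<le> 3 - t_coord i x" "G i (a_coord i x /\<^sub>R t_coord i x) = x"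
proof -
  obtain y where y: "y \<in> topspace X" "x = \<Phi> y" using x by (auto simp: M_def)
  have 1: "y \<in> fst (c i)" "t_coord i x = bump (\<phi> i y)" "a_coord i x = bump (\<phi> i y) *\<^sub>R \<phi> i y"
    using t_coord_pos[of i y] x y by auto
  then have eq: "a_coord i x /\<^sub>R t_coord i x = \<phi> i y" using x(2) by simp
  show "norm (a_coord i x /\<^sub>R t_coord i x) \<le> 3 - t_coord i x"
    unfolding eq using norm_le_if_bump_pos[of "\<phi> i y"] 1(2) x(2) by simp
  show "G i (a_coord i x /\<^sub>R t_coord i x) = x"
    unfolding eq using \<rho>_pos[OF i] chart_inv_chart[OF c_in[OF i] 1(1)] y(2)
    by (simp add: G_def \<phi>_def)
qed

lemma lipschitz_atlas_ex: "\<exists>C. lipschitz_atlas M q a_coord t_coord G C"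
proof -
  have "\<exists>C\<ge>0. \<forall>u\<in>cball (p i) (3 * \<rho> i). \<forall>v\<in>cball (p i) (3 * \<rho> i).
      dist (\<Phi> (chart_inv (c i) u)) (\<Phi> (chart_inv (c i) v)) \<le> C * dist u v" if i: "i < q" for i
    by (intro lipschitz_on_compact_if_near compact_cball \<Phi>_lipschitz_near c_in i)
       (use cball_subset[OF i] in blast)
  then obtain C where C: "\<And>i. i < q \<Longrightarrow> 0 \<le> C i \<and> (\<forall>u\<in>cball (p i) (3 * \<rho> i). \<forall>v\<in>cball (p i) (3 * \<rho> i).
      dist (\<Phi> (chart_inv (c i) u)) (\<Phi> (chart_inv (c i) v)) \<le> C i * dist u v)" by metis
  have C0: "0 \<le> C i" if "i < q" for i using C[OF that] by (rule conjunct1)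
  \<comment> \<open>The factor \<open>\<rho> i\<close> comes from the rescaling inside
    \<open>G i\<close>.\<close>
  define CC where "CC = 1 + (\<Sum>i<q. C i * \<rho> i)"
  have pos: "0 \<le> C i * \<rho> i" if "i < q" for i using C0[OF that] \<rho>_pos[OF that] by simp
  have "lipschitz_atlas M q a_coord t_coord G CC"
  proof
    fix i and y y' :: "nat \<Rightarrow>\<^sub>C ('e \<times> real)"
    show "dist (a_coord i y) (a_coord i y') \<le> dist y y'"
      unfolding a_coord_def by (rule order_trans[OF dist_fst_le dist_bounded])
    have "dist (t_coord i y) (t_coord i y') \<le> dist y y'"
      unfolding t_coord_def by (rule order_trans[OF dist_snd_le dist_bounded])
    then show "\<bar>t_coord i y - t_coord i y'\<bar> \<le> dist y y'" by (simp add: dist_real_def)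
  next
    fix i and u :: 'e assume i: "i < q" and u: "norm u \<le> 3"
    have "p i + \<rho> i *\<^sub>R u \<in> chart_image (c i)" using scaled_in_cball[OF i u] cball_subset[OF i] by blast
    from subsetD[OF chart_subset[OF c_in[OF i]] chart_inv_in[OF this]]
    have "chart_inv (c i) (p i + \<rho> i *\<^sub>R u) \<in> topspace X" .
    then show "G i u \<in> M" unfolding G_def M_def by (rule imageI)
    fix u' :: 'e assume u': "norm u' \<le> 3"
    have "dist (G i u) (G i u') \<le> C i * dist (p i + \<rho> i *\<^sub>R u) (p i + \<rho> i *\<^sub>R u')"
      unfolding G_def
      by (rule C[OF i, THEN conjunct2, rule_format, OF scaled_in_cball[OF i u] scaled_in_cball[OF i u']])
    also have "\<dots> = C i * \<rho> i * dist u u'"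
      using dist_affine[OF \<rho>_pos[OF i], of "p i" u u'] by simp
    also have "\<dots> \<le> CC * dist u u'"
    proof (rule mult_right_mono)
      have "C i * \<rho> i \<le> (\<Sum>i<q. C i * \<rho> i)" using i pos by (intro member_le_sum) auto
      then show "C i * \<rho> i \<le> CC" by (simp add: CC_def)
    qed simp
    finally show "dist (G i u) (G i u') \<le> CC * dist u u'" .
  next
    fix x assume "x \<in> M"
    then show "\<exists>i<q. t_coord i x = 1" using t_coord_cover by (auto simp: M_def)
  next
    have "0 \<le> (\<Sum>i<q. C i * \<rho> i)" by (intro sum_nonneg) (simp add: pos)
    then show "1 \<le> CC" by (simp add: CC_def)
  next
    fix i x assume *: "i < q" "x \<in> M" "0 < t_coord i x"
    show "norm (a_coord i x /\<^sub>R t_coord i x) \<le> 3 - t_coord i x" "G i (a_coord i x /\<^sub>R t_coord i x) = x"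
      by (rule G_coord[OF *])+
  qed
  then show ?thesis by blast
qed

lemma total_betti_\<Phi>:
  assumes "Z \<subseteq> topspace X"
  shows "total_betti (subtopology X Z) \<le> total_betti (top_of_set (\<Phi> ` Z))"
proof -
  have "homeomorphic_map (subtopology X Z) (subtopology (top_of_set M) (\<Phi> ` Z)) \<Phi>"
    by (rule homeomorphic_map_subtopologies[OF homeomorphic_\<Phi>]) (use assms in \<open>auto simp: M_def\<close>)
  also have "subtopology (top_of_set M) (\<Phi> ` Z) = top_of_set (\<Phi> ` Z)"
    using assms by (simp add: subtopology_subtopology M_def Int_absorb1 image_mono)
  finally show ?thesis
    using section_and_retraction_eq_homeomorphic_map total_betti_section_map by blast
qed

end

section \<open>Derivatives in charts\<close>

lemma frechet_derivative_diff_const: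
  assumes "F differentiable (at u)"
  shows "(\<lambda>y. F y - a) differentiable (at u)"
    and "frechet_derivative (\<lambda>y. F y - a) (at u) = frechet_derivative F (at u)"
proof -
  have "(F has_derivative frechet_derivative F (at u)) (at u)"
    using assms by (simp flip: frechet_derivative_works)
  then have d: "((\<lambda>y. F y - a) has_derivative frechet_derivative F (at u)) (at u)"
    using has_derivative_diff[OF _ has_derivative_const[of a]] by fastforce
  then show "(\<lambda>y. F y - a) differentiable (at u)" by (auto simp: differentiable_def)
  show "frechet_derivative (\<lambda>y. F y - a) (at u) = frechet_derivative F (at u)"
    using frechet_derivative_at[OF d] by simp
qed

lemma Ck_on_1_diff_const:
  assumes "Ck_on 1 F S"
  shows "Ck_on 1 (\<lambda>y. F y - a) S"
  unfolding Ck_on_1_iff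
proof (intro conjI ballI allI)
  have F: "\<And>x. x \<in> S \<Longrightarrow> F differentiable (at x)" "\<And>v. continuous_on S (\<lambda>x. frechet_derivative F (at x) v)"
    using assms unfolding Ck_on_1_iff by blast+
  show "(\<lambda>y. F y - a) differentiable (at x)" if "x \<in> S" for x
    by (rule frechet_derivative_diff_const(1)[OF F(1)[OF that]])
  show "continuous_on S (\<lambda>x. frechet_derivative (\<lambda>y. F y - a) (at x) v)" for v
    by (rule continuous_on_eq[OF F(2)[of v]]) (simp add: frechet_derivative_diff_const(2)[OF F(1)])
qed

section \<open>Chain rule and coordinate vectors\<close>

context compact_manifold
begin

lemma transition_differentiable:
  assumes "c \<in> A" "d \<in> A" "x \<in> fst c" "x \<in> fst d"
  shows "transition c d differentiable (at (snd c x))"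
  using transition_C1(1)[OF assms(1,2)] assms(3,4) unfolding Ck_on_1_iff by blast

lemma transition_at:
  assumes "c \<in> A" "x \<in> fst c"
  shows "transition c d (snd c x) = snd d x"
  by (simp add: transition_def chart_inv_chart[OF assms])

lemma open_overlap:
  assumes "c \<in> A" "d \<in> A"
  shows "open {u \<in> chart_image c. chart_inv c u \<in> fst d}"
  by (rule open_chart_preimage[OF assms(1) chart_openin[OF assms(2)]])

lemma frechet_derivative_change_chart:
  fixes F :: "'a \<Rightarrow> 'f::real_normed_vector"
  assumes cd: "c \<in> A" "d \<in> A" "x \<in> fst c" "x \<in> fst d"
    and F: "(\<lambda>u. F (chart_inv d u)) differentiable (at (snd d x))"
  shows "frechet_derivative (\<lambda>u. F (chart_inv c u)) (at (snd c x)) e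
    = frechet_derivative (\<lambda>u. F (chart_inv d u)) (at (snd d x))
        (frechet_derivative (transition c d) (at (snd c x)) e)"
proof -
  let ?S = "{u \<in> chart_image c. chart_inv c u \<in> fst d}"
  let ?h = "(\<lambda>u. F (chart_inv d u)) \<circ> transition c d"
  have t: "transition c d differentiable (at (snd c x))" by (rule transition_differentiable[OF cd])
  have F': "(\<lambda>u. F (chart_inv d u)) differentiable (at (transition c d (snd c x)))"
    using F transition_at[OF cd(1,3)] by simp
  have "?h differentiable (at (snd c x))" by (rule differentiable_chain_at[OF t F'])
  moreover have "snd c x \<in> ?S" using cd chart_in_image chart_inv_chart[OF cd(1,3)] by simp
  moreover have "?h u = F (chart_inv c u)" if "u \<in> ?S" for u
    using that chart_inv_chart[OF cd(2)] by (simp add: transition_def)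
  ultimately have "frechet_derivative ?h (at (snd c x)) = frechet_derivative (\<lambda>u. F (chart_inv c u)) (at (snd c x))"
    using open_overlap[OF cd(1,2)] by (intro frechet_derivative_transform_within_open) auto
  moreover have "frechet_derivative ?h (at (snd c x))
      = frechet_derivative (\<lambda>u. F (chart_inv d u)) (at (transition c d (snd c x))) \<circ> frechet_derivative (transition c d) (at (snd c x))"
    by (rule frechet_derivative_compose[OF t F'])
  ultimately show ?thesis using transition_at[OF cd(1,3), of d] by (metis comp_apply)
qed

lemma coord_vector_self:
  assumes "c \<in> A" "x \<in> fst c"
  shows "coord_vector A c x e c = e"
proof -
  have "frechet_derivative (\<lambda>u. u) (at (snd c x)) = frechet_derivative (transition c c) (at (snd c x))"
    by (rule frechet_derivative_transform_within_open[of _ _ "chart_image c"])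
       (use chart_image_open[OF assms(1)] chart_in_image[OF assms(2)] in \<open>auto simp: transition_def chart_chart_inv\<close>)
  then show ?thesis using assms by (simp add: coord_vector_def charts_at_def flip: \<open>_ = frechet_derivative (transition c c) _\<close>)
qed

text \<open>The compatibility demanded of a tangent vector is the chain rule for changing charts
  from \<open>c\<close> over \<open>d\<close> to \<open>d'\<close>.\<close>

lemma coord_vector_tangent:
  assumes c: "c \<in> A" "x \<in> fst c"
  shows "coord_vector A c x e \<in> tangent_space A x"
  unfolding tangent_space_def mem_Collect_eq
proof (intro conjI ballI allI impI)
  fix d d' assume d: "d \<in> charts_at A x" "d' \<in> charts_at A x"
  then have d2: "d \<in> A" "x \<in> fst d" "d' \<in> A" "x \<in> fst d'" by (auto simp: charts_at_def)
  have "frechet_derivative (\<lambda>u. snd d' (chart_inv c u)) (at (snd c x)) e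
      = frechet_derivative (\<lambda>u. snd d' (chart_inv d u)) (at (snd d x))
          (frechet_derivative (transition c d) (at (snd c x)) e)"
    using transition_differentiable[OF d2(1,3,2,4)]
    by (intro frechet_derivative_change_chart c d2) (simp add: transition_def comp_def)
  then show "coord_vector A c x e d' = frechet_derivative (transition d d') (at (snd d x)) (coord_vector A c x e d)"
    using d by (simp add: coord_vector_def transition_def comp_def)
qed (simp add: coord_vector_def)

lemma C1_mapsD:
  assumes "f \<in> C1_maps X A k" "d \<in> A"
  shows "i < k \<Longrightarrow> Ck_on 1 (\<lambda>u. f (chart_inv d u) i) (chart_image d)"
    and "i < k \<Longrightarrow> u \<in> chart_image d \<Longrightarrow> (\<lambda>u. f (chart_inv d u) i) differentiable (at u)"
    and "i < k \<Longrightarrow> continuous_on (chart_image d) (\<lambda>u. f (chart_inv d u) i)"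
    and "i < k \<Longrightarrow> continuous_on (chart_image d) (\<lambda>u. frechet_derivative (\<lambda>u. f (chart_inv d u) i) (at u) v)"
proof -
  show C: "i < k \<Longrightarrow> Ck_on 1 (\<lambda>u. f (chart_inv d u) i) (chart_image d)" for i
    using assms unfolding C1_maps_def by blast
  show D: "i < k \<Longrightarrow> u \<in> chart_image d \<Longrightarrow> (\<lambda>u. f (chart_inv d u) i) differentiable (at u)" for i u
    using C unfolding Ck_on_1_iff by blast
  show "i < k \<Longrightarrow> continuous_on (chart_image d) (\<lambda>u. f (chart_inv d u) i)"
    by (intro differentiable_imp_continuous_on differentiable_at_imp_differentiable_on) (rule D)
  show "i < k \<Longrightarrow> continuous_on (chart_image d) (\<lambda>u. frechet_derivative (\<lambda>u. f (chart_inv d u) i) (at u) v)"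
    using C unfolding Ck_on_1_iff by blast
qed

lemma some_chart:
  assumes "x \<in> topspace X"
  shows "(SOME c. c \<in> charts_at A x) \<in> A" "x \<in> fst (SOME c. c \<in> charts_at A x)"
proof -
  have "\<exists>c. c \<in> charts_at A x" using charts_at_ex[OF assms] unfolding charts_at_def by blast
  then have "(SOME c. c \<in> charts_at A x) \<in> charts_at A x" by (rule someI_ex)
  then show "(SOME c. c \<in> charts_at A x) \<in> A" "x \<in> fst (SOME c. c \<in> charts_at A x)"
    by (auto simp: charts_at_def)
qed

lemma differential_in_chart:
  assumes f: "f \<in> C1_maps X A k" and c: "c \<in> A" "x \<in> fst c" and v: "v \<in> tangent_space A x"
  shows "differential A k f x v
    = (\<lambda>i. if i < k then frechet_derivative (\<lambda>u. f (chart_inv c u) i) (at (snd c x)) (v c) else 0)"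
proof -
  define d where "d = (SOME d. d \<in> charts_at A x)"
  have xX: "x \<in> topspace X" using c chart_subset by blast
  have d: "d \<in> A" "x \<in> fst d" using some_chart[OF xX] by (auto simp: d_def)
  have vd: "v d = frechet_derivative (transition c d) (at (snd c x)) (v c)"
    using v c d unfolding tangent_space_def charts_at_def by blast
  have "frechet_derivative (\<lambda>u. f (chart_inv c u) i) (at (snd c x)) (v c)
      = frechet_derivative (\<lambda>u. f (chart_inv d u) i) (at (snd d x)) (v d)" if i: "i < k" for i
    unfolding vd
    by (rule frechet_derivative_change_chart[OF c(1) d(1) c(2) d(2)])
       (rule C1_mapsD(2)[OF f d(1) i chart_in_image[OF d(2)]])
  then show ?thesis unfolding differential_def d_def[symmetric] by (auto simp: Let_def)
qed

lemma continuous_map_C1: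
  assumes "f \<in> C1_maps X A k" "i < k"
  shows "continuous_map X euclidean (\<lambda>x. f x i)"
  by (rule continuous_map_if_charts) (rule C1_mapsD(3)[OF assms(1) _ assms(2)])

section \<open>The discriminant\<close>

lemma C1_maps_shift:
  assumes f: "f \<in> C1_maps X A k" and x0: "x0 \<in> topspace X"
  shows "(\<lambda>x i. f x i - f x0 i) \<in> C1_maps X A k"
    and "x \<in> topspace X \<Longrightarrow> diff_rank A k (\<lambda>x i. f x i - f x0 i) x = diff_rank A k f x"
proof -
  show *: "(\<lambda>x i. f x i - f x0 i) \<in> C1_maps X A k"
    unfolding C1_maps_def mem_Collect_eq
  proof (intro conjI ballI allI impI)
    show "(\<lambda>i. f x i - f x0 i) \<in> topspace (Euclidean_space k)" if "x \<in> topspace X" for x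
      using f x0 that by (simp add: C1_maps_def topspace_Euclidean_space)
    show "Ck_on 1 (\<lambda>y. f (chart_inv c y) i - f x0 i) (chart_image c)" if "c \<in> A" "i < k" for c i
      by (intro Ck_on_1_diff_const C1_mapsD(1)[OF f that])
  qed
  assume x: "x \<in> topspace X"
  define d where "d = (SOME d. d \<in> charts_at A x)"
  have d: "d \<in> A" "x \<in> fst d" using some_chart[OF x] by (auto simp: d_def)
  have "frechet_derivative (\<lambda>y. f (chart_inv d y) i - f x0 i) (at (snd d x))
      = frechet_derivative (\<lambda>y. f (chart_inv d y) i) (at (snd d x))" if i: "i < k" for i
    by (rule frechet_derivative_diff_const(2)[OF C1_mapsD(2)[OF f d(1) i chart_in_image[OF d(2)]]])
  then have "differential A k (\<lambda>x i. f x i - f x0 i) x v = differential A k f x v" for v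
    unfolding differential_def d_def[symmetric] by (auto simp: Let_def)
  then show "diff_rank A k (\<lambda>x i. f x i - f x0 i) x = diff_rank A k f x"
    unfolding diff_rank_def by simp
qed

text \<open>The map f - f x0 has a zero at \<open>x0\<close> with unchanged derivative, and it
  differs from \<open>f\<close> by a constant, whose C1-norm is at most its length because its
  derivative is 0.\<close>

lemma dist_discriminant_le:
  assumes f: "f \<in> C1_maps X A k" and x0: "x0 \<in> topspace X" and rank: "diff_rank A k f x0 < k"
  shows "dist_discriminant X A g k f \<le> ennreal (L2_set (f x0) {..<k})"
proof -
  let ?h = "\<lambda>x i. f x i - f x0 i"
  have "?h \<in> discriminant X A k"
    unfolding discriminant_def using C1_maps_shift[OF f x0] x0 rank by auto
  then have "dist_discriminant X A g k f \<le> C1_norm X A g k (\<lambda>x i. f x i - ?h x i)"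
    unfolding dist_discriminant_def by (rule INF_lower)
  also have "(\<lambda>x i. f x i - ?h x i) = (\<lambda>x. f x0)" by simp
  also have "C1_norm X A g k (\<lambda>x. f x0) \<le> ennreal (L2_set (f x0) {..<k})"
  proof -
    have "differential A k (\<lambda>x. f x0) x v = (\<lambda>i. 0)" for x v
      unfolding differential_def by (auto simp: Let_def frechet_derivative_const)
    then have "diff_norm A g k (\<lambda>x. f x0) x \<le> 0" for x
      unfolding diff_norm_def by (intro SUP_least) (simp add: L2_set_def)
    then show ?thesis
      unfolding C1_norm_def by (intro SUP_least) simp
  qed
  finally show ?thesis .
qed

section \<open>Rank in the space of real sequences\<close>

definition seq_unit :: "nat \<Rightarrow> nat \<Rightarrow> real" where
  "seq_unit j = (\<lambda>i. if i = j then 1 else 0)"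

interpretation seqs: vector_space "\<lambda>(a::real) (y::nat \<Rightarrow> real) i. a * y i"
  by (rule vector_space_real_sequences)

lemma in_span_seq_units:
  fixes y :: "nat \<Rightarrow> real"
  assumes "finite J" "\<And>i. i \<notin> J \<Longrightarrow> y i = 0"
  shows "y \<in> seqs.span (seq_unit ` J)"
proof -
  have "(\<Sum>j\<in>J. (\<lambda>i. y j * seq_unit j i)) \<in> seqs.span (seq_unit ` J)"
    by (intro seqs.span_sum seqs.span_scale seqs.span_base imageI)
  moreover have "(\<Sum>j\<in>J. (\<lambda>i. y j * seq_unit j i)) = y"
  proof
    fix i
    have "(\<Sum>j\<in>J. (\<lambda>i. y j * seq_unit j i)) i = (\<Sum>j\<in>J. y j * seq_unit j i)"
      using assms(1) by (induction J rule: finite_induct) auto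
    also have "\<dots> = (\<Sum>j\<in>J. if j = i then y j else 0)" by (intro sum.cong) (auto simp: seq_unit_def)
    also have "\<dots> = y i" using assms by simp
    finally show "(\<Sum>j\<in>J. (\<lambda>i. y j * seq_unit j i)) i = y i" .
  qed
  ultimately show ?thesis by simp
qed

text \<open>A maximum point of the first component is a point of rank deficiency.\<close>

lemma rank_deficient_point_ex:
  assumes f: "f \<in> C1_maps X A k" and k: "1 \<le> k" and X: "topspace X \<noteq> {}"
  shows "\<exists>x\<in>topspace X. diff_rank A k f x < k"
proof -
  have cont: "continuous_map X euclidean (\<lambda>x. f x 0)" by (rule continuous_map_C1[OF f]) (use k in simp)
  have "compact ((\<lambda>x. f x 0) ` topspace X)"
    using image_compactin[OF compact_X[unfolded compact_space_def] cont] by simp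
  then obtain x where x: "x \<in> topspace X" "\<And>y. y \<in> topspace X \<Longrightarrow> f y 0 \<le> f x 0"
    using compact_attains_sup[of "(\<lambda>x. f x 0) ` topspace X"] X by auto
  define d where "d = (SOME d. d \<in> charts_at A x)"
  have d: "d \<in> A" "x \<in> fst d" using some_chart[OF x(1)] by (auto simp: d_def)
  let ?F = "\<lambda>u. f (chart_inv d u) 0"
  have "frechet_derivative ?F (at (snd d x)) = (\<lambda>v. 0)"
  proof (rule differential_zero_maxmin[OF chart_in_image[OF d(2)] chart_image_open[OF d(1)]])
    show "(?F has_derivative frechet_derivative ?F (at (snd d x))) (at (snd d x))"
      using C1_mapsD(2)[OF f d(1) _ chart_in_image[OF d(2)], of 0] k by (simp flip: frechet_derivative_works)
    have "?F u \<le> ?F (snd d x)" if "u \<in> chart_image d" for u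
      using x(2)[OF subsetD[OF chart_subset[OF d(1)] chart_inv_in[OF that]]]
      by (simp add: chart_inv_chart[OF d])
    then show "(\<forall>y\<in>chart_image d. ?F y \<le> ?F (snd d x)) \<or> (\<forall>y\<in>chart_image d. ?F (snd d x) \<le> ?F y)"
      by blast
  qed
  then have *: "differential A k f x v i = 0" if "i \<notin> {1..<k}" for v i
    unfolding differential_def d_def[symmetric] using that by (cases "i = 0") (auto simp: Let_def)
  \<comment> \<open>Component 0 of the derivative vanishes at the maximum, which leaves k - 1 unit
    sequences to span its image.\<close>
  have "differential A k f x ` tangent_space A x \<subseteq> seqs.span (seq_unit ` {1..<k})"
    using * by (intro image_subsetI in_span_seq_units) auto
  then have "diff_rank A k f x \<le> card (seq_unit ` {1..<k})"
    unfolding diff_rank_def by (rule seqs.dim_le_card) simp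
  also have "\<dots> \<le> card {1..<k}" by (rule card_image_le) simp
  also have "\<dots> < k" using k by simp
  finally show ?thesis using x(1) by blast
qed

text \<open>A basis of the image of the derivative has at least k elements and lies in the span of k
  unit sequences. If one of these were outside the image, adjoining it would give k + 1 independent
  vectors in that span. The preimages \<open>w j\<close> form a right inverse of the derivative at
  \<open>x\<close>.\<close>

lemma full_rank_preimages:
  assumes f: "f \<in> C1_maps X A k" and x: "x \<in> topspace X" and rank: "\<not> diff_rank A k f x < k"
  obtains d w where "d \<in> A" "x \<in> fst d"
    "\<And>i j. i < k \<Longrightarrow> j < k \<Longrightarrow>
       frechet_derivative (\<lambda>u. f (chart_inv d u) i) (at (snd d x)) (w j) = (if i = j then 1 else 0)"
proof -
  define d where "d = (SOME d. d \<in> charts_at A x)"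
  have d: "d \<in> A" "x \<in> fst d" using some_chart[OF x] by (auto simp: d_def)
  define D where "D v = (\<lambda>i. if i < k then frechet_derivative (\<lambda>u. f (chart_inv d u) i) (at (snd d x)) v else 0)" for v
  have lin: "linear (frechet_derivative (\<lambda>u. f (chart_inv d u) i) (at (snd d x)))" if "i < k" for i
    by (rule linear_frechet_derivative[OF C1_mapsD(2)[OF f d(1) that chart_in_image[OF d(2)]]])
  have sub: "seqs.subspace (range D)"
  proof (rule seqs.subspaceI)
    have "D 0 = 0" using linear_0[OF lin] by (auto simp: D_def fun_eq_iff)
    then show "0 \<in> range D" by (metis rangeI)
    have add: "D u + D v = D (u + v)" for u v using linear_add[OF lin] by (auto simp: D_def fun_eq_iff)
    show "y + z \<in> range D" if "y \<in> range D" "z \<in> range D" for y z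
      using that add by (metis (no_types, lifting) rangeE rangeI)
    have scale: "(\<lambda>i. a * D u i) = D (a *\<^sub>R u)" for a u
      using linear_cmul[OF lin] by (auto simp: D_def fun_eq_iff)
    show "(\<lambda>i. a * y i) \<in> range D" if "y \<in> range D" for a y
    proof -
      from that obtain u where "y = D u" by blast
      then show ?thesis using scale[of a u] by simp
    qed
  qed
  let ?I = "differential A k f x ` tangent_space A x"
  have IR: "?I \<subseteq> range D"
    using differential_in_chart[OF f d] by (auto simp: D_def)
  obtain Bs where Bs: "Bs \<subseteq> ?I" "seqs.independent Bs" "card Bs = seqs.dim ?I"
    using seqs.basis_exists[of ?I] by metis
  have cardB: "k \<le> card Bs" using rank Bs(3) by (simp add: diff_rank_def)
  have spanB: "seqs.span Bs \<subseteq> range D"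
    by (rule seqs.span_minimal[OF _ sub]) (use Bs(1) IR in blast)
  let ?E = "seq_unit ` {..<k}"
  have BsE: "Bs \<subseteq> seqs.span ?E"
  proof
    fix y assume "y \<in> Bs"
    then have "y \<in> range D" using Bs(1) IR by blast
    then show "y \<in> seqs.span ?E" by (intro in_span_seq_units) (auto simp: D_def)
  qed
  have "seq_unit j \<in> range D" if j: "j < k" for j
  proof (rule ccontr)
    assume "seq_unit j \<notin> range D"
    then have nin: "seq_unit j \<notin> seqs.span Bs" using spanB by blast
    then have ind: "seqs.independent (insert (seq_unit j) Bs)"
      using Bs(2) by (simp add: seqs.independent_insertI)
    have "insert (seq_unit j) Bs \<subseteq> seqs.span ?E"
      using BsE j by (auto intro: seqs.span_base)
    from seqs.independent_span_bound[OF _ ind this]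
    have "finite (insert (seq_unit j) Bs)" "card (insert (seq_unit j) Bs) \<le> card ?E" by auto
    moreover have "card ?E \<le> k" using card_image_le[of "{..<k}" seq_unit] by simp
    moreover have "seq_unit j \<notin> Bs" using nin seqs.span_base by blast
    ultimately show False using cardB by simp
  qed
  then have "\<forall>j. \<exists>v. j < k \<longrightarrow> D v = seq_unit j" by (metis rangeE)
  then obtain w where w: "\<And>j. j < k \<Longrightarrow> D (w j) = seq_unit j" by metis
  have "frechet_derivative (\<lambda>u. f (chart_inv d u) i) (at (snd d x)) (w j) = (if i = j then 1 else 0)"
    if "i < k" "j < k" for i j
    using fun_cong[OF w[OF that(2)], of i] that(1) by (simp add: D_def seq_unit_def)
  then show thesis using that d by blast
qed

end

text \<open>The vectors \<open>w j\<close> form an approximate right inverse of the derivative; the tolerance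
  \<open>1 / (2 k\<^sup>2)\<close> bounds the total error of a step of size \<open>t\<close> by \<open>t / 2\<close> times the norm of \<open>F u\<close>.\<close>

lemma newton_step_decrease:
  fixes F :: "nat \<Rightarrow> 'e::real_normed_vector \<Rightarrow> real" and w :: "nat \<Rightarrow> 'e"
  assumes S: "convex S" and d: "\<And>i z. i < k \<Longrightarrow> z \<in> S \<Longrightarrow> F i differentiable (at z)"
    and near: "\<And>i j z. i < k \<Longrightarrow> j < k \<Longrightarrow> z \<in> S \<Longrightarrow>
      \<bar>frechet_derivative (F i) (at z) (w j) - (if i = j then 1 else 0)\<bar> \<le> 1 / (2 * (real k)\<^sup>2)"
    and u: "u \<in> S" and v: "v = (\<Sum>j<k. F j u *\<^sub>R w j)" and t: "0 \<le> t" "t \<le> 1" and ut: "u - t *\<^sub>R v \<in> S"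
  shows "L2_set (\<lambda>i. F i (u - t *\<^sub>R v)) {..<k} \<le> (1 - t / 2) * L2_set (\<lambda>i. F i u) {..<k}"
proof (cases "t = 0 \<or> k = 0")
  case False
  then have t0: "0 < t" and k0: "0 < k" using t by auto
  define N where "N = L2_set (\<lambda>i. F i u) {..<k}"
  have N0: "0 \<le> N" by (simp add: N_def)
  have "L2_set (\<lambda>i. \<bar>F i u\<bar>) {..<k} = N" by (simp add: N_def L2_set_def)
  then have FN: "\<bar>F j u\<bar> \<le> N" if "j < k" for j
    using member_le_L2_set[of "{..<k}" j "\<lambda>i. \<bar>F i u\<bar>"] that by simp
  have seg: "u - s *\<^sub>R v \<in> S" if "0 \<le> s" "s \<le> t" for s
  proof -
    have "(1 - s / t) *\<^sub>R u + (s / t) *\<^sub>R (u - t *\<^sub>R v) = u - s *\<^sub>R v"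
      using t0 by (simp add: algebra_simps)
    moreover have "(1 - s / t) *\<^sub>R u + (s / t) *\<^sub>R (u - t *\<^sub>R v) \<in> S"
      using that t0 by (intro convexD[OF S u ut]) auto
    ultimately show ?thesis by simp
  qed
  \<comment> \<open>The mean value theorem is applied to each component separately; its intermediate
    point depends on \<open>i\<close>, which does no harm because \<open>near\<close> holds on all
    of \<open>S\<close>.\<close>
  have "\<exists>e. F i (u - t *\<^sub>R v) = (1 - t) * F i u + t * e \<and> \<bar>e\<bar> \<le> N / (2 * real k)" if i: "i < k" for i
  proof -
    let ?D = "\<lambda>z. frechet_derivative (F i) (at z)"
    let ?h = "\<lambda>s. F i (u - s *\<^sub>R v)"
    have hd: "(?h has_derivative (\<lambda>ds. ?D (u - s *\<^sub>R v) (- (ds *\<^sub>R v)))) (at s)" if s: "0 \<le> s" "s \<le> t" for s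
    proof -
      have "((\<lambda>s. u - s *\<^sub>R v) has_derivative (\<lambda>ds. - (ds *\<^sub>R v))) (at s)"
        by (auto intro!: derivative_eq_intros)
      moreover have "(F i has_derivative ?D (u - s *\<^sub>R v)) (at (u - s *\<^sub>R v))"
        using d[OF i seg[OF s]] by (simp flip: frechet_derivative_works)
      ultimately show ?thesis using diff_chain_at by (fastforce simp: comp_def)
    qed
    have "continuous_on {0..t} ?h"
      using hd by (intro continuous_at_imp_continuous_on ballI has_derivative_continuous) auto
    then obtain \<xi> where \<xi>: "0 < \<xi>" "\<xi> < t" "?h t - ?h 0 = ?D (u - \<xi> *\<^sub>R v) (- ((t - 0) *\<^sub>R v))"
      using mvt[OF t0, of ?h "\<lambda>s ds. ?D (u - s *\<^sub>R v) (- (ds *\<^sub>R v))"] hd by auto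
    let ?z = "u - \<xi> *\<^sub>R v"
    have z: "?z \<in> S" using \<xi> by (intro seg) auto
    have lin: "linear (?D ?z)" by (rule linear_frechet_derivative[OF d[OF i z]])
    have "?D ?z (\<Sum>j<k. F j u *\<^sub>R w j) = (\<Sum>j<k. F j u * ?D ?z (w j))"
      by (simp add: linear_sum[OF lin] linear_cmul[OF lin])
    then have Dv: "?D ?z v = (\<Sum>j<k. F j u * ?D ?z (w j))" by (simp only: v[symmetric])
    \<comment> \<open>The error by which the slope of \<open>F i\<close> along \<open>v\<close>
      misses \<open>F i u\<close>, the slope of an exact Newton step.\<close>
    define e where "e = F i u - ?D ?z v"
    have "?D ?z (- ((t - 0) *\<^sub>R v)) = - (t * ?D ?z v)"
      using linear_neg[OF lin] linear_cmul[OF lin] by simp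
    then have 1: "F i (u - t *\<^sub>R v) = (1 - t) * F i u + t * e"
      using \<xi>(3) by (simp add: e_def algebra_simps)
    have "F i u = (\<Sum>j<k. F j u * (if i = j then 1 else 0))"
      using i by (simp add: if_distrib[of "\<lambda>x. _ * x"] cong: if_cong)
    then have "e = - (\<Sum>j<k. F j u * (?D ?z (w j) - (if i = j then 1 else 0)))"
      unfolding e_def Dv by (simp add: right_diff_distrib sum_subtractf)
    then have "\<bar>e\<bar> \<le> (\<Sum>j<k. \<bar>F j u * (?D ?z (w j) - (if i = j then 1 else 0))\<bar>)"
      by (simp add: sum_abs)
    also have "\<dots> \<le> (\<Sum>j<k. N * (1 / (2 * (real k)\<^sup>2)))"
      unfolding abs_mult using near[OF i _ z] FN N0 by (intro sum_mono mult_mono) auto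
    also have "\<dots> = N / (2 * real k)" using k0 by (simp add: power2_eq_square)
    finally show ?thesis using 1 by blast
  qed
  then obtain e where e: "\<And>i. i < k \<Longrightarrow> F i (u - t *\<^sub>R v) = (1 - t) * F i u + t * e i"
    "\<And>i. i < k \<Longrightarrow> \<bar>e i\<bar> \<le> N / (2 * real k)" by metis
  have "L2_set e {..<k} \<le> (\<Sum>i<k. \<bar>e i\<bar>)" by (rule L2_set_le_sum_abs)
  also have "\<dots> \<le> (\<Sum>i<k. N / (2 * real k))" using e(2) by (intro sum_mono) auto
  also have "\<dots> = N / 2" using k0 by simp
  finally have eN: "t * L2_set e {..<k} \<le> t * (N / 2)" using t by (intro mult_left_mono) auto
  have "L2_set (\<lambda>i. F i (u - t *\<^sub>R v)) {..<k} = L2_set (\<lambda>i. (1 - t) * F i u + t * e i) {..<k}"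
    using e(1) by (intro L2_set_cong) auto
  also have "\<dots> \<le> L2_set (\<lambda>i. (1 - t) * F i u) {..<k} + L2_set (\<lambda>i. t * e i) {..<k}"
    by (rule L2_set_triangle_ineq)
  also have "\<dots> = (1 - t) * N + t * L2_set e {..<k}"
    using t by (simp add: L2_set_right_distrib N_def)
  also have "\<dots> \<le> (1 - t) * N + t * (N / 2)" using eN by simp
  also have "\<dots> = (1 - t / 2) * N" by (simp add: algebra_simps)
  finally show ?thesis by (simp add: N_def)
qed auto

section \<open>Lipschitz estimate from the \<open>C\<^sup>1\<close>-norm\<close>

context compact_manifold
begin

lemma coord_vector_scale:
  assumes c: "c \<in> A" "x \<in> fst c"
  shows "coord_vector A c x (r *\<^sub>R e) = (\<lambda>d. r *\<^sub>R coord_vector A c x e d)"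
proof
  fix d
  show "coord_vector A c x (r *\<^sub>R e) d = r *\<^sub>R coord_vector A c x e d"
  proof (cases "d \<in> charts_at A x")
    case True
    then have "linear (frechet_derivative (transition c d) (at (snd c x)))"
      using transition_differentiable[OF c(1) _ c(2)] by (intro linear_frechet_derivative) (auto simp: charts_at_def)
    then show ?thesis using True by (simp add: coord_vector_def linear_cmul)
  qed (simp add: coord_vector_def)
qed

text \<open>The norm bounds derivatives along vectors of g-length 1, so the coordinate vector of
  \<open>e\<close> is divided by its length \<open>s\<close>. It is nonzero because its coordinate
  in the chart \<open>c\<close> is \<open>e\<close>.\<close>

lemma derivative_le_C1_norm:
  assumes metric: "riemannian_metric X A g" and f: "f \<in> C1_maps X A k"
    and L: "C1_norm X A g k f \<le> ennreal L" "0 \<le> L" and c: "c \<in> A" "x \<in> fst c" and e: "e \<noteq> 0"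
  shows "L2_set (\<lambda>i. frechet_derivative (\<lambda>u. f (chart_inv c u) i) (at (snd c x)) e) {..<k}
    \<le> L * sqrt (g x (coord_vector A c x e) (coord_vector A c x e))"
proof -
  let ?v = "coord_vector A c x e"
  have xX: "x \<in> topspace X" using c chart_subset by blast
  have vT: "?v \<in> tangent_space A x" by (rule coord_vector_tangent[OF c])
  have "?v \<noteq> (\<lambda>c. 0)" using coord_vector_self[OF c, of e] e by (metis (full_types))
  then have pos: "0 < g x ?v ?v" using metric xX vT unfolding riemannian_metric_def by blast
  define s where "s = sqrt (g x ?v ?v)"
  have s: "0 < s" "s * s = g x ?v ?v" using pos by (auto simp: s_def)
  let ?v' = "coord_vector A c x ((1 / s) *\<^sub>R e)"
  have v'T: "?v' \<in> tangent_space A x" by (rule coord_vector_tangent[OF c])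
  have v': "?v' = (\<lambda>d. (1 / s) *\<^sub>R ?v d)" by (rule coord_vector_scale[OF c])
  have sc: "g x (\<lambda>c. r *\<^sub>R u c) v = r * g x u v" and sym: "g x u v = g x v u"
    if "u \<in> tangent_space A x" "v \<in> tangent_space A x" for u v r
    using metric xX that unfolding riemannian_metric_def by blast+
  \<comment> \<open>\<open>riemannian_metric\<close> states homogeneity in the first argument; the
    second factor 1 / s is pulled out by symmetry.\<close>
  have "g x ?v' ?v' = (1 / s) * g x ?v ?v'" using sc[OF vT v'T, of "1 / s"] by (simp only: v'[symmetric])
  also have "g x ?v ?v' = g x ?v' ?v" by (rule sym[OF vT v'T])
  also have "\<dots> = (1 / s) * g x ?v ?v" using sc[OF vT vT, of "1 / s"] by (simp only: v'[symmetric])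
  finally have "g x ?v' ?v' = (1 / s) * ((1 / s) * g x ?v ?v)" .
  also have "\<dots> = 1" unfolding s(2)[symmetric] using s(1) by simp
  finally have "sqrt (g x ?v' ?v') = 1" by simp
  then have "ennreal (L2_set (differential A k f x ?v') {..<k}) \<le> diff_norm A g k f x"
    unfolding diff_norm_def using v'T by (intro SUP_upper) simp
  also have "\<dots> \<le> ennreal (L2_set (f x) {..<k}) + diff_norm A g k f x" by simp
  also have "\<dots> \<le> C1_norm X A g k f" unfolding C1_norm_def by (rule SUP_upper[OF xX])
  also note L(1)
  finally have le: "L2_set (differential A k f x ?v') {..<k} \<le> L" using L(2) by simp
  let ?D = "\<lambda>i. frechet_derivative (\<lambda>u. f (chart_inv c u) i) (at (snd c x))"
  have "differential A k f x ?v' i = (1 / s) * ?D i e" if i: "i < k" for i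
  proof -
    have "linear (?D i)"
      by (rule linear_frechet_derivative[OF C1_mapsD(2)[OF f c(1) i chart_in_image[OF c(2)]]])
    then show ?thesis
      unfolding differential_in_chart[OF f c v'T] coord_vector_self[OF c] using i by (simp add: linear_cmul)
  qed
  then have "L2_set (differential A k f x ?v') {..<k} = L2_set (\<lambda>i. (1 / s) * ?D i e) {..<k}"
    by (intro L2_set_cong) auto
  also have "\<dots> = (1 / s) * L2_set (\<lambda>i. ?D i e) {..<k}"
    using s(1) by (intro L2_set_right_distrib[symmetric]) simp
  finally have "L2_set (\<lambda>i. ?D i e) {..<k} = s * L2_set (differential A k f x ?v') {..<k}"
    using s(1) by simp
  also have "\<dots> \<le> s * L" using le s(1) by (intro mult_left_mono) auto
  finally show ?thesis unfolding s_def by (simp add: mult.commute)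
qed

lemma value_le_C1_norm:
  assumes "C1_norm X A g k f \<le> ennreal L" "0 \<le> L" "x \<in> topspace X"
  shows "L2_set (f x) {..<k} \<le> L"
proof -
  have "ennreal (L2_set (f x) {..<k}) \<le> ennreal (L2_set (f x) {..<k}) + diff_norm A g k f x" by simp
  also have "\<dots> \<le> C1_norm X A g k f" unfolding C1_norm_def by (rule SUP_upper[OF assms(3)])
  also note assms(1)
  finally show ?thesis using assms(2) by simp
qed

end

context charted_manifold
begin

text \<open>\<open>K\<close> bounds the g-lengths of the coordinate basis vectors over the compact
  chart balls; with \<open>derivative_le_C1_norm\<close> it turns the C1-norm into a bound on
  coordinate derivatives.\<close>

lemma metric_bounded:
  assumes metric: "riemannian_metric X A g" and B: "finite B"
  shows "\<exists>K\<ge>0. \<forall>i<q. \<forall>u\<in>cball (p i) (3 * \<rho> i). \<forall>b\<in>B.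
    g (chart_inv (c i) u) (coord_vector A (c i) (chart_inv (c i) u) b) (coord_vector A (c i) (chart_inv (c i) u) b) \<le> K\<^sup>2"
proof -
  let ?g = "\<lambda>i b u. g (chart_inv (c i) u) (coord_vector A (c i) (chart_inv (c i) u) b) (coord_vector A (c i) (chart_inv (c i) u) b)"
  have "\<exists>N. i < q \<longrightarrow> (\<forall>u\<in>cball (p i) (3 * \<rho> i). \<bar>?g i b u\<bar> \<le> N)" for i b
  proof (cases "i < q")
    case True
    have "smooth_on (?g i b) (chart_image (c i))"
      by (rule metric[unfolded riemannian_metric_def, THEN conjunct2, rule_format, OF c_in[OF True]])
    then have "Ck_on 0 (?g i b) (chart_image (c i))" unfolding smooth_on_def by (rule spec)
    then have "continuous_on (chart_image (c i)) (?g i b)" by (simp only: Ck_on.simps)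
    then have "continuous_on (cball (p i) (3 * \<rho> i)) (?g i b)"
      by (rule continuous_on_subset[OF _ cball_subset[OF True]])
    then have "bounded (?g i b ` cball (p i) (3 * \<rho> i))"
      by (intro compact_imp_bounded compact_continuous_image compact_cball)
    then obtain N where "\<forall>y\<in>?g i b ` cball (p i) (3 * \<rho> i). norm y \<le> N" unfolding bounded_iff by blast
    then have "\<forall>u\<in>cball (p i) (3 * \<rho> i). \<bar>?g i b u\<bar> \<le> N" by simp
    then show ?thesis by blast
  qed simp
  then obtain N where N: "\<And>i b u. i < q \<Longrightarrow> u \<in> cball (p i) (3 * \<rho> i) \<Longrightarrow> \<bar>?g i b u\<bar> \<le> N i b" by metis
  \<comment> \<open>The summand 1 makes \<open>K\<close> at least 1, so that a bound by
    \<open>K\<close> is also one by its square, the form that suits lengths.\<close>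
  define K where "K = 1 + (\<Sum>i<q. \<Sum>b\<in>B. \<bar>N i b\<bar>)"
  have K1: "1 \<le> K" by (simp add: K_def sum_nonneg)
  have "?g i b u \<le> K\<^sup>2" if "i < q" "u \<in> cball (p i) (3 * \<rho> i)" "b \<in> B" for i u b
  proof -
    have "?g i b u \<le> \<bar>N i b\<bar>" using N[OF that(1,2), of b] by linarith
    also have "\<dots> \<le> (\<Sum>b\<in>B. \<bar>N i b\<bar>)" using that B by (intro member_le_sum) auto
    also have "\<dots> \<le> (\<Sum>i<q. \<Sum>b\<in>B. \<bar>N i b\<bar>)"
      using that by (intro member_le_sum[of i "{..<q}" "\<lambda>i. \<Sum>b\<in>B. \<bar>N i b\<bar>"]) (auto intro: sum_nonneg)
    also have "\<dots> \<le> K * 1" by (simp add: K_def)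
    also have "\<dots> \<le> K * K" using K1 by (intro mult_left_mono) auto
    finally show ?thesis by (simp add: power2_eq_square)
  qed
  then show ?thesis using K1 by (intro exI[of _ K]) auto
qed

text \<open>The mean value inequality is applied to the scalar function \<open>\<langle>f, \<lambda>\<rangle>\<close> with
  \<open>\<lambda> = f x - f x'\<close>.\<close>

lemma C1_lipschitz_in_charts:
  assumes metric: "riemannian_metric X A g"
  obtains K where "1 \<le> K" and "\<And>k f L i u u'. f \<in> C1_maps X A k \<Longrightarrow> 0 \<le> L \<Longrightarrow> C1_norm X A g k f \<le> ennreal L \<Longrightarrow>
      i < q \<Longrightarrow> u \<in> cball (p i) (3 * \<rho> i) \<Longrightarrow> u' \<in> cball (p i) (3 * \<rho> i) \<Longrightarrow>
      L2_set (\<lambda>j. f (chart_inv (c i) u) j - f (chart_inv (c i) u') j) {..<k} \<le> K * L * dist u u'"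
proof -
  obtain B :: "'e set" where B: "finite B" "orthonormal B" "span B = UNIV" using orthonormal_basis by metis
  obtain K where K: "0 \<le> K" "\<And>i u b. i < q \<Longrightarrow> u \<in> cball (p i) (3 * \<rho> i) \<Longrightarrow> b \<in> B \<Longrightarrow>
    g (chart_inv (c i) u) (coord_vector A (c i) (chart_inv (c i) u) b) (coord_vector A (c i) (chart_inv (c i) u) b) \<le> K\<^sup>2"
    using metric_bounded[OF metric B(1)] by blast
  define K' where "K' = 1 + real (card B) * K"
  have K': "1 \<le> K'" using K(1) by (simp add: K'_def)
  have main: "L2_set (\<lambda>j. f (chart_inv (c i) u) j - f (chart_inv (c i) u') j) {..<k} \<le> K' * L * dist u u'"
    if f: "f \<in> C1_maps X A k" and L: "0 \<le> L" "C1_norm X A g k f \<le> ennreal L" and i: "i < q"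
      and u: "u \<in> cball (p i) (3 * \<rho> i)" "u' \<in> cball (p i) (3 * \<rho> i)" for k f L i u u'
  proof -
    define F where "F j z = f (chart_inv (c i) z) j" for j z
    define y where "y j = F j u - F j u'" for j
    define N where "N = L2_set y {..<k}"
    have N0: "0 \<le> N" by (simp add: N_def)
    define H where "H z = (\<Sum>j<k. y j * F j z)" for z
    let ?D = "\<lambda>j z. frechet_derivative (F j) (at z)"
    have dH: "(H has_derivative (\<lambda>v. \<Sum>j<k. y j * ?D j z v)) (at z)" if z: "z \<in> cball (p i) (3 * \<rho> i)" for z
    proof -
      have "(F j has_derivative ?D j z) (at z)" if "j < k" for j
        using C1_mapsD(2)[OF f c_in[OF i] that subsetD[OF cball_subset[OF i] z]]
        by (simp add: F_def[abs_def] flip: frechet_derivative_works)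
      then show ?thesis unfolding H_def by (intro has_derivative_sum has_derivative_mult_right) auto
    qed
    have DH: "frechet_derivative H (at z) = (\<lambda>v. \<Sum>j<k. y j * ?D j z v)" if z: "z \<in> cball (p i) (3 * \<rho> i)" for z
      using frechet_derivative_at[OF dH[OF z]] by simp
    have Db: "\<bar>frechet_derivative H (at z) b\<bar> \<le> N * (L * K)" if z: "z \<in> cball (p i) (3 * \<rho> i)" and b: "b \<in> B" for z b
    proof -
      have zi: "z \<in> chart_image (c i)" by (rule subsetD[OF cball_subset[OF i] z])
      have b0: "b \<noteq> 0"
      proof
        assume "b = 0"
        moreover have "b \<bullet> b = 1" using B(2) b unfolding orthonormal_def by metis
        ultimately show False by simp
      qed
      have "L2_set (\<lambda>j. ?D j z b) {..<k} \<le> L * sqrt (g (chart_inv (c i) z)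
          (coord_vector A (c i) (chart_inv (c i) z) b) (coord_vector A (c i) (chart_inv (c i) z) b))"
        using derivative_le_C1_norm[OF metric f L(2,1) c_in[OF i] chart_inv_in[OF zi] b0]
        by (simp add: chart_chart_inv[OF zi] F_def[abs_def])
      also have "\<dots> \<le> L * sqrt (K\<^sup>2)"
        using K(2)[OF i z b] L(1) by (intro mult_left_mono real_sqrt_le_mono)
      finally have D: "L2_set (\<lambda>j. ?D j z b) {..<k} \<le> L * K" using K(1) by simp
      \<comment> \<open>The Cauchy-Schwarz inequality pairs the Euclidean norms directly; summing
        componentwise bounds would let \<open>k\<close> into the constant.\<close>
      have "\<bar>frechet_derivative H (at z) b\<bar> \<le> (\<Sum>j<k. \<bar>y j\<bar> * \<bar>?D j z b\<bar>)"
        unfolding DH[OF z] by (intro order_trans[OF sum_abs]) (simp add: abs_mult)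
      also have "\<dots> \<le> N * L2_set (\<lambda>j. ?D j z b) {..<k}" unfolding N_def by (rule L2_set_mult_ineq)
      also have "\<dots> \<le> N * (L * K)" using D N0 by (rule mult_left_mono)
      finally show ?thesis .
    qed
    have "norm (H u - H u') \<le> (real (card B) * (N * (L * K))) * norm (u - u')"
    proof (rule differentiable_bound[OF convex_cball[of "p i" "3 * \<rho> i"] _ _ u])
      fix z assume z: "z \<in> cball (p i) (3 * \<rho> i)"
      have Hd: "H differentiable (at z)" using dH[OF z] by (auto simp: differentiable_def)
      then have "(H has_derivative frechet_derivative H (at z)) (at z)" by (simp flip: frechet_derivative_works)
      then show "(H has_derivative frechet_derivative H (at z)) (at z within cball (p i) (3 * \<rho> i))"
        by (rule has_derivative_at_withinI)
      show "onorm (frechet_derivative H (at z)) \<le> real (card B) * (N * (L * K))"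
      proof (rule onorm_bound)
        show "norm (frechet_derivative H (at z) v) \<le> real (card B) * (N * (L * K)) * norm v" for v
          by (rule frechet_derivative_norm_le[OF B Hd]) (use Db[OF z] in simp)
      qed (use N0 L K in simp)
    qed
    moreover have "H u - H u' = N\<^sup>2"
    proof -
      have "H u - H u' = (\<Sum>j<k. y j * y j)"
        by (simp add: H_def y_def right_diff_distrib sum_subtractf)
      also have "\<dots> = N\<^sup>2" by (simp add: N_def L2_set_def sum_nonneg power2_eq_square)
      finally show ?thesis .
    qed
    ultimately have "N * N \<le> N * (real (card B) * K * L * dist u u')"
      by (simp add: power2_eq_square dist_norm mult_ac)
    then have "N \<le> real (card B) * K * L * dist u u' \<or> N = 0"
      using N0 by (auto simp: mult_le_cancel_left)
    moreover have "0 \<le> real (card B) * K * L * dist u u'" using K L by simp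
    ultimately have "N \<le> real (card B) * K * L * dist u u'" by auto
    also have "\<dots> \<le> K' * L * dist u u'"
      using L by (intro mult_right_mono) (auto simp: K'_def)
    finally show ?thesis by (simp add: N_def y_def[abs_def] F_def)
  qed
  show thesis by (rule that[OF K' main])
qed

section \<open>Pushing towards the zero set\<close>

definition \<Psi> :: "(nat \<Rightarrow>\<^sub>C ('e \<times> real)) \<Rightarrow> 'a" where
  "\<Psi> = inv_into (topspace X) \<Phi>"

lemma \<Psi>_\<Phi>: "x \<in> topspace X \<Longrightarrow> \<Psi> (\<Phi> x) = x"
  by (simp add: \<Psi>_def \<Phi>_inj)

lemma \<Phi>_\<Psi>: "y \<in> M \<Longrightarrow> \<Phi> (\<Psi> y) = y"
  by (simp add: \<Psi>_def M_def f_inv_into_f)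

lemma \<Psi>_in: "y \<in> M \<Longrightarrow> \<Psi> y \<in> topspace X"
  by (simp add: \<Psi>_def M_def inv_into_into)

lemma continuous_\<Psi>: "continuous_map (top_of_set M) X \<Psi>"
proof -
  obtain h where h: "homeomorphic_maps X (top_of_set M) \<Phi> h"
    using homeomorphic_\<Phi> homeomorphic_map_maps by blast
  then have *: "continuous_map (top_of_set M) X h" by (simp add: homeomorphic_maps_def)
  have "h y = \<Psi> y" if "y \<in> topspace (top_of_set M)" for y
  proof -
    have "h (\<Phi> (\<Psi> y)) = \<Psi> y" using h \<Psi>_in that by (simp add: homeomorphic_maps_def)
    then show ?thesis using \<Phi>_\<Psi> that by simp
  qed
  then show ?thesis by (rule continuous_map_eq[OF *])
qed

definition f_norm :: "('a \<Rightarrow> nat \<Rightarrow> real) \<Rightarrow> nat \<Rightarrow> (nat \<Rightarrow>\<^sub>C ('e \<times> real)) \<Rightarrow> real" where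
  "f_norm f k y = L2_set (f (\<Psi> y)) {..<k}"

lemma continuous_on_f_norm:
  assumes "f \<in> C1_maps X A k"
  shows "continuous_on M (f_norm f k)"
proof -
  have "continuous_on M (\<lambda>y. f (\<Psi> y) i)" if "i < k" for i
    using continuous_map_compose[OF continuous_\<Psi> continuous_map_C1[OF assms that]] by (simp add: comp_def)
  then show ?thesis unfolding f_norm_def[abs_def] L2_set_def by (intro continuous_intros) auto
qed

text \<open>In a chart around \<open>y0\<close> the step subtracts \<open>l u *\<^sub>R v u\<close>
  from u. The direction \<open>v u\<close> uses the right inverse of the derivative at the centre
  for all nearby u, so it is continuous in u; \<open>l\<close> fades the step out before the edge of
  the chart ball, beyond which the map is the identity.\<close>

lemma push_ex:
  assumes f: "f \<in> C1_maps X A k" and s: "0 \<le> s"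
    and K: "K = {y \<in> M. f_norm f k y \<le> s}" and y0: "y0 \<in> K" and rank: "\<not> diff_rank A k f (\<Psi> y0) < k"
  shows "\<exists>S l C. push K (f_norm f k) S l C \<and> 0 < l y0"
proof -
  have KM: "K \<subseteq> M" by (auto simp: K)
  have x0: "\<Psi> y0 \<in> topspace X" using y0 \<Psi>_in by (simp add: K)
  obtain d w where d: "d \<in> A" "\<Psi> y0 \<in> fst d"
    and w: "\<And>i j. i < k \<Longrightarrow> j < k \<Longrightarrow>
       frechet_derivative (\<lambda>u. f (chart_inv d u) i) (at (snd d (\<Psi> y0))) (w j) = (if i = j then 1 else 0)"
    using full_rank_preimages[OF f x0 rank] by metis
  define u0 where "u0 = snd d (\<Psi> y0)"
  define F where "F i u = f (chart_inv d u) i" for i u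
  define \<gamma> where "\<gamma> u = \<Phi> (chart_inv d u)" for u
  define \<kappa> where "\<kappa> y = snd d (\<Psi> y)" for y
  define \<tau> where "\<tau> = 1 / (2 * (real k)\<^sup>2)"
  let ?V = "chart_image d"
  let ?near = "\<lambda>z. \<forall>i\<in>{..<k}. \<forall>j\<in>{..<k}. \<bar>frechet_derivative (F i) (at z) (w j) - (if i = j then 1 else 0)\<bar> \<le> \<tau>"
  have u0: "u0 \<in> ?V" using chart_in_image[OF d(2)] by (simp add: u0_def)
  have V: "open ?V" by (rule chart_image_open[OF d(1)])
  have Fd: "F i differentiable (at z)" if "i < k" "z \<in> ?V" for i z
    using C1_mapsD(2)[OF f d(1) that] by (simp add: F_def[abs_def])
  have Fc: "continuous_on ?V (F i)" if "i < k" for i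
    using C1_mapsD(3)[OF f d(1) that] by (simp add: F_def[abs_def])
  have "\<forall>\<^sub>F z in nhds u0. \<bar>frechet_derivative (F i) (at z) (w j) - (if i = j then 1 else 0)\<bar> \<le> \<tau>"
    if ij: "i < k" "j < k" for i j
  proof -
    have "isCont (\<lambda>z. frechet_derivative (F i) (at z) (w j)) u0"
      using C1_mapsD(4)[OF f d(1) ij(1), of "w j"] continuous_on_eq_continuous_at[OF V] u0
      by (auto simp: F_def[abs_def])
    then have "((\<lambda>z. frechet_derivative (F i) (at z) (w j)) \<longlongrightarrow> frechet_derivative (F i) (at u0) (w j)) (nhds u0)"
      by (simp add: isCont_def tendsto_nhds_iff)
    moreover have "0 < \<tau>" using ij by (simp add: \<tau>_def)
    ultimately have "\<forall>\<^sub>F z in nhds u0. dist (frechet_derivative (F i) (at z) (w j)) (frechet_derivative (F i) (at u0) (w j)) < \<tau>"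
      by (rule tendstoD)
    then show ?thesis
    proof (rule eventually_mono)
      fix z
      assume "dist (frechet_derivative (F i) (at z) (w j)) (frechet_derivative (F i) (at u0) (w j)) < \<tau>"
      moreover have "frechet_derivative (F i) (at u0) (w j) = (if i = j then 1 else 0)"
        using w[OF ij] by (simp add: F_def[abs_def] u0_def)
      ultimately show "\<bar>frechet_derivative (F i) (at z) (w j) - (if i = j then 1 else 0)\<bar> \<le> \<tau>"
        unfolding dist_real_def by (simp only: less_imp_le)
    qed
  qed
  then have "\<forall>\<^sub>F z in nhds u0. ?near z" by (intro eventually_ball_finite ballI) auto
  then obtain W where W: "open W" "u0 \<in> W" "\<And>z. z \<in> W \<Longrightarrow> ?near z" unfolding eventually_nhds by blast
  have "lipschitz_near \<gamma> u0" unfolding \<gamma>_def[abs_def] by (rule \<Phi>_lipschitz_near[OF d(1) u0])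
  then obtain r Lc where r: "0 < r" "0 \<le> Lc" "ball u0 r \<subseteq> W \<inter> ?V"
    "\<And>u v. u \<in> ball u0 r \<Longrightarrow> v \<in> ball u0 r \<Longrightarrow> dist (\<gamma> u) (\<gamma> v) \<le> Lc * dist u v"
    using lipschitz_nearE[of \<gamma> u0 "W \<inter> ?V"] W V u0 by (metis IntI open_Int)
  have rV: "ball u0 r \<subseteq> ?V" and rW: "ball u0 r \<subseteq> W" using r(3) by auto
  define v where "v u = (\<Sum>j<k. F j u *\<^sub>R w j)" for u
  define Wn where "Wn = (\<Sum>j<k. norm (w j))"
  have Wn0: "0 \<le> Wn" by (simp add: Wn_def sum_nonneg)
  \<comment> \<open>Nontrivial steps start within r/3 of \<open>u0\<close>, and the bound
    \<open>s\<close> for |f| on \<open>K\<close> limits their length to h0 s Wn \<le> r/3, so they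
    end inside the ball of radius \<open>r\<close>. The added 1 avoids division by 0.\<close>
  define h0 where "h0 = min 1 (r / (3 * (1 + s * Wn)))"
  have sW: "0 < 1 + s * Wn" using s Wn0 by (simp add: add_pos_nonneg)
  have h0: "0 < h0" "h0 \<le> 1" "h0 * (s * Wn) \<le> r / 3"
  proof -
    show "0 < h0" "h0 \<le> 1" using r sW by (auto simp: h0_def)
    have "h0 * (s * Wn) \<le> r / (3 * (1 + s * Wn)) * (1 + s * Wn)"
      using s Wn0 r by (intro mult_mono) (auto simp: h0_def)
    also have "\<dots> = r / 3"
    proof -
      have "r / (3 * z) * z = r / 3" if "z \<noteq> 0" for z :: real using that by simp
      then show ?thesis using sW by (metis less_irrefl)
    qed
    finally show "h0 * (s * Wn) \<le> r / 3" .
  qed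
  define l where "l u = h0 * max 0 (1 - 3 * dist u u0 / r)" for u
  have l0: "0 \<le> l u" for u using h0 by (simp add: l_def)
  have lh: "l u \<le> h0" for u
  proof -
    have "h0 * max 0 (1 - 3 * dist u u0 / r) \<le> h0 * 1"
      using h0 r by (intro mult_left_mono) auto
    then show ?thesis by (simp add: l_def)
  qed
  have lz: "l u = 0" if "r / 3 \<le> dist u u0" for u
    using that r by (simp add: l_def field_simps)
  define O1 where "O1 = {y \<in> M. \<Psi> y \<in> fst d \<and> \<kappa> y \<in> ball u0 r}"
  define step where "step u = u - l u *\<^sub>R v u" for u
  define S where "S y = (if y \<in> O1 then \<gamma> (step (\<kappa> y)) else y)" for y
  \<comment> \<open>The half matches the factor 1 - t / 2 in
    \<open>newton_step_decrease\<close>.\<close>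
  define ll where "ll y = (if y \<in> O1 then l (\<kappa> y) / 2 else 0)" for y
  have \<gamma>\<kappa>: "\<gamma> (\<kappa> y) = y" if "y \<in> O1" for y
    using that chart_inv_chart[OF d(1)] \<Phi>_\<Psi> by (simp add: O1_def \<gamma>_def \<kappa>_def)
  have F\<kappa>: "F i (\<kappa> y) = f (\<Psi> y) i" if "y \<in> O1" for y i
    using that chart_inv_chart[OF d(1)] by (simp add: O1_def F_def \<kappa>_def)
  have fn0: "0 \<le> f_norm f k y" for y by (simp add: f_norm_def)
  have vn: "norm (v (\<kappa> y)) \<le> f_norm f k y * Wn" if y: "y \<in> O1" for y
  proof -
    have "\<bar>F j (\<kappa> y)\<bar> \<le> f_norm f k y" if "j < k" for j
    proof -
      have "\<bar>F j (\<kappa> y)\<bar> \<le> L2_set (\<lambda>j. \<bar>F j (\<kappa> y)\<bar>) {..<k}" using that by (intro member_le_L2_set) auto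
      also have "\<dots> = f_norm f k y" using F\<kappa>[OF y] by (simp add: f_norm_def L2_set_def)
      finally show ?thesis .
    qed
    then have "(\<Sum>j<k. norm (F j (\<kappa> y) *\<^sub>R w j)) \<le> (\<Sum>j<k. f_norm f k y * norm (w j))"
      by (intro sum_mono) (simp add: mult_right_mono)
    then show ?thesis
      unfolding v_def Wn_def sum_distrib_left by (rule order_trans[OF norm_sum])
  qed
  have step_in: "step (\<kappa> y) \<in> ball u0 r" if y: "y \<in> K" "y \<in> O1" for y
  proof (cases "r / 3 \<le> dist (\<kappa> y) u0")
    case True
    then show ?thesis using lz[OF True] y(2) by (simp add: step_def O1_def)
  next
    case False
    have "norm (l (\<kappa> y) *\<^sub>R v (\<kappa> y)) = l (\<kappa> y) * norm (v (\<kappa> y))" using l0 by simp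
    also have "\<dots> \<le> h0 * (f_norm f k y * Wn)" using lh vn[OF y(2)] h0 by (intro mult_mono) auto
    also have "\<dots> \<le> h0 * (s * Wn)" using y(1) h0 Wn0 by (intro mult_left_mono mult_right_mono) (auto simp: K)
    also have "\<dots> \<le> r / 3" by (rule h0(3))
    finally have "dist (step (\<kappa> y)) (\<kappa> y) \<le> r / 3" by (simp add: step_def dist_norm)
    then have "dist (step (\<kappa> y)) u0 < r" using False r(1) dist_triangle[of "step (\<kappa> y)" u0 "\<kappa> y"] by linarith
    then show ?thesis by (simp add: dist_commute)
  qed
  have \<gamma>M: "\<gamma> u \<in> M" "\<Psi> (\<gamma> u) = chart_inv d u" if "u \<in> ball u0 r" for u
  proof -
    have "chart_inv d u \<in> topspace X"
      by (rule subsetD[OF chart_subset[OF d(1)] chart_inv_in[OF subsetD[OF rV that]]])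
    then show "\<gamma> u \<in> M" "\<Psi> (\<gamma> u) = chart_inv d u" by (auto simp: \<gamma>_def M_def \<Psi>_\<Phi>)
  qed
  have main: "S y \<in> M \<and> f_norm f k (S y) \<le> (1 - ll y) * f_norm f k y \<and> dist (S y) y \<le> (Lc * Wn) * f_norm f k y
      \<and> (ll y = 0 \<longrightarrow> S y = y) \<and> 0 \<le> ll y \<and> ll y \<le> 1" if y: "y \<in> K" for y
  proof (cases "y \<in> O1")
    case False
    then show ?thesis using y r Wn0 fn0 by (auto simp: S_def ll_def K)
  next
    case True
    have \<kappa>b: "\<kappa> y \<in> ball u0 r" using True by (simp add: O1_def)
    have st: "step (\<kappa> y) \<in> ball u0 r" by (rule step_in[OF y True])
    have "L2_set (\<lambda>i. F i (\<kappa> y - l (\<kappa> y) *\<^sub>R v (\<kappa> y))) {..<k} \<le> (1 - l (\<kappa> y) / 2) * L2_set (\<lambda>i. F i (\<kappa> y)) {..<k}"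
    proof (rule newton_step_decrease[OF convex_ball _ _ \<kappa>b v_def])
      show "F i differentiable (at z)" if "i < k" "z \<in> ball u0 r" for i z using Fd that rV by blast
      show "\<bar>frechet_derivative (F i) (at z) (w j) - (if i = j then 1 else 0)\<bar> \<le> 1 / (2 * (real k)\<^sup>2)"
        if "i < k" "j < k" "z \<in> ball u0 r" for i j z
        using W(3)[OF subsetD[OF rW that(3)]] that unfolding \<tau>_def by simp
      show "l (\<kappa> y) \<le> 1" using lh h0(2) order_trans by blast
    qed (use st l0 in \<open>simp_all add: step_def\<close>)
    moreover have "L2_set (\<lambda>i. F i (\<kappa> y)) {..<k} = f_norm f k y" by (simp add: F\<kappa>[OF True] f_norm_def)
    moreover have "f_norm f k (\<gamma> (step (\<kappa> y))) = L2_set (\<lambda>i. F i (step (\<kappa> y))) {..<k}"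
      by (simp add: f_norm_def \<gamma>M(2)[OF st] F_def)
    ultimately have 1: "f_norm f k (S y) \<le> (1 - ll y) * f_norm f k y"
      using True by (simp add: S_def ll_def step_def)
    have "dist (S y) y = dist (\<gamma> (step (\<kappa> y))) (\<gamma> (\<kappa> y))" using True \<gamma>\<kappa>[OF True] by (simp add: S_def)
    also have "\<dots> \<le> Lc * dist (step (\<kappa> y)) (\<kappa> y)" by (rule r(4)[OF st \<kappa>b])
    also have "dist (step (\<kappa> y)) (\<kappa> y) = l (\<kappa> y) * norm (v (\<kappa> y))" using l0 by (simp add: step_def dist_norm)
    also have "Lc * \<dots> \<le> Lc * (1 * (f_norm f k y * Wn))"
      using vn[OF True] lh[of "\<kappa> y"] h0(2) r(2) by (intro mult_left_mono mult_mono) auto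
    finally have 2: "dist (S y) y \<le> (Lc * Wn) * f_norm f k y" by (simp add: mult_ac)
    have "S y \<in> M" using True \<gamma>M(1)[OF st] by (simp add: S_def)
    moreover have "ll y = 0 \<longrightarrow> S y = y" using True \<gamma>\<kappa>[OF True] by (simp add: S_def ll_def step_def)
    moreover have "0 \<le> ll y" "ll y \<le> 1" using l0 lh[of "\<kappa> y"] h0(2) True by (auto simp: ll_def)
    ultimately show ?thesis using 1 2 by blast
  qed
  have SK: "S y \<in> K" if y: "y \<in> K" for y
  proof -
    have "(1 - ll y) * f_norm f k y \<le> 1 * f_norm f k y" using main[OF y] fn0 by (intro mult_right_mono) auto
    then show ?thesis using main[OF y] y by (simp add: K)
  qed
  have opO1: "openin (top_of_set M) O1"
  proof -
    have "openin X {x \<in> fst d. snd d x \<in> ball u0 r}" by (intro openin_chart_vimage d open_ball)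
    then have "openin (top_of_set M) {y \<in> topspace (top_of_set M). \<Psi> y \<in> {x \<in> fst d. snd d x \<in> ball u0 r}}"
      by (rule openin_continuous_map_preimage[OF continuous_\<Psi>])
    then show ?thesis by (simp add: O1_def \<kappa>_def Collect_conj_eq)
  qed
  then obtain T where T: "open T" "O1 = M \<inter> T" by (auto simp: openin_open)
  have cb: "cball u0 (r / 2) \<subseteq> ?V" using rV r(1) by (intro order_trans[OF _ rV]) auto
  have "compact (\<gamma> ` cball u0 (r / 2))"
  proof (rule compact_continuous_image[OF _ compact_cball])
    show "continuous_on (cball u0 (r / 2)) \<gamma>"
      using continuous_on_subset[OF continuous_on_\<Phi>_chart_inv[OF d(1)] cb] by (simp add: \<gamma>_def[abs_def])
  qed
  then have cl: "closed (\<gamma> ` cball u0 (r / 2))" by (rule compact_imp_closed)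
  \<comment> \<open>Two sets open in \<open>K\<close> cover it: on \<open>?K1\<close> the chart
    formula for \<open>S\<close> is continuous, on \<open>?K2\<close> the map is the identity. Both
    descriptions agree on the overlap because the cut-off already ends at r/3, whereas
    \<open>?K2\<close> omits the closed ball of radius r/2.\<close>
  let ?K1 = "K \<inter> T" and ?K2 = "K \<inter> - (\<gamma> ` cball u0 (r / 2))"
  have K1O: "?K1 \<subseteq> O1" using T(2) KM by blast
  have Kun: "?K1 \<union> ?K2 = K"
  proof -
    have "\<gamma> u \<in> O1" if "u \<in> cball u0 (r / 2)" for u
    proof -
      have ub: "u \<in> ball u0 r" using that r(1) by auto
      have uV: "u \<in> ?V" by (rule subsetD[OF rV ub])
      show ?thesis
        using \<gamma>M[OF ub] ub chart_inv_in[OF uV] chart_chart_inv[OF uV] by (simp add: O1_def \<kappa>_def)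
    qed
    then show ?thesis using T(2) by blast
  qed
  have K2id: "S y = y \<and> ll y = 0" if y: "y \<in> ?K2" for y
  proof (cases "y \<in> O1")
    case True
    have "\<kappa> y \<notin> cball u0 (r / 2)" using y \<gamma>\<kappa>[OF True] by (metis ComplD IntE imageI)
    then have "r / 3 \<le> dist (\<kappa> y) u0" using r(1) by (simp add: dist_commute)
    then have "l (\<kappa> y) = 0" by (rule lz)
    then show ?thesis using True \<gamma>\<kappa>[OF True] by (simp add: S_def ll_def step_def)
  qed (simp add: S_def ll_def)
  have c\<kappa>: "continuous_on ?K1 \<kappa>"
  proof -
    have "continuous_map (top_of_set ?K1) (subtopology X (fst d)) \<Psi>"
    proof (rule continuous_map_into_subtopology)
      show "continuous_map (top_of_set ?K1) X \<Psi>"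
        by (rule continuous_map_from_subtopology_mono[OF continuous_\<Psi>]) (use KM in blast)
      show "\<Psi> \<in> topspace (top_of_set ?K1) \<rightarrow> fst d" using K1O by (auto simp: O1_def)
    qed
    from continuous_map_compose[OF this continuous_chart[OF d(1)]]
    show ?thesis by (simp add: comp_def \<kappa>_def[abs_def])
  qed
  have \<kappa>K1: "\<kappa> ` ?K1 \<subseteq> ball u0 r" using K1O by (auto simp: O1_def)
  have cl': "continuous_on UNIV l" unfolding l_def using r(1) by (intro continuous_intros) auto
  have cst: "continuous_on (ball u0 r) step"
    unfolding step_def v_def
    by (intro continuous_intros continuous_on_subset[OF cl'] continuous_on_subset[OF Fc _] rV) auto
  have cst': "continuous_on ?K1 (\<lambda>y. step (\<kappa> y))" by (rule continuous_on_compose2[OF cst c\<kappa> \<kappa>K1])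
  have "continuous_on ?K1 (\<lambda>y. \<gamma> (step (\<kappa> y)))"
  proof (rule continuous_on_compose2[OF _ cst'])
    show "continuous_on (ball u0 r) \<gamma>"
      using continuous_on_subset[OF continuous_on_\<Phi>_chart_inv[OF d(1)] rV] by (simp add: \<gamma>_def[abs_def])
    show "(\<lambda>y. step (\<kappa> y)) ` ?K1 \<subseteq> ball u0 r" using step_in K1O by blast
  qed
  then have cS1: "continuous_on ?K1 S"
    by (rule continuous_on_eq) (use K1O in \<open>auto simp: S_def\<close>)
  have "continuous_on ?K1 (\<lambda>y. l (\<kappa> y) / 2)"
    by (intro continuous_intros continuous_on_compose2[OF cl' c\<kappa>]) auto
  then have cl1: "continuous_on ?K1 ll"
    by (rule continuous_on_eq) (use K1O in \<open>auto simp: ll_def\<close>)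
  have "continuous_on ?K2 (\<lambda>y. y)" by (rule continuous_on_id)
  then have cS2: "continuous_on ?K2 S" by (rule continuous_on_eq) (simp add: K2id)
  have "continuous_on ?K2 (\<lambda>y. 0::real)" by (rule continuous_on_const)
  then have cl2: "continuous_on ?K2 ll" by (rule continuous_on_eq) (simp add: K2id)
  have op: "openin (top_of_set (?K1 \<union> ?K2)) ?K1" "openin (top_of_set (?K1 \<union> ?K2)) ?K2"
    unfolding Kun using T(1) cl by (auto intro: openin_open_Int)
  have cS: "continuous_on K S" and cll: "continuous_on K ll"
    using continuous_on_Un_local_open[OF op cS1 cS2] continuous_on_Un_local_open[OF op cl1 cl2]
    unfolding Kun by auto
  have "push K (f_norm f k) S ll (Lc * Wn)"
    unfolding push_def
  proof (intro conjI ballI)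
    show "S ` K \<subseteq> K" using SK by blast
    show "0 \<le> Lc * Wn" using r(2) Wn0 by simp
  qed (use cS cll main in blast)+
  moreover have "0 < ll y0"
  proof -
    have "y0 \<in> O1" using y0 d(2) r(1) by (simp add: O1_def K \<kappa>_def u0_def)
    moreover have "l (\<kappa> y0) = h0" by (simp add: l_def \<kappa>_def u0_def)
    ultimately show ?thesis using h0(1) by (simp add: ll_def)
  qed
  ultimately show ?thesis by blast
qed

end

section \<open>Choice of the constants and proof of the Betti number bound\<close>

theorem theoremA:
  fixes X :: "'a topology"
    and A :: "('a, 'e::{real_inner, heine_borel}) chart set"
    and g :: "'a \<Rightarrow> ('a, 'e) tvector \<Rightarrow> ('a, 'e) tvector \<Rightarrow> real"
    and m :: nat
  assumes "smooth_manifold m X A"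
    and "compact_space X"
    and "riemannian_metric X A g"
  shows "\<exists>c1::real. 0 < c1 \<and> (\<forall>k::nat. 1 \<le> k \<longrightarrow> (\<forall>f\<in>C1_maps X A k.
           0 < dist_discriminant X A g k f \<longrightarrow>
           total_betti (subtopology X (zero_set X k f))
             \<le> ennreal c1 * (C1_norm X A g k f / dist_discriminant X A g k f) ^ m))"
proof -
  interpret compact_manifold X A m using assms(1,2) by unfold_locales
  obtain q :: nat and c p \<rho> where cov: "\<And>i. i < q \<Longrightarrow> c i \<in> A" "\<And>i. i < q \<Longrightarrow> (0::real) < \<rho> i"
    "\<And>i. i < q \<Longrightarrow> cball (p i) (3 * \<rho> i) \<subseteq> chart_image (c i)"
    "\<And>x. x \<in> topspace X \<Longrightarrow> \<exists>i<q. x \<in> fst (c i) \<and> snd (c i) x \<in> ball (p i) (\<rho> i)"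
    by (rule finite_chart_cover) blast
  interpret charted_manifold X A m q c p \<rho> by unfold_locales (use cov in auto)
  obtain C where at: "lipschitz_atlas M q a_coord t_coord G C" using lipschitz_atlas_ex by blast
  interpret atl: lipschitz_atlas M q a_coord t_coord G C by (rule at)
  obtain B :: "'e set" where B: "finite B" "orthonormal B" "span B = UNIV" "card B = m"
    using orthonormal_basis by metis
  obtain c0 D \<eta> where c0: "0 < c0" "1 \<le> D" "0 < \<eta>" "\<eta> \<le> 1"
    and betti: "\<And>\<epsilon> Z U r. 0 < \<epsilon> \<Longrightarrow> \<epsilon> \<le> \<eta> \<Longrightarrow> Z \<subseteq> M \<Longrightarrow> \<forall>x\<in>M. \<forall>z\<in>Z. dist x z \<le> D * \<epsilon> \<longrightarrow> x \<in> U \<Longrightarrow>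
      continuous_on U r \<Longrightarrow> r ` U \<subseteq> Z \<Longrightarrow> \<forall>z\<in>Z. r z = z \<Longrightarrow> total_betti (top_of_set Z) \<le> ennreal (c0 / \<epsilon> ^ m)"
    using atl.total_betti_retract_bound[OF B(1-3)] unfolding B(4) by metis
  obtain K0 where K0: "1 \<le> K0" and lip: "\<And>k f L i u u'. f \<in> C1_maps X A k \<Longrightarrow> 0 \<le> L \<Longrightarrow> C1_norm X A g k f \<le> ennreal L \<Longrightarrow>
      i < q \<Longrightarrow> u \<in> cball (p i) (3 * \<rho> i) \<Longrightarrow> u' \<in> cball (p i) (3 * \<rho> i) \<Longrightarrow>
      L2_set (\<lambda>j. f (chart_inv (c i) u) j - f (chart_inv (c i) u') j) {..<k} \<le> K0 * L * dist u u'"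
    by (rule C1_lipschitz_in_charts[OF assms(3)]) blast
  \<comment> \<open>\<open>G i\<close> rescales its chart by \<open>\<rho> i\<close>;
    \<open>R\<close> bounds all these factors.\<close>
  define R where "R = 1 + (\<Sum>i<q. \<rho> i)"
  have R: "1 \<le> R" "\<And>i. i < q \<Longrightarrow> \<rho> i \<le> R"
  proof -
    have "0 \<le> (\<Sum>i<q. \<rho> i)" using cov(2) by (intro sum_nonneg less_imp_le) auto
    then show "1 \<le> R" by (simp add: R_def)
    fix i assume "i < q"
    then have "\<rho> i \<le> (\<Sum>i<q. \<rho> i)" using cov(2) by (intro member_le_sum) (auto simp: less_imp_le)
    then show "\<rho> i \<le> R" by (simp add: R_def)
  qed
  define K1 where "K1 = K0 * R"
  have K1: "1 \<le> K1" using mult_mono[of 1 K0 1 R] K0 R(1) by (simp add: K1_def)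
  \<comment> \<open>By the Lipschitz bound 8 K1 L, points within D \<epsilon> of a zero have |f|
    \<le> 8 K1 L D \<epsilon>; for \<epsilon> = h \<delta> / L this is at most \<delta>/2 once 16 K1
    D h \<le> 1. With h \<le> \<eta> and \<delta> \<le> L, also \<epsilon> \<le> \<eta>.\<close>
  define h where "h = min \<eta> (1 / (16 * K1 * D))"
  have h: "0 < h" "h \<le> \<eta>" "16 * K1 * D * h \<le> 1"
  proof -
    show "0 < h" "h \<le> \<eta>" using c0 K1 by (auto simp: h_def)
    have "16 * K1 * D * h \<le> 16 * K1 * D * (1 / (16 * K1 * D))"
      using c0 K1 by (intro mult_left_mono) (auto simp: h_def)
    then show "16 * K1 * D * h \<le> 1" using c0 K1 by simp
  qed
  have "total_betti (subtopology X (zero_set X k f))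
      \<le> ennreal (c0 / h ^ m) * (C1_norm X A g k f / dist_discriminant X A g k f) ^ m"
    if k: "1 \<le> k" and f: "f \<in> C1_maps X A k" and dpos: "0 < dist_discriminant X A g k f" for k f
  proof (cases "zero_set X k f = {}")
    case True
    then show ?thesis by (simp add: total_betti_empty)
  next
    case False
    let ?Z = "zero_set X k f"
    let ?d = "dist_discriminant X A g k f"
    have Zfn: "L2_set (f z) {..<k} = 0" if "z \<in> ?Z" for z
      using that by (simp add: zero_set_def L2_set_def)
    have ZX: "?Z \<subseteq> topspace X" by (auto simp: zero_set_def)
    then have Xne: "topspace X \<noteq> {}" using False by blast
    \<comment> \<open>Such a point makes the distance to the discriminant finite; the value of f
      there also yields \<delta> \<le> L below.\<close>
    obtain x1 where x1: "x1 \<in> topspace X" "diff_rank A k f x1 < k"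
      using rank_deficient_point_ex[OF f k Xne] by blast
    have dfin: "?d \<le> ennreal (L2_set (f x1) {..<k})" by (rule dist_discriminant_le[OF f x1])
    then have "?d < \<infinity>" by (simp add: order_le_less_trans less_top)
    then obtain \<delta> where \<delta>: "?d = ennreal \<delta>" "0 < \<delta>"
      using dpos by (cases ?d) auto
    have full: "\<not> diff_rank A k f x < k" if "x \<in> topspace X" "L2_set (f x) {..<k} < \<delta>" for x
    proof
      assume rank: "diff_rank A k f x < k"
      have "ennreal \<delta> \<le> ennreal (L2_set (f x) {..<k})"
        unfolding \<delta>(1)[symmetric] by (rule dist_discriminant_le[OF f that(1) rank])
      then show False using that(2) by simp
    qed
    show ?thesis
    proof (cases "C1_norm X A g k f")
      case top
      \<comment> \<open>An infinite norm makes the right-hand side infinite unless m = 0, when the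
        power is 1. In dimension 0 a derivative cannot have rank k \<ge> 1, whereas \<delta> > 0
        forces this rank at a zero.\<close>
      have "m \<noteq> 0"
      proof
        assume "m = 0"
        then have "B = {}" using B by simp
        then have triv: "v = 0" for v :: 'e using B(3) by auto
        obtain z where z: "z \<in> ?Z" using False by blast
        have zX: "z \<in> topspace X" using z ZX by blast
        have "\<not> diff_rank A k f z < k" using full[OF zX] Zfn[OF z] \<delta>(2) by simp
        then obtain d w where d: "d \<in> A" "z \<in> fst d" and w: "\<And>i j. i < k \<Longrightarrow> j < k \<Longrightarrow>
            frechet_derivative (\<lambda>u. f (chart_inv d u) i) (at (snd d z)) (w j) = (if i = j then 1 else 0)"
          using full_rank_preimages[OF f zX] by metis
        have lin: "linear (frechet_derivative (\<lambda>u. f (chart_inv d u) 0) (at (snd d z)))"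
          using k by (intro linear_frechet_derivative C1_mapsD(2)[OF f d(1)] chart_in_image d) auto
        show False using w[of 0 0] k triv[of "w 0"] linear_0[OF lin] by simp
      qed
      then have "(C1_norm X A g k f / ?d) ^ m = \<infinity>"
        using top \<delta> by (simp add: ennreal_top_divide power_eq_top_ennreal)
      then show ?thesis using c0 h by (simp add: ennreal_mult_top)
    next
      case (real L)
      then have L0: "0 \<le> L" and L: "C1_norm X A g k f \<le> ennreal L" by auto
      have "ennreal \<delta> \<le> ennreal (L2_set (f x1) {..<k})" using dfin \<delta>(1) by simp
      then have "\<delta> \<le> L2_set (f x1) {..<k}" by simp
      also have "\<dots> \<le> L" by (rule value_le_C1_norm[OF L L0 x1(1)])
      finally have \<delta>L: "\<delta> \<le> L" .
      define \<epsilon> where "\<epsilon> = h * \<delta> / L"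
      have Lpos: "0 < L" using \<delta>(2) \<delta>L by linarith
      have \<epsilon>: "0 < \<epsilon>" "\<epsilon> \<le> \<eta>"
      proof -
        show "0 < \<epsilon>" using h \<delta> Lpos by (simp add: \<epsilon>_def)
        have "h * \<delta> / L \<le> h * 1" using h \<delta>L Lpos by (simp add: field_simps)
        then show "\<epsilon> \<le> \<eta>" using h by (simp add: \<epsilon>_def)
      qed
      define fd where "fd x x' = L2_set (\<lambda>j. f (\<Psi> x) j - f (\<Psi> x') j) {..<k}" for x x'
      have fdle: "fd x x' \<le> 8 * (K1 * L) * dist x x'" if "x \<in> M" "x' \<in> M" for x x'
      proof (rule atl.pseudodist_le_if_local[OF _ _ _ that])
        show "0 \<le> K1 * L" using K1 L0 by simp
        fix i :: nat and u u' :: 'e assume i: "i < q" and u: "norm u \<le> 3" "norm u' \<le> 3"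
        let ?s = "\<lambda>u. p i + \<rho> i *\<^sub>R u"
        have sc: "?s u \<in> cball (p i) (3 * \<rho> i)" "?s u' \<in> cball (p i) (3 * \<rho> i)"
          using scaled_in_cball[OF i] u by auto
        have inX: "chart_inv (c i) z \<in> topspace X" if "z \<in> cball (p i) (3 * \<rho> i)" for z
          by (rule subsetD[OF chart_subset[OF cov(1)[OF i]] chart_inv_in[OF subsetD[OF cov(3)[OF i] that]]])
        have "fd (G i u) (G i u') = L2_set (\<lambda>j. f (chart_inv (c i) (?s u)) j - f (chart_inv (c i) (?s u')) j) {..<k}"
          unfolding fd_def G_def by (simp add: \<Psi>_\<Phi>[OF inX[OF sc(1)]] \<Psi>_\<Phi>[OF inX[OF sc(2)]])
        also have "\<dots> \<le> K0 * L * dist (?s u) (?s u')" by (rule lip[OF f L0 L i sc])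
        also have "\<dots> = K0 * L * dist u u' * \<rho> i"
          unfolding dist_affine[OF cov(2)[OF i]] by (simp only: mult_ac)
        also have "\<dots> \<le> K0 * L * dist u u' * R"
          using R(2)[OF i] K0 L0 by (intro mult_left_mono) auto
        finally show "fd (G i u) (G i u') \<le> K1 * L * dist u u'" by (simp add: K1_def mult_ac)
      next
        fix x x' assume x: "x \<in> M" "x' \<in> M"
        have "fd x x' \<le> L2_set (f (\<Psi> x)) {..<k} + L2_set (\<lambda>j. - f (\<Psi> x') j) {..<k}"
          unfolding fd_def using L2_set_triangle_ineq[of "f (\<Psi> x)" "\<lambda>j. - f (\<Psi> x') j" "{..<k}"] by simp
        also have "\<dots> = L2_set (f (\<Psi> x)) {..<k} + L2_set (f (\<Psi> x')) {..<k}" by (simp add: L2_set_def)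
        also have "\<dots> \<le> L + L" by (intro add_mono value_le_C1_norm[OF L L0] \<Psi>_in x)
        also have "\<dots> \<le> 2 * (K1 * L)" using K1 L0 mult_right_mono[of 1 K1 L] by simp
        finally show "fd x x' \<le> 2 * (K1 * L)" .
      qed
      \<comment> \<open>The level \<delta>/2 gives a closed condition, so that \<open>U\<close> is
        compact, and lies strictly below \<delta>, so that the derivative has full rank on
        \<open>U\<close>.\<close>
      define U where "U = {y \<in> M. f_norm f k y \<le> \<delta> / 2}"
      have contU: "continuous_on U (f_norm f k)"
        by (rule continuous_on_subset[OF continuous_on_f_norm[OF f]]) (auto simp: U_def)
      have "U = M \<inter> f_norm f k -` {..\<delta> / 2}" by (auto simp: U_def)
      then have "compact U"
        using closedin_compact[OF compact_M continuous_closedin_preimage[OF continuous_on_f_norm[OF f] closed_atMost]]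
        by simp
      then obtain r where r: "continuous_on U r" "r ` U \<subseteq> {x \<in> U. f_norm f k x = 0}" "\<forall>x\<in>U. f_norm f k x = 0 \<longrightarrow> r x = x"
      proof -
        have "\<exists>r. continuous_on U r \<and> r ` U \<subseteq> {x \<in> U. f_norm f k x = 0} \<and> (\<forall>x\<in>U. f_norm f k x = 0 \<longrightarrow> r x = x)"
        proof (rule zero_set_retract_if_push[OF \<open>compact U\<close> contU])
          show "0 \<le> f_norm f k x" for x by (simp add: f_norm_def)
          fix y assume y: "y \<in> U"
          have "\<not> diff_rank A k f (\<Psi> y) < k"
            using y \<delta>(2) \<Psi>_in by (intro full) (auto simp: U_def f_norm_def)
          then show "\<exists>S l C. push U (f_norm f k) S l C \<and> 0 < l y"
            using push_ex[OF f _ U_def y] \<delta>(2) by simp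
        qed
        then show thesis using that by blast
      qed
      have ZU: "\<Phi> ` ?Z = {x \<in> U. f_norm f k x = 0}"
      proof (intro equalityI subsetI)
        fix y assume "y \<in> \<Phi> ` ?Z"
        then obtain z where z: "z \<in> ?Z" "y = \<Phi> z" by blast
        have "z \<in> topspace X" using z ZX by blast
        then show "y \<in> {x \<in> U. f_norm f k x = 0}"
          using Zfn[OF z(1)] \<delta>(2) z(2) by (simp add: U_def f_norm_def \<Psi>_\<Phi> M_def)
      next
        fix y assume "y \<in> {x \<in> U. f_norm f k x = 0}"
        then have y: "y \<in> M" "L2_set (f (\<Psi> y)) {..<k} = 0" by (auto simp: U_def f_norm_def)
        then have "\<Psi> y \<in> ?Z" using \<Psi>_in by (simp add: zero_set_def L2_set_eq_0_iff)
        then show "y \<in> \<Phi> ` ?Z" using \<Phi>_\<Psi>[OF y(1)] by (metis imageI)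
      qed
      have "total_betti (subtopology X ?Z) \<le> total_betti (top_of_set (\<Phi> ` ?Z))" by (rule total_betti_\<Phi>[OF ZX])
      also have "\<dots> \<le> ennreal (c0 / \<epsilon> ^ m)"
      proof (rule betti[OF \<epsilon>, of _ U r])
        show "\<Phi> ` ?Z \<subseteq> M" using ZX by (auto simp: M_def)
        show "\<forall>x\<in>M. \<forall>z\<in>\<Phi> ` ?Z. dist x z \<le> D * \<epsilon> \<longrightarrow> x \<in> U"
        proof (intro ballI impI)
          fix x z assume x: "x \<in> M" and z: "z \<in> \<Phi> ` ?Z" and xz: "dist x z \<le> D * \<epsilon>"
          have zM: "z \<in> M" using z ZX by (auto simp: M_def)
          have "f (\<Psi> z) j = 0" if "j < k" for j
            using z that ZX by (auto simp: zero_set_def \<Psi>_\<Phi>)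
          then have "f_norm f k x = fd x z" unfolding f_norm_def fd_def by (intro L2_set_cong) auto
          also have "\<dots> \<le> 8 * (K1 * L) * dist x z" by (rule fdle[OF x zM])
          also have "\<dots> \<le> 8 * (K1 * L) * (D * \<epsilon>)" using xz K1 L0 by (intro mult_left_mono) auto
          also have "\<dots> = (16 * K1 * D * h) * (\<delta> / 2)" using Lpos by (simp add: \<epsilon>_def)
          also have "\<dots> \<le> 1 * (\<delta> / 2)" using h \<delta> by (intro mult_right_mono) auto
          finally show "x \<in> U" using x by (simp add: U_def)
        qed
      qed (use r in \<open>auto simp: ZU\<close>)
      also have "c0 / \<epsilon> ^ m = (c0 / h ^ m) * (L / \<delta>) ^ m"
        using h \<delta> Lpos by (simp add: \<epsilon>_def power_divide power_mult_distrib field_simps)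
      also have "ennreal \<dots> = ennreal (c0 / h ^ m) * (ennreal L / ennreal \<delta>) ^ m"
      proof -
        have "ennreal (c0 / h ^ m * (L / \<delta>) ^ m) = ennreal (c0 / h ^ m) * ennreal ((L / \<delta>) ^ m)"
          using c0 h \<delta> L0 by (intro ennreal_mult) auto
        also have "ennreal ((L / \<delta>) ^ m) = (ennreal L / ennreal \<delta>) ^ m"
          using \<delta> L0 by (simp add: divide_ennreal ennreal_power)
        finally show ?thesis .
      qed
      finally show ?thesis using real \<delta> by simp
    qed
  qed
  moreover have "0 < c0 / h ^ m" using c0 h by simp
  ultimately show ?thesis by blast
qed

end
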